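(* Let $n\ge 1$ be an integer and let $p(n)$ denote the number of conjugacy classes of the symmetric group $S_n$ (equivalently, the number of partitions of the integer $n$). Then the $n$-homogeneous C*-algebra $C(S^1,M_n)$ over the circle $S^1$ has, up to equivalence, exactly $p(n)$ Cartan subalgebras; i.e. there are exactly $p(n)$ equivalence classes of Cartan subalgebras of $C(S^1,M_n)$.
   Context: $M_n=M_n(\mathbb C)$. A Cartan subalgebra of a C*-algebra $A$ is an abelian sub-C*-algebra $B \subseteq A$ such that (1) $B$ contains an approximate unit of $A$; (2) $B$ is maximal abelian in $A$; (3) $B$ is regular, i.e. $N_A(B)=\{n\in A : nBn^*\subseteq B \text{ and } n^*Bn\subseteq B\}$ generates $A$ as a C*-algebra; (4) there exists a faithful conditional expectation of $A$ onto $B$. Two Cartan subalgebras $B_1,B_2$ of $A$ are equivalent if there is an automorphism $\varphi$ of $A$ with $\varphi(B_1)=B_2$. *)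

theory Defs
  imports
    "HOL-Analysis.Analysis"
    "HOL-Algebra.Sym_Groups"
    "HOL-Algebra.Group_Action"
begin

section \<open>C*-algebras\<close>

text \<open>Not necessarily unital complex C*-algebras. The real scalar multiplication is the one
  inherited from \<^class>\<open>banach\<close>; it is the restriction of the complex one.\<close>

class cstar_algebra = banach + real_normed_algebra +
  fixes scaleC :: "complex \<Rightarrow> 'a \<Rightarrow> 'a"  (infixr "*\<^sub>C" 75)
    and star :: "'a \<Rightarrow> 'a"  ("_\<^sup>\<star>" [1000] 999)
  assumes scaleC_add_right: "c *\<^sub>C (x + y) = c *\<^sub>C x + c *\<^sub>C y"
    and scaleC_add_left: "(c + d) *\<^sub>C x = c *\<^sub>C x + d *\<^sub>C x"
    and scaleC_scaleC: "c *\<^sub>C (d *\<^sub>C x) = (c * d) *\<^sub>C x"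
    and scaleC_of_real: "complex_of_real r *\<^sub>C x = r *\<^sub>R x"
    and mult_scaleC_left: "(c *\<^sub>C x) * y = c *\<^sub>C (x * y)"
    and mult_scaleC_right: "x * (c *\<^sub>C y) = c *\<^sub>C (x * y)"
    and norm_scaleC: "norm (c *\<^sub>C x) = cmod c * norm x"
    and star_star: "(x\<^sup>\<star>)\<^sup>\<star> = x"
    and star_add: "(x + y)\<^sup>\<star> = x\<^sup>\<star> + y\<^sup>\<star>"
    and star_scaleC: "(c *\<^sub>C x)\<^sup>\<star> = cnj c *\<^sub>C x\<^sup>\<star>"
    and star_mult: "(x * y)\<^sup>\<star> = y\<^sup>\<star> * x\<^sup>\<star>"
    and cstar_identity: "norm (x\<^sup>\<star> * x) = (norm x)\<^sup>2"

definition positive_element :: "'a::cstar_algebra \<Rightarrow> bool" where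
  "positive_element a \<longleftrightarrow> (\<exists>x. a = x\<^sup>\<star> * x)"

definition cstar_subalgebra :: "'a::cstar_algebra set \<Rightarrow> bool" where
  "cstar_subalgebra B \<longleftrightarrow>
     0 \<in> B \<and> (\<forall>x\<in>B. \<forall>y\<in>B. x + y \<in> B) \<and> (\<forall>x\<in>B. \<forall>y\<in>B. x * y \<in> B) \<and>
     (\<forall>c. \<forall>x\<in>B. c *\<^sub>C x \<in> B) \<and> (\<forall>x\<in>B. x\<^sup>\<star> \<in> B) \<and> closed B"

definition cstar_generated :: "'a::cstar_algebra set \<Rightarrow> 'a set" where
  "cstar_generated S = \<Inter>{B. cstar_subalgebra B \<and> S \<subseteq> B}"

definition abelian_cstar_subalgebra :: "'a::cstar_algebra set \<Rightarrow> bool" where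
  "abelian_cstar_subalgebra B \<longleftrightarrow> cstar_subalgebra B \<and> (\<forall>x\<in>B. \<forall>y\<in>B. x * y = y * x)"

definition maximal_abelian :: "'a::cstar_algebra set \<Rightarrow> bool" where
  "maximal_abelian B \<longleftrightarrow> abelian_cstar_subalgebra B \<and>
     (\<forall>C. abelian_cstar_subalgebra C \<and> B \<subseteq> C \<longrightarrow> C = B)"

text \<open>An approximate unit is a net of positive contractions along which left and right
  multiplication converge pointwise to the identity. The net is represented by its filter of
  tails (every proper filter is the filter of tails of some net), which avoids quantifying over
  the type of the index set.\<close>

definition contains_approximate_unit :: "'a::cstar_algebra set \<Rightarrow> bool" where
  "contains_approximate_unit B \<longleftrightarrow>
     (\<exists>F. F \<noteq> bot \<and> (\<forall>\<^sub>F e in F. e \<in> B \<and> positive_element e \<and> norm e \<le> 1) \<and>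
       (\<forall>a. ((\<lambda>e. e * a) \<longlongrightarrow> a) F \<and> ((\<lambda>e. a * e) \<longlongrightarrow> a) F))"

definition cstar_normalizer :: "'a::cstar_algebra set \<Rightarrow> 'a set" where
  "cstar_normalizer B = {n. (\<forall>b\<in>B. n * b * n\<^sup>\<star> \<in> B) \<and> (\<forall>b\<in>B. n\<^sup>\<star> * b * n \<in> B)}"

text \<open>Complete positivity is not listed: it follows from positivity when \<open>B\<close> is abelian, the only
  case used below.\<close>

definition conditional_expectation_onto :: "'a::cstar_algebra set \<Rightarrow> ('a \<Rightarrow> 'a) \<Rightarrow> bool" where
  "conditional_expectation_onto B E \<longleftrightarrow>
     (\<forall>a. E a \<in> B) \<and> (\<forall>b\<in>B. E b = b) \<and>
     (\<forall>x y. E (x + y) = E x + E y) \<and> (\<forall>c x. E (c *\<^sub>C x) = c *\<^sub>C E x) \<and>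
     (\<forall>a. positive_element a \<longrightarrow> positive_element (E a)) \<and>
     (\<forall>a. norm (E a) \<le> norm a) \<and>
     (\<forall>b\<in>B. \<forall>a. E (b * a) = b * E a \<and> E (a * b) = E a * b)"

definition faithful_map :: "('a::cstar_algebra \<Rightarrow> 'a) \<Rightarrow> bool" where
  "faithful_map E \<longleftrightarrow> (\<forall>a. positive_element a \<and> E a = 0 \<longrightarrow> a = 0)"

definition cartan_subalgebra :: "'a::cstar_algebra set \<Rightarrow> bool" where
  "cartan_subalgebra B \<longleftrightarrow>
     abelian_cstar_subalgebra B \<and>
     contains_approximate_unit B \<and>
     maximal_abelian B \<and>
     cstar_generated (cstar_normalizer B) = UNIV \<and>
     (\<exists>E. conditional_expectation_onto B E \<and> faithful_map E)"

definition cstar_automorphism :: "('a::cstar_algebra \<Rightarrow> 'a) \<Rightarrow> bool" where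
  "cstar_automorphism \<phi> \<longleftrightarrow> bij \<phi> \<and>
     (\<forall>x y. \<phi> (x + y) = \<phi> x + \<phi> y) \<and> (\<forall>c x. \<phi> (c *\<^sub>C x) = c *\<^sub>C \<phi> x) \<and>
     (\<forall>x y. \<phi> (x * y) = \<phi> x * \<phi> y) \<and> (\<forall>x. \<phi> (x\<^sup>\<star>) = (\<phi> x)\<^sup>\<star>)"

definition cartan_equivalence :: "('a::cstar_algebra set \<times> 'a set) set" where
  "cartan_equivalence = {(B\<^sub>1, B\<^sub>2). cartan_subalgebra B\<^sub>1 \<and> cartan_subalgebra B\<^sub>2 \<and>
     (\<exists>\<phi>. cstar_automorphism \<phi> \<and> \<phi> ` B\<^sub>1 = B\<^sub>2)}"


section \<open>Conjugacy classes\<close>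

definition conjugacy_classes :: "('a, 'b) monoid_scheme \<Rightarrow> 'a set set" where
  "conjugacy_classes G =
     orbits G (carrier G) (\<lambda>g. \<lambda>h \<in> carrier G. g \<otimes>\<^bsub>G\<^esub> h \<otimes>\<^bsub>G\<^esub> (inv\<^bsub>G\<^esub> g))"


section \<open>Complex matrices with the operator norm\<close>

definition conj_transpose :: "complex^'n^'m \<Rightarrow> complex^'m^'n" where
  "conj_transpose A = (\<chi> i j. cnj (A $ j $ i))"

definition opnorm :: "complex^'n^'n \<Rightarrow> real" where
  "opnorm A = onorm ((*v) A)"

lemma opnorm: "norm (A *v x) \<le> opnorm A * norm x"
  unfolding opnorm_def by (rule onorm) simp

lemma opnorm_nonneg [simp]: "0 \<le> opnorm A"
  unfolding opnorm_def by (rule onorm_pos_le) simp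

lemma opnorm_le: "0 \<le> b \<Longrightarrow> (\<And>x. norm (A *v x) \<le> b * norm x) \<Longrightarrow> opnorm A \<le> b"
  unfolding opnorm_def by (rule onorm_le)

lemma opnorm_zero [simp]: "opnorm 0 = 0"
  by (rule antisym[OF opnorm_le opnorm_nonneg]) auto

lemma opnorm_entry_le: "cmod (A $ i $ j) \<le> opnorm A"
proof -
  have "A $ i $ j = (A *v axis j 1) $ i"
    by (simp add: matrix_vector_mult_def axis_def if_distrib [of "(*) _"] cong: if_cong)
  then have "cmod (A $ i $ j) \<le> norm (A *v axis j 1)"
    by (metis Finite_Cartesian_Product.norm_nth_le)
  also have "\<dots> \<le> opnorm A * norm (axis j (1::complex))"
    by (rule opnorm)
  finally show ?thesis
    by (simp add: norm_vec_def L2_set_def axis_def if_distrib[of "\<lambda>x. (cmod x)\<^sup>2"]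
        cong: if_cong)
qed

lemma norm_le_opnorm: "norm (A::complex^'n^'n) \<le> (real CARD('n))\<^sup>2 * opnorm A"
proof -
  have "norm A \<le> (\<Sum>i\<in>UNIV. norm (A $ i))"
    unfolding norm_vec_def by (rule L2_set_le_sum) simp
  also have "\<dots> \<le> (\<Sum>i\<in>(UNIV::'n set). \<Sum>j\<in>(UNIV::'n set). norm (A $ i $ j))"
    unfolding norm_vec_def by (intro sum_mono L2_set_le_sum) simp
  also have "\<dots> \<le> (\<Sum>i\<in>(UNIV::'n set). \<Sum>j\<in>(UNIV::'n set). opnorm A)"
    by (intro sum_mono opnorm_entry_le)
  finally show ?thesis by (simp add: power2_eq_square)
qed

lemma opnorm_le_norm: "opnorm (A::complex^'n^'n) \<le> (real CARD('n))\<^sup>2 * norm A"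
proof (rule opnorm_le)
  fix x :: "complex^'n"
  have "norm (A *v x) \<le> (\<Sum>i\<in>UNIV. norm ((A *v x) $ i))"
    unfolding norm_vec_def by (rule L2_set_le_sum) simp
  also have "\<dots> \<le> (\<Sum>i\<in>(UNIV::'n set). \<Sum>j\<in>(UNIV::'n set). norm (A $ i $ j) * norm (x $ j))"
    unfolding matrix_vector_mult_def
    by (intro sum_mono) (auto intro!: sum_norm_le simp: norm_mult)
  also have "\<dots> \<le> (\<Sum>i\<in>(UNIV::'n set). \<Sum>j\<in>(UNIV::'n set). norm A * norm x)"
    by (intro sum_mono mult_mono) (auto intro: order_trans[OF Finite_Cartesian_Product.norm_nth_le
        Finite_Cartesian_Product.norm_nth_le] Finite_Cartesian_Product.norm_nth_le)
  finally show "norm (A *v x) \<le> (real CARD('n))\<^sup>2 * norm A * norm x"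
    by (simp add: power2_eq_square algebra_simps)
qed simp

lemma opnorm_eq_0_iff [simp]: "opnorm A = 0 \<longleftrightarrow> A = 0"
proof
  assume "opnorm A = 0"
  then have "norm A \<le> 0" using norm_le_opnorm[of A] by simp
  then show "A = 0" by simp
qed simp

lemma opnorm_triangle: "opnorm (A + B) \<le> opnorm A + opnorm B"
proof (rule opnorm_le)
  fix x
  have "norm ((A + B) *v x) \<le> norm (A *v x) + norm (B *v x)"
    by (simp add: matrix_vector_mult_add_rdistrib norm_triangle_ineq)
  also have "\<dots> \<le> opnorm A * norm x + opnorm B * norm x"
    by (intro add_mono opnorm)
  finally show "norm ((A + B) *v x) \<le> (opnorm A + opnorm B) * norm x"
    by (simp add: algebra_simps)
qed simp

definition matscale :: "complex \<Rightarrow> complex^'n^'m \<Rightarrow> complex^'n^'m" where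
  "matscale c A = (\<chi> i j. c * A $ i $ j)"

lemma norm_cvec_scale: "norm (c *s (x::complex^'n)) = cmod c * norm x"
  by (simp add: norm_vec_def norm_mult L2_set_right_distrib)

lemma matscale_mult_vec: "matscale c A *v x = c *s (A *v x)"
  by (simp add: matscale_def matrix_vector_mult_def vec_eq_iff sum_distrib_left mult.assoc)

lemma matscale_matscale: "matscale c (matscale d A) = matscale (c * d) A"
  by (simp add: matscale_def vec_eq_iff)

lemma matscale_zero [simp]: "matscale c 0 = 0"
  by (simp add: matscale_def vec_eq_iff)

lemma matscale_one [simp]: "matscale 1 A = A"
  by (simp add: matscale_def vec_eq_iff)

lemma opnorm_matscale: "opnorm (matscale c A) = cmod c * opnorm A"
proof -
  have le: "opnorm (matscale c A) \<le> cmod c * opnorm A" for c and A :: "complex^'n^'n"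
    by (rule opnorm_le)
       (auto simp: matscale_mult_vec norm_cvec_scale mult.assoc intro!: mult_left_mono opnorm)
  show ?thesis
  proof (cases "c = 0")
    case True
    then have "matscale c A = 0" by (simp add: matscale_def vec_eq_iff)
    with True show ?thesis by simp
  next
    case False
    have "opnorm A = opnorm (matscale (inverse c) (matscale c A))"
      using False by (simp add: matscale_matscale)
    also have "\<dots> \<le> inverse (cmod c) * opnorm (matscale c A)"
      using le[of "inverse c"] by (simp add: norm_inverse)
    finally have "cmod c * opnorm A \<le> opnorm (matscale c A)"
      using False by (simp add: field_simps)
    with le[of c A] show ?thesis by simp
  qed
qed

lemma opnorm_mult: "opnorm (A ** B) \<le> opnorm A * opnorm B"
proof (rule opnorm_le)
  fix x
  have "norm ((A ** B) *v x) \<le> opnorm A * norm (B *v x)"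
    by (simp add: matrix_vector_mul_assoc [symmetric] opnorm)
  also have "\<dots> \<le> opnorm A * (opnorm B * norm x)"
    by (intro mult_left_mono opnorm) simp
  finally show "norm ((A ** B) *v x) \<le> opnorm A * opnorm B * norm x"
    by (simp add: mult.assoc)
qed simp

lemma inner_conj_transpose: "(A *v x) \<bullet> y = x \<bullet> (conj_transpose A *v (y::complex^'n))"
proof -
  have "(A *v x) \<bullet> y = (\<Sum>i\<in>UNIV. \<Sum>j\<in>UNIV. (A $ i $ j * x $ j) \<bullet> (y $ i))"
    by (simp add: inner_vec_def matrix_vector_mult_def inner_sum_left)
  also have "\<dots> = (\<Sum>j\<in>UNIV. \<Sum>i\<in>UNIV. (A $ i $ j * x $ j) \<bullet> (y $ i))"
    by (rule sum.swap)
  also have "\<dots> = (\<Sum>j\<in>UNIV. \<Sum>i\<in>UNIV. (x $ j) \<bullet> (cnj (A $ i $ j) * y $ i))"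
    by (intro sum.cong refl) (simp add: inner_complex_def algebra_simps)
  also have "\<dots> = x \<bullet> (conj_transpose A *v y)"
    by (simp add: inner_vec_def matrix_vector_mult_def inner_sum_right conj_transpose_def)
  finally show ?thesis .
qed

lemma conj_transpose_zero [simp]: "conj_transpose 0 = 0"
  by (simp add: conj_transpose_def vec_eq_iff)

lemma conj_transpose_conj_transpose [simp]: "conj_transpose (conj_transpose A) = A"
  by (simp add: conj_transpose_def vec_eq_iff)

lemma opnorm_sq_le: "(opnorm A)\<^sup>2 \<le> opnorm (conj_transpose A ** A)"
proof -
  let ?m = "opnorm (conj_transpose A ** A)"
  have "opnorm A \<le> sqrt ?m"
  proof (rule opnorm_le)
    fix x
    have "(norm (A *v x))\<^sup>2 = x \<bullet> ((conj_transpose A ** A) *v x)"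
      by (simp add: power2_norm_eq_inner inner_conj_transpose matrix_vector_mul_assoc)
    also have "\<dots> \<le> norm x * norm ((conj_transpose A ** A) *v x)"
      by (rule norm_cauchy_schwarz)
    also have "\<dots> \<le> norm x * (?m * norm x)"
      by (intro mult_left_mono opnorm) simp
    finally have "(norm (A *v x))\<^sup>2 \<le> ?m * (norm x)\<^sup>2"
      by (simp add: power2_eq_square algebra_simps)
    then have "norm (A *v x) \<le> sqrt (?m * (norm x)\<^sup>2)"
      by (rule real_le_rsqrt)
    then show "norm (A *v x) \<le> sqrt ?m * norm x"
      by (simp add: real_sqrt_mult)
  qed simp
  then have "(opnorm A)\<^sup>2 \<le> (sqrt ?m)\<^sup>2"
    by (intro power_mono) auto
  then show ?thesis by simp
qed

lemma opnorm_conj_transpose [simp]: "opnorm (conj_transpose A) = opnorm A"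
proof -
  have le: "opnorm A \<le> opnorm (conj_transpose A)" for A :: "complex^'n^'n"
  proof (cases "opnorm A = 0")
    case False
    have "opnorm A * opnorm A \<le> opnorm (conj_transpose A) * opnorm A"
      using opnorm_sq_le[of A] opnorm_mult[of "conj_transpose A" A]
      by (simp add: power2_eq_square)
    then show ?thesis
      using False opnorm_nonneg[of A] by (simp add: less_le)
  qed (metis opnorm_nonneg)
  show ?thesis using le[of A] le[of "conj_transpose A"] by simp
qed

lemma opnorm_cstar: "opnorm (conj_transpose A ** A) = (opnorm A)\<^sup>2"
  using opnorm_sq_le[of A] opnorm_mult[of "conj_transpose A" A]
  by (simp add: power2_eq_square)


section \<open>The C*-algebra of continuous matrix-valued functions on the circle\<close>

text \<open>Elements are functions on the complex plane that are continuous on the unit circle and,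
  to make them determined by their values there, zero off the circle.\<close>

typedef (overloaded) ('n::finite) circle_matrix_algebra =
  "{f :: complex \<Rightarrow> complex^'n^'n.
      continuous_on (sphere 0 1) f \<and> (\<forall>z. z \<notin> sphere 0 1 \<longrightarrow> f z = 0)}"
  morphisms circle_fun Circle_fun
  by (rule exI[of _ "\<lambda>_. 0"]) auto

setup_lifting type_definition_circle_matrix_algebra

lemma continuous_circle_fun: "continuous_on (sphere 0 1) (circle_fun f)"
  using circle_fun[of f] by simp

lemma circle_eqI: "(\<And>z. z \<in> sphere 0 1 \<Longrightarrow> circle_fun f z = circle_fun g z) \<Longrightarrow> f = g"
  using circle_fun[of f] circle_fun[of g]
  by (intro circle_fun_inject[THEN iffD1] ext) (metis (mono_tags, lifting) mem_Collect_eq)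

lemma continuous_on_matrix_mult:
  fixes f g :: "'a::topological_space \<Rightarrow> complex^'n^'n"
  assumes "continuous_on S f" "continuous_on S g"
  shows "continuous_on S (\<lambda>z. f z ** g z)"
  unfolding matrix_matrix_mult_def
  by (intro continuous_intros assms)

lemma continuous_on_conj_transpose:
  fixes f :: "'a::topological_space \<Rightarrow> complex^'n^'n"
  assumes "continuous_on S f"
  shows "continuous_on S (\<lambda>z. conj_transpose (f z))"
  unfolding conj_transpose_def by (intro continuous_intros assms)

lemma continuous_on_matscale:
  fixes f :: "'a::topological_space \<Rightarrow> complex^'n^'n"
  assumes "continuous_on S f"
  shows "continuous_on S (\<lambda>z. matscale c (f z))"
  unfolding matscale_def by (intro continuous_intros assms)

instantiation circle_matrix_algebra :: (finite) real_normed_algebra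
begin

lift_definition zero_circle_matrix_algebra :: "'a circle_matrix_algebra" is "\<lambda>_. 0"
  by simp

lift_definition plus_circle_matrix_algebra ::
  "'a circle_matrix_algebra \<Rightarrow> 'a circle_matrix_algebra \<Rightarrow> 'a circle_matrix_algebra"
  is "\<lambda>f g z. f z + g z"
  by (auto intro: continuous_intros)

lift_definition minus_circle_matrix_algebra ::
  "'a circle_matrix_algebra \<Rightarrow> 'a circle_matrix_algebra \<Rightarrow> 'a circle_matrix_algebra"
  is "\<lambda>f g z. f z - g z"
  by (auto intro: continuous_intros)

lift_definition uminus_circle_matrix_algebra ::
  "'a circle_matrix_algebra \<Rightarrow> 'a circle_matrix_algebra"
  is "\<lambda>f z. - f z"
  by (auto intro: continuous_intros)

lift_definition times_circle_matrix_algebra ::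
  "'a circle_matrix_algebra \<Rightarrow> 'a circle_matrix_algebra \<Rightarrow> 'a circle_matrix_algebra"
  is "\<lambda>f g z. f z ** g z"
  by (auto intro: continuous_on_matrix_mult)

lift_definition scaleR_circle_matrix_algebra ::
  "real \<Rightarrow> 'a circle_matrix_algebra \<Rightarrow> 'a circle_matrix_algebra"
  is "\<lambda>r f z. r *\<^sub>R f z"
  by (auto intro: continuous_intros)

lift_definition norm_circle_matrix_algebra :: "'a circle_matrix_algebra \<Rightarrow> real"
  is "\<lambda>f. SUP z\<in>sphere 0 1. opnorm (f z)" .

definition "dist_circle_matrix_algebra (f :: 'a circle_matrix_algebra) g = norm (f - g)"

definition "sgn_circle_matrix_algebra (f :: 'a circle_matrix_algebra) = inverse (norm f) *\<^sub>R f"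

definition uniformity_circle_matrix_algebra ::
    "('a circle_matrix_algebra \<times> 'a circle_matrix_algebra) filter" where
  "uniformity_circle_matrix_algebra = (INF e\<in>{0<..}. principal {(x, y). dist x y < e})"

definition open_circle_matrix_algebra :: "'a circle_matrix_algebra set \<Rightarrow> bool" where
  "open_circle_matrix_algebra S = (\<forall>x\<in>S. \<forall>\<^sub>F (x', y) in uniformity. x' = x \<longrightarrow> y \<in> S)"

lemma one_in_circle: "(1::complex) \<in> sphere 0 1"
  by simp

lemma bdd_above_circle:
  fixes f :: "'a circle_matrix_algebra"
  shows "bdd_above ((\<lambda>z. opnorm (circle_fun f z)) ` sphere 0 1)"
proof -
  have "compact (circle_fun f ` sphere 0 1)"
    by (intro compact_continuous_image continuous_circle_fun) simp
  then have "bounded (circle_fun f ` sphere 0 1)"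
    by (rule compact_imp_bounded)
  then obtain b where "\<forall>A \<in> circle_fun f ` sphere 0 1. norm A \<le> b"
    unfolding bounded_iff ..
  then have b: "norm (circle_fun f z) \<le> b" if "z \<in> sphere 0 1" for z
    using that by simp
  show ?thesis
  proof (rule bdd_aboveI2)
    fix z :: complex assume "z \<in> sphere 0 1"
    then have "(real CARD('a))\<^sup>2 * norm (circle_fun f z) \<le> (real CARD('a))\<^sup>2 * b"
      by (intro mult_left_mono b) simp_all
    then show "opnorm (circle_fun f z) \<le> (real CARD('a))\<^sup>2 * b"
      by (rule order_trans[OF opnorm_le_norm])
  qed
qed

lemma opnorm_le_circle_norm: "z \<in> sphere 0 1 \<Longrightarrow> opnorm (circle_fun f z) \<le> norm f"
  unfolding norm_circle_matrix_algebra.rep_eq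
  by (rule cSUP_upper[OF _ bdd_above_circle])

lemma circle_norm_le:
  "(\<And>z. z \<in> sphere 0 1 \<Longrightarrow> opnorm (circle_fun f z) \<le> b) \<Longrightarrow> norm f \<le> b"
  unfolding norm_circle_matrix_algebra.rep_eq
  using one_in_circle by (intro cSUP_least) auto

lemma circle_norm_nonneg: "0 \<le> norm (f :: 'a circle_matrix_algebra)"
  using opnorm_le_circle_norm[OF one_in_circle, of f] opnorm_nonneg order_trans by blast

lemma scaleR_matscale: "r *\<^sub>R A = matscale (complex_of_real r) (A :: complex^'n^'m)"
  unfolding matscale_def vec_eq_iff vector_scaleR_component vec_lambda_beta
  by (simp add: scaleR_conv_of_real)

lemma circle_norm_scale:
  fixes f g :: "'a circle_matrix_algebra"
  assumes fg: "\<And>z. circle_fun g z = matscale c (circle_fun f z)"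
  shows "norm g = cmod c * norm f"
proof (rule antisym)
  show "norm g \<le> cmod c * norm f"
    by (rule circle_norm_le) (simp add: fg opnorm_matscale mult_left_mono opnorm_le_circle_norm)
  show "cmod c * norm f \<le> norm g"
  proof (cases "c = 0")
    case False
    have "norm f \<le> norm g / cmod c"
    proof (rule circle_norm_le)
      fix z :: complex assume "z \<in> sphere 0 1"
      then have "cmod c * opnorm (circle_fun f z) \<le> norm g"
        using opnorm_le_circle_norm[of z g] by (simp add: fg opnorm_matscale)
      then show "opnorm (circle_fun f z) \<le> norm g / cmod c"
        using False by (simp add: field_simps)
    qed
    then show ?thesis using False by (simp add: field_simps)
  qed (simp add: circle_norm_nonneg)
qed

lemmas circle_rep_eqs =
  zero_circle_matrix_algebra.rep_eq plus_circle_matrix_algebra.rep_eq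
  minus_circle_matrix_algebra.rep_eq uminus_circle_matrix_algebra.rep_eq
  times_circle_matrix_algebra.rep_eq scaleR_circle_matrix_algebra.rep_eq

instance
proof
  fix f g h :: "'a circle_matrix_algebra" and r s :: real
  show "f + g + h = f + (g + h)" "f + g = g + f" "0 + f = f" "- f + f = 0" "f - g = f + - g"
    by (rule circle_eqI; simp add: circle_rep_eqs algebra_simps)+
  show "r *\<^sub>R (f + g) = r *\<^sub>R f + r *\<^sub>R g" "(r + s) *\<^sub>R f = r *\<^sub>R f + s *\<^sub>R f"
    "r *\<^sub>R s *\<^sub>R f = (r * s) *\<^sub>R f" "1 *\<^sub>R f = f"
    by (rule circle_eqI; simp add: circle_rep_eqs algebra_simps)+
  show "f * g * h = f * (g * h)"
    by (rule circle_eqI) (simp add: circle_rep_eqs matrix_mul_assoc)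
  show "(f + g) * h = f * h + g * h" "f * (g + h) = f * g + f * h"
    by (rule circle_eqI; simp add: circle_rep_eqs matrix_matrix_mult_def vec_eq_iff
          sum.distrib algebra_simps)+
  show "r *\<^sub>R f * g = r *\<^sub>R (f * g)" "f * r *\<^sub>R g = r *\<^sub>R (f * g)"
    by (rule circle_eqI; simp add: circle_rep_eqs matrix_matrix_mult_def vec_eq_iff scaleR_sum_right)+
  show "dist f g = norm (f - g)" by (rule dist_circle_matrix_algebra_def)
  show "sgn f = inverse (norm f) *\<^sub>R f" by (rule sgn_circle_matrix_algebra_def)
  show "uniformity = (INF e\<in>{0<..}. principal {(x::'a circle_matrix_algebra, y). dist x y < e})"
    by (rule uniformity_circle_matrix_algebra_def)
  show "open U = (\<forall>x\<in>U. \<forall>\<^sub>F (x', y) in uniformity. x' = x \<longrightarrow> y \<in> U)"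
    for U :: "'a circle_matrix_algebra set"
    by (rule open_circle_matrix_algebra_def)
  show "(norm f = 0) = (f = 0)"
  proof
    assume 0: "norm f = 0"
    show "f = 0"
    proof (rule circle_eqI)
      fix z :: complex assume "z \<in> sphere 0 1"
      then have "opnorm (circle_fun f z) \<le> 0" using opnorm_le_circle_norm[of z f] 0 by simp
      then show "circle_fun f z = circle_fun 0 z"
        using opnorm_nonneg[of "circle_fun f z"]
        by (simp add: zero_circle_matrix_algebra.rep_eq)
    qed
  next
    assume "f = 0"
    then have "norm f \<le> 0"
      by (intro circle_norm_le) (simp add: zero_circle_matrix_algebra.rep_eq)
    then show "norm f = 0" using circle_norm_nonneg[of f] by simp
  qed
  show "norm (f + g) \<le> norm f + norm g"
    by (rule circle_norm_le, subst plus_circle_matrix_algebra.rep_eq,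
        rule order_trans[OF opnorm_triangle], intro add_mono opnorm_le_circle_norm)
  show "norm (r *\<^sub>R f) = \<bar>r\<bar> * norm f"
    using circle_norm_scale[of "r *\<^sub>R f" "complex_of_real r" f]
    by (simp add: circle_rep_eqs scaleR_matscale)
  show "norm (f * g) \<le> norm f * norm g"
    by (rule circle_norm_le, subst times_circle_matrix_algebra.rep_eq,
        rule order_trans[OF opnorm_mult], intro mult_mono opnorm_le_circle_norm)
       (auto simp: circle_norm_nonneg)
qed

end

instance circle_matrix_algebra :: (finite) banach
proof
  fix X :: "nat \<Rightarrow> 'a circle_matrix_algebra"
  assume X: "Cauchy X"
  let ?S = "sphere (0::complex) 1"
  define K where "K = (real CARD('a))\<^sup>2"
  have K: "K > 0" by (simp add: K_def)
  have "uniformly_Cauchy_on ?S (\<lambda>n. circle_fun (X n))"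
  proof (rule uniformly_Cauchy_onI)
    fix e :: real assume e: "e > 0"
    from X e K obtain M where M: "\<And>m n. m \<ge> M \<Longrightarrow> n \<ge> M \<Longrightarrow> norm (X m - X n) < e / K"
      unfolding Cauchy_def dist_circle_matrix_algebra_def by (meson divide_pos_pos)
    have "dist (circle_fun (X m) z) (circle_fun (X n) z) < e"
      if z: "z \<in> ?S" and mn: "m \<ge> M" "n \<ge> M" for z m n
    proof -
      have "norm (circle_fun (X m) z - circle_fun (X n) z)
          \<le> K * opnorm (circle_fun (X m - X n) z)"
        unfolding K_def minus_circle_matrix_algebra.rep_eq by (rule norm_le_opnorm)
      also have "\<dots> \<le> K * norm (X m - X n)"
        using K z by (intro mult_left_mono opnorm_le_circle_norm) auto
      also have "\<dots> < e" using M[OF mn] K by (simp add: field_simps)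
      finally show ?thesis by (simp add: dist_norm)
    qed
    then show "\<exists>M. \<forall>z\<in>?S. \<forall>m\<ge>M. \<forall>n\<ge>M. dist (circle_fun (X m) z) (circle_fun (X n) z) < e"
      by blast
  qed
  then obtain l where l: "uniform_limit ?S (\<lambda>n. circle_fun (X n)) l sequentially"
    using Cauchy_uniformly_convergent uniformly_convergent_on_def by blast
  have cl: "continuous_on ?S l"
    by (rule uniform_limit_theorem[OF _ l]) (auto intro: always_eventually simp: continuous_circle_fun)
  define L where "L = Circle_fun (\<lambda>z. if z \<in> ?S then l z else 0)"
  have "continuous_on ?S (\<lambda>z. if z \<in> ?S then l z else 0)"
    by (rule continuous_on_eq[OF cl]) simp
  then have L: "circle_fun L z = l z" if "z \<in> ?S" for z
    using that unfolding L_def by (subst Circle_fun_inverse) auto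
  have "X \<longlonglongrightarrow> L"
    unfolding LIMSEQ_def
  proof (intro allI impI)
    fix e :: real assume e: "e > 0"
    then have "e / (2 * K) > 0" using K by simp
    from uniform_limitD[OF l this] obtain M where
      M: "\<And>n z. n \<ge> M \<Longrightarrow> z \<in> ?S \<Longrightarrow> dist (circle_fun (X n) z) (l z) < e / (2 * K)"
      unfolding eventually_sequentially by metis
    have "dist (X n) L < e" if n: "n \<ge> M" for n
    proof -
      have "norm (X n - L) \<le> e / 2"
      proof (rule circle_norm_le)
        fix z :: complex assume z: "z \<in> ?S"
        have "opnorm (circle_fun (X n - L) z) \<le> K * norm (circle_fun (X n) z - l z)"
          unfolding K_def minus_circle_matrix_algebra.rep_eq L[OF z] by (rule opnorm_le_norm)
        also have "\<dots> \<le> K * (e / (2 * K))"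
          using M[OF n z] K by (intro mult_left_mono) (auto simp: dist_norm)
        finally show "opnorm (circle_fun (X n - L) z) \<le> e / 2" using K by simp
      qed
      then show ?thesis using e by (simp add: dist_circle_matrix_algebra_def)
    qed
    then show "\<exists>M. \<forall>n\<ge>M. dist (X n) L < e" by blast
  qed
  then show "convergent X" by (auto simp: convergent_def)
qed

instantiation circle_matrix_algebra :: (finite) cstar_algebra
begin

lift_definition scaleC_circle_matrix_algebra ::
  "complex \<Rightarrow> 'a circle_matrix_algebra \<Rightarrow> 'a circle_matrix_algebra"
  is "\<lambda>c f z. matscale c (f z)"
  by (auto intro: continuous_on_matscale)

lift_definition star_circle_matrix_algebra ::
  "'a circle_matrix_algebra \<Rightarrow> 'a circle_matrix_algebra"
  is "\<lambda>f z. conj_transpose (f z)"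
  by (auto intro: continuous_on_conj_transpose)

lemma circle_cstar: "norm (star f * f) = (norm (f :: 'a circle_matrix_algebra))\<^sup>2"
proof (rule antisym)
  show "norm (star f * f) \<le> (norm f)\<^sup>2"
    by (rule circle_norm_le)
       (auto simp: times_circle_matrix_algebra.rep_eq star_circle_matrix_algebra.rep_eq
         opnorm_cstar intro!: power_mono opnorm_le_circle_norm)
  have "norm f \<le> sqrt (norm (star f * f))"
  proof (rule circle_norm_le)
    fix z :: complex assume "z \<in> sphere 0 1"
    then have "(opnorm (circle_fun f z))\<^sup>2 \<le> norm (star f * f)"
      using opnorm_le_circle_norm[of z "star f * f"]
      by (simp add: times_circle_matrix_algebra.rep_eq star_circle_matrix_algebra.rep_eq
         opnorm_cstar)
    then show "opnorm (circle_fun f z) \<le> sqrt (norm (star f * f))"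
      by (rule real_le_rsqrt)
  qed
  then have "(norm f)\<^sup>2 \<le> (sqrt (norm (star f * f)))\<^sup>2"
    using circle_norm_nonneg by (intro power_mono) auto
  then show "(norm f)\<^sup>2 \<le> norm (star f * f)"
    by (simp add: circle_norm_nonneg)
qed

lemmas circle_rep_eqs' =
  circle_rep_eqs scaleC_circle_matrix_algebra.rep_eq star_circle_matrix_algebra.rep_eq

instance
proof
  fix f g h :: "'a circle_matrix_algebra" and c d :: complex and r :: real
  show "scaleC c (f + g) = scaleC c f + scaleC c g" "scaleC (c + d) f = scaleC c f + scaleC d f"
    "scaleC c (scaleC d f) = scaleC (c * d) f"
    by (rule circle_eqI; simp add: circle_rep_eqs' matscale_def vec_eq_iff algebra_simps)+
  show "scaleC (complex_of_real r) f = r *\<^sub>R f"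
    by (rule circle_eqI) (simp add: circle_rep_eqs' scaleR_matscale)
  show "scaleC c f * g = scaleC c (f * g)" "f * scaleC c g = scaleC c (f * g)"
    by (rule circle_eqI; simp add: circle_rep_eqs' matscale_def matrix_matrix_mult_def vec_eq_iff
          sum_distrib_left mult.assoc mult.left_commute)+
  show "norm (scaleC c f) = cmod c * norm f" 
    by (rule circle_norm_scale) (simp add: scaleC_circle_matrix_algebra.rep_eq)
  show "star (star f) = f" by (rule circle_eqI) (simp add: circle_rep_eqs')
  show "star (f + g) = star f + star g"
    by (rule circle_eqI) (simp add: circle_rep_eqs' conj_transpose_def vec_eq_iff)
  show "star (scaleC c f) = scaleC (cnj c) (star f)"
    by (rule circle_eqI) (simp add: circle_rep_eqs' conj_transpose_def matscale_def vec_eq_iff)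
  show "star (f * g) = star g * star f"
    by (rule circle_eqI) (simp add: circle_rep_eqs' conj_transpose_def matrix_matrix_mult_def vec_eq_iff
          mult.commute)
  show "norm (star f * f) = (norm f)\<^sup>2" by (rule circle_cstar)
qed

end

end

(*
  The fibers of a Cartan subalgebra B form a continuous field of maximal abelian subalgebras of
  M_n: the conditional expectation acts fiberwise and depends continuously on the base point, so
  the minimal projections of the fibers form a covering space of the circle, and maximality forces
  them to have rank one (for a rank-two projection p(z) one could adjoin elements p(z) x p(z)).
  Lifting t |-> exp(2 pi i t) to this covering gives a path of unitaries U(t), 0 <= t <= 1, whose
  conjugates of the diagonal matrices are the fibers of B. The endpoints differ by a
  monomial matrix, and its permutation s, the monodromy of the covering, is the invariant of B.

  If s and s' are conjugate, a path of monomial matrices joins the two fields of frames to a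
  unitary of the algebra that conjugates one Cartan subalgebra into the other. Conversely, the
  projections of B correspond to the s-invariant subsets of {1..n}, the trace being the
  cardinality; automorphisms preserve traces, so they induce an isomorphism between the lattices of
  invariant sets that preserves cardinalities, and hence a bijection between the cycles of s and s'
  that preserves lengths. Every permutation occurs because permutation matrices can be joined to
  the identity in U(n).
*)
theory Submission
  imports Defs "HOL-Computational_Algebra.Fundamental_Theorem_Algebra"
begin

section \<open>Simultaneous diagonalization\<close>

text \<open>The fibers vary continuously because central elements commute with everything and hence
  lie in \<open>B\<close>: the expectation is linear over C(S^1) and is determined by the finitely
  many functions E(e_ij). Compactness then takes over: minimal projections have operator norm one
  and keep a fixed distance from each other, so the closedness of their graph, and the fact that
  they sum to one, give a covering. The recurring obstacle is that frames and lifted paths live on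
  the interval [0,1] and need not close up. In the coordinates of the frame U, elements of the
  algebra are the paths X with X(0) = N X(1) N^{-1}, where N is the monomial matrix with U(1) = U(0)
  N, and constructions in the algebra reduce to checking this boundary condition. Where it fails,
  the path is first multiplied by a function vanishing at the ends, or split into bumps around them.
  An automorphism may move the points of the circle, so coverings are not compared fiber by fiber;
  only projections are compared, whose traces are constant along the circle.\<close>

lemma conj_transpose_mult: "conj_transpose (A ** B) = conj_transpose B ** conj_transpose A"
  by (simp add: conj_transpose_def matrix_matrix_mult_def vec_eq_iff mult.commute)

lemma conj_transpose_mat_1 [simp]: "conj_transpose (mat 1) = mat 1"
  by (simp add: conj_transpose_def mat_def vec_eq_iff)

definition unitary_mat :: "complex^'n^'n \<Rightarrow> bool" where
  "unitary_mat U \<longleftrightarrow> conj_transpose U ** U = mat 1"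

lemma unitary_mat_left: "unitary_mat U \<Longrightarrow> conj_transpose U ** U = mat 1"
  by (simp add: unitary_mat_def)

lemma unitary_mat_right: "unitary_mat U \<Longrightarrow> U ** conj_transpose U = mat 1"
  using matrix_left_right_inverse by (auto simp: unitary_mat_def)

lemma unitary_mat_mult: "unitary_mat U \<Longrightarrow> unitary_mat V \<Longrightarrow> unitary_mat (U ** V)"
  unfolding unitary_mat_def conj_transpose_mult
  by (metis matrix_mul_assoc matrix_mul_lid)

lemma unitary_mat_conj_transpose: "unitary_mat U \<Longrightarrow> unitary_mat (conj_transpose U)"
  by (simp add: unitary_mat_def unitary_mat_right)

lemma unitary_cancel_left: "unitary_mat U \<Longrightarrow> conj_transpose U ** (U ** A) = A"
  by (simp add: matrix_mul_assoc unitary_mat_left)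

lemma unitary_cancel_left': "unitary_mat U \<Longrightarrow> U ** (conj_transpose U ** A) = A"
  by (simp add: matrix_mul_assoc unitary_mat_right)

definition diagonal_mat :: "complex^'n^'n \<Rightarrow> bool" where
  "diagonal_mat A \<longleftrightarrow> (\<forall>i j. i \<noteq> j \<longrightarrow> A $ i $ j = 0)"

text \<open>The shape of the discrepancy between the two ends of a frame: e_i goes to c_i e_(\<pi>
  i). Indexing \<open>c\<close> by columns makes products compose the permutations in the same
  order, and \<pi> = \<open>id\<close> covers the diagonal matrices, so that one product rule serves
  both.\<close>

definition monomial_mat :: "('n \<Rightarrow> 'n) \<Rightarrow> ('n \<Rightarrow> complex) \<Rightarrow> complex^'n^'n" where
  "monomial_mat \<pi> c = (\<chi> k i. if k = \<pi> i then c i else 0)"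

abbreviation diag_mat :: "('n \<Rightarrow> complex) \<Rightarrow> complex^'n^'n" where
  "diag_mat \<equiv> monomial_mat id"

lemma monomial_mat_mult:
  "monomial_mat \<pi> c ** monomial_mat \<sigma> d = monomial_mat (\<pi> \<circ> \<sigma>) (\<lambda>i. c (\<sigma> i) * d i)"
proof -
  have "(\<Sum>j\<in>UNIV. (if k = \<pi> j then c j else 0) * (if j = \<sigma> i then d i else 0)) =
      (\<Sum>j\<in>UNIV. if j = \<sigma> i then (if k = \<pi> j then c j else 0) * d i else 0)" for k i
    by (intro sum.cong) auto
  then show ?thesis
    by (simp add: monomial_mat_def matrix_matrix_mult_def vec_eq_iff)
qed

lemma conj_transpose_monomial_mat:
  assumes "bij \<pi>"
  shows "conj_transpose (monomial_mat \<pi> c) = monomial_mat (inv' \<pi>) (\<lambda>i. cnj (c (inv' \<pi> i)))"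
  using assms
  by (auto simp: conj_transpose_def monomial_mat_def vec_eq_iff bij_is_inj bij_is_surj surj_f_inv_f inv_f_f)

lemma diag_mat_1: "diag_mat (\<lambda>_. 1) = mat 1"
  by (simp add: monomial_mat_def mat_def)

lemma diagonal_diag_mat [simp]: "diagonal_mat (diag_mat d)"
  by (simp add: diagonal_mat_def monomial_mat_def)

lemma diagonal_mat_eq: "diagonal_mat A \<Longrightarrow> A = diag_mat (\<lambda>i. A $ i $ i)"
  by (auto simp: diagonal_mat_def monomial_mat_def vec_eq_iff)

lemma diag_mat_eq_iff [simp]: "diag_mat c = diag_mat d \<longleftrightarrow> c = d"
  by (auto simp: monomial_mat_def vec_eq_iff fun_eq_iff)

lemma unitary_monomial_mat:
  assumes "bij \<pi>" "\<And>i. cmod (c i) = 1"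
  shows "unitary_mat (monomial_mat \<pi> c)"
  unfolding unitary_mat_def conj_transpose_monomial_mat[OF assms(1)] monomial_mat_mult
  using assms by (simp add: bij_is_inj inv_f_f complex_norm_square[symmetric] mult.commute[of "cnj _"] diag_mat_1)

text \<open>The real inner product \<open>\<bullet>\<close> does not detect orthogonality over the
  complex numbers; this Hermitian form, linear in its second argument, does.\<close>

definition cinner :: "complex^'n \<Rightarrow> complex^'n \<Rightarrow> complex" where
  "cinner x y = (\<Sum>i\<in>UNIV. cnj (x $ i) * y $ i)"

lemma cinner_simps:
  "cinner x (y + z) = cinner x y + cinner x z"
  "cinner x (y - z) = cinner x y - cinner x z"
  "cinner x (c *s y) = c * cinner x y"
  "cinner (c *s x) y = cnj c * cinner x y"
  "cinner x 0 = 0" "cinner 0 x = 0"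
  by (simp_all add: cinner_def sum.distrib sum_subtractf algebra_simps sum_distrib_left)

lemma cinner_commute: "cinner y x = cnj (cinner x y)"
  by (simp add: cinner_def mult.commute)

lemma cinner_self: "cinner x x = complex_of_real ((norm x)\<^sup>2)"
  by (simp add: cinner_def norm_vec_def L2_set_def sum_nonneg complex_norm_square mult.commute
      del: of_real_power)

lemma cinner_self_eq_0 [simp]: "cinner x x = 0 \<longleftrightarrow> x = 0"
  by (simp add: cinner_self)

lemma cinner_sum_right: "cinner x (\<Sum>s\<in>S. f s) = (\<Sum>s\<in>S. cinner x (f s))"
  by (induction S rule: infinite_finite_induct) (simp_all add: cinner_simps)

lemma cinner_mat: "cinner x (A *v y) = cinner (conj_transpose A *v x) y"
proof -
  have "cinner x (A *v y) = (\<Sum>i\<in>UNIV. \<Sum>j\<in>UNIV. cnj (x $ i) * (A $ i $ j * y $ j))"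
    by (simp add: cinner_def matrix_vector_mult_def sum_distrib_left)
  also have "\<dots> = (\<Sum>j\<in>UNIV. \<Sum>i\<in>UNIV. cnj (x $ i) * (A $ i $ j * y $ j))"
    by (rule sum.swap)
  also have "\<dots> = cinner (conj_transpose A *v x) y"
    unfolding cinner_def matrix_vector_mult_def conj_transpose_def
    by (simp add: sum_distrib_right) (simp add: mult_ac)
  finally show ?thesis .
qed

section \<open>Eigenvectors, common eigenvectors and orthonormal eigenbases\<close>

context
  fixes A :: "complex^'n^'n" and w :: "complex^'n"
begin

text \<open>This is p(A) w, computed by Horner's rule so that it recurses along
  \<open>pCons\<close>.\<close>

definition poly_vec :: "complex poly \<Rightarrow> complex^'n" where
  "poly_vec p = fold_coeffs (\<lambda>c x. c *s w + A *v x) p 0"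

lemma poly_vec_0 [simp]: "poly_vec 0 = 0"
  by (simp add: poly_vec_def)

lemma poly_vec_pCons [simp]: "poly_vec (pCons c p) = c *s w + A *v poly_vec p"
  by (cases "p = 0 \<and> c = 0") (auto simp: poly_vec_def)

lemma poly_vec_add: "poly_vec (p + q) = poly_vec p + poly_vec q"
proof (induction p arbitrary: q)
  case (pCons c p)
  then show ?case
    by (cases q) (simp add: vector_sadd_rdistrib matrix_vector_right_distrib)
qed simp

lemma poly_vec_smult: "poly_vec (smult c p) = c *s poly_vec p"
  by (induction p) (simp_all add: vector_add_ldistrib vector_scalar_commute vector_smult_assoc)

lemma poly_vec_linear_factor: "poly_vec ([:- c, 1:] * p) = A *v poly_vec p - c *s poly_vec p"
proof -
  have "[:- c, 1:] * p = smult (- c) p + pCons 0 p"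
    by simp
  then show ?thesis
    by (simp only: poly_vec_add poly_vec_smult poly_vec_pCons) simp
qed

lemma poly_vec_sum: "poly_vec (\<Sum>k\<in>I. f k) = (\<Sum>k\<in>I. poly_vec (f k))"
  by (induction I rule: infinite_finite_induct) (simp_all add: poly_vec_add)

lemma poly_vec_monom: "poly_vec (monom c k) = c *s ((*v) A ^^ k) w"
  by (induction k) (simp_all add: monom_Suc monom_0 vector_scalar_commute)

end

text \<open>No determinant is used: the vectors w, A w, A^2 w, ... are linearly dependent, hence
  p(A) w = 0 for some nonzero p. Factoring a root c out of p leaves q of smaller degree; either q(A)
  w = 0 and the argument repeats, or q(A) w is an eigenvector for c. All vectors p(A) w stay in
  \<open>W\<close>.\<close>

lemma exists_eigenvector_in_invariant_subspace:
  fixes A :: "complex^'n^'n"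
  assumes W: "vec.subspace W" and inv: "\<And>x. x \<in> W \<Longrightarrow> A *v x \<in> W" and w: "w \<in> W" "w \<noteq> 0"
  obtains c x where "x \<in> W" "x \<noteq> 0" "A *v x = c *s x"
proof -
  have pW: "poly_vec A w p \<in> W" for p
    by (induction p) (use W w inv in \<open>auto intro: vec.subspace_add vec.subspace_scale vec.subspace_0\<close>)
  have "\<exists>p. p \<noteq> 0 \<and> poly_vec A w p = 0"
  proof (rule ccontr)
    assume neg: "\<not> ?thesis"
    define f where "f k = ((*v) A ^^ k) w" for k
    \<comment> \<open>Dependence is a property of sets, so repeated iterates must be excluded before
      indexing by exponents; a repetition would make X^i - X^j annihilate \<open>w\<close>.\<close>
    have inj: "inj f"
    proof (rule injI, rule ccontr)
      fix i j assume "f i = f j" "i \<noteq> j"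
      then have "poly_vec A w (monom 1 i + monom (-1) j) = 0"
        by (simp add: poly_vec_add poly_vec_monom f_def)
      moreover have "coeff (monom 1 i + monom (-1::complex) j) i = 1"
        using \<open>i \<noteq> j\<close> by simp
      ultimately show False
        using neg by (metis coeff_0 zero_neq_one)
    qed
    define N where "N = vec.dim (UNIV :: (complex^'n) set)"
    have "\<not> vec.independent (f ` {..N})"
    proof
      assume "vec.independent (f ` {..N})"
      then have "card (f ` {..N}) \<le> vec.dim (f ` {..N})"
        using vec.independent_bound_general by blast
      also have "\<dots> \<le> N"
        unfolding N_def by (rule vec.dim_subset) auto
      finally show False
        using inj by (simp add: card_image inj_on_def)
    qed
    then obtain u v where u: "v \<in> f ` {..N}" "u v \<noteq> 0" "(\<Sum>v\<in>f ` {..N}. u v *s v) = 0"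
      by (auto simp: vec.dependent_finite)
    define p where "p = (\<Sum>k\<le>N. monom (u (f k)) k)"
    have "poly_vec A w p = (\<Sum>k\<le>N. u (f k) *s f k)"
      by (simp add: p_def poly_vec_sum poly_vec_monom f_def)
    also have "\<dots> = 0"
      using u(3) inj by (subst (asm) sum.reindex) (auto simp: inj_on_def)
    finally have "poly_vec A w p = 0" .
    moreover obtain k where k: "k \<le> N" "v = f k"
      using u(1) by auto
    have "coeff p k = u v"
      unfolding p_def coeff_sum using k by (simp add: if_distrib cong: if_cong)
    ultimately show False
      using neg u(2) by (metis coeff_0)
  qed
  then obtain p where "p \<noteq> 0" "poly_vec A w p = 0"
    by blast
  then show ?thesis
  proof (induction "degree p" arbitrary: p rule: less_induct)
    case less
    show ?case
    proof (cases "degree p = 0")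
      case True
      then obtain c where "p = [:c:]"
        by (metis degree_eq_zeroE)
      with less.prems w show ?thesis
        by (simp add: vec.scale_eq_0_iff)
    next
      case False
      then have "\<not> constant (poly p)"
        by (simp add: constant_degree)
      then obtain c where "poly p c = 0"
        using fundamental_theorem_of_algebra by blast
      then obtain q where q: "p = [:- c, 1:] * q"
        by (metis dvdE poly_eq_0_iff_dvd)
      have q0: "q \<noteq> 0"
        using q less.prems by auto
      then have deg: "degree q < degree p"
        unfolding q by (subst degree_mult_eq) auto
      show ?thesis
      proof (cases "poly_vec A w q = 0")
        case True
        then show ?thesis using less.hyps[OF deg q0] by blast
      next
        case nz: False
        have "A *v poly_vec A w q = c *s poly_vec A w q"
          using less.prems(2) unfolding q poly_vec_linear_factor by simp
        with nz pW that show ?thesis by blast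
      qed
    qed
  qed
qed

text \<open>On a nonzero invariant subspace of least dimension every a in \<open>S\<close> is
  scalar: an eigenspace of a inside it is again invariant, by commutativity, hence is all of
  it.\<close>

lemma exists_common_eigenvector:
  fixes S :: "(complex^'n^'n) set"
  assumes comm: "\<And>a b. a \<in> S \<Longrightarrow> b \<in> S \<Longrightarrow> a ** b = b ** a"
    and W: "vec.subspace W" and inv: "\<And>a x. a \<in> S \<Longrightarrow> x \<in> W \<Longrightarrow> a *v x \<in> W"
    and w: "w \<in> W" "w \<noteq> 0"
  obtains x where "x \<in> W" "x \<noteq> 0" "\<And>a. a \<in> S \<Longrightarrow> \<exists>c. a *v x = c *s x"
proof -
  define P where "P V \<longleftrightarrow> vec.subspace V \<and> V \<subseteq> W \<and> V \<noteq> {0} \<and> (\<forall>a\<in>S. \<forall>x\<in>V. a *v x \<in> V)" for V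
  have "P W"
    using W inv w by (auto simp: P_def)
  then obtain V where V: "P V" and min: "\<And>V'. P V' \<Longrightarrow> vec.dim V \<le> vec.dim V'"
    using ex_has_least_nat[of P W vec.dim] by blast
  have sub: "vec.subspace V" and VW: "V \<subseteq> W" and Vinv: "\<And>a x. a \<in> S \<Longrightarrow> x \<in> V \<Longrightarrow> a *v x \<in> V"
    using V by (auto simp: P_def)
  obtain x where x: "x \<in> V" "x \<noteq> 0"
    using V vec.subspace_0[OF sub] by (auto simp: P_def)
  have "\<exists>c. a *v x = c *s x" if a: "a \<in> S" for a
  proof -
    obtain c y where y: "y \<in> V" "y \<noteq> 0" "a *v y = c *s y"
      using exists_eigenvector_in_invariant_subspace[OF sub Vinv[OF a] x] by metis
    define V' where "V' = {z \<in> V. a *v z = c *s z}"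
    have sub': "vec.subspace V'"
      unfolding V'_def
      using sub
      by (auto simp: vec.subspace_def matrix_vector_right_distrib vector_add_ldistrib
          vector_scalar_commute vector_smult_assoc mult.commute)
    have "b *v z \<in> V'" if "b \<in> S" "z \<in> V'" for b z
    proof -
      have "a *v (b *v z) = b *v (a *v z)"
        using comm[OF a that(1)] by (simp add: matrix_vector_mul_assoc)
      then show ?thesis
        using that Vinv by (auto simp: V'_def vector_scalar_commute)
    qed
    then have "P V'"
      using y sub' VW by (auto simp: P_def V'_def)
    then have "V' = V"
      using sub sub' min by (intro vec.subspace_dim_equal) (auto simp: V'_def)
    then show ?thesis
      using x by (auto simp: V'_def)
  qed
  then show ?thesis
    using x VW that by blast
qed

text \<open>A largest orthonormal set of common eigenvectors is a basis: as \<open>S\<close> is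
  closed under adjoints, the orthogonal complement is invariant, and if it were nonzero it would
  contain a further common eigenvector.\<close>

lemma simultaneous_diagonalization:
  fixes S :: "(complex^'n^'n) set"
  assumes comm: "\<And>a b. a \<in> S \<Longrightarrow> b \<in> S \<Longrightarrow> a ** b = b ** a"
    and star: "\<And>a. a \<in> S \<Longrightarrow> conj_transpose a \<in> S"
  obtains V where "unitary_mat V" "\<And>a. a \<in> S \<Longrightarrow> diagonal_mat (conj_transpose V ** a ** V)"
proof -
  define N where "N = vec.dim (UNIV :: (complex^'n) set)"
  define P where "P T \<longleftrightarrow> finite T \<and> (\<forall>x\<in>T. norm x = 1 \<and> (\<forall>a\<in>S. \<exists>c. a *v x = c *s x)) \<and>
    (\<forall>x\<in>T. \<forall>y\<in>T. x \<noteq> y \<longrightarrow> cinner x y = 0)" for T :: "(complex^'n) set"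
  have indep: "vec.independent T" if "P T" for T
  proof -
    have "u v = 0" if v: "v \<in> T" and "(\<Sum>v\<in>T. u v *s v) = 0" for u v
    proof -
      have "cinner v (\<Sum>v\<in>T. u v *s v) = (\<Sum>y\<in>T. if y = v then u v else 0)"
        unfolding cinner_sum_right using \<open>P T\<close> v
        by (intro sum.cong) (auto simp: cinner_simps P_def cinner_self)
      also have "\<dots> = u v"
        using \<open>P T\<close> v by (simp add: P_def)
      finally show ?thesis
        using that by (simp add: cinner_simps)
    qed
    then show ?thesis
      using that by (auto simp: vec.dependent_finite P_def)
  qed
  have card_le: "card T \<le> N" if "P T" for T
    using vec.independent_bound_general[OF indep[OF that]] vec.dim_subset[OF subset_UNIV, of T]
    unfolding N_def by linarith
  have "P {}"
    by (simp add: P_def)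
  then obtain T where T: "P T" and max: "\<And>T'. P T' \<Longrightarrow> card T' \<le> card T"
    using ex_has_greatest_nat[of P "{}" card "Suc N"] card_le by (auto simp: less_Suc_eq_le)
  define W where "W = {x. \<forall>y\<in>T. cinner y x = 0}"
  have subW: "vec.subspace W"
    by (auto simp: W_def vec.subspace_def cinner_simps)
  have invW: "a *v x \<in> W" if "a \<in> S" "x \<in> W" for a x
    unfolding W_def
  proof (intro CollectI ballI)
    fix y assume y: "y \<in> T"
    then obtain c where "conj_transpose a *v y = c *s y"
      using T star[OF \<open>a \<in> S\<close>] unfolding P_def by blast
    then show "cinner y (a *v x) = 0"
      using that y by (simp add: cinner_mat cinner_simps W_def)
  qed
  have W0: "W = {0}"
  proof (rule ccontr)
    assume "W \<noteq> {0}"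
    then obtain w where w: "w \<in> W" "w \<noteq> 0"
      using vec.subspace_0[OF subW] by blast
    obtain x where x: "x \<in> W" "x \<noteq> 0" "\<And>a. a \<in> S \<Longrightarrow> \<exists>c. a *v x = c *s x"
      by (rule exists_common_eigenvector[of S W w]) (use comm subW invW w in auto)
    define x' where "x' = complex_of_real (inverse (norm x)) *s x"
    have x': "x' \<in> W" "norm x' = 1"
      using x(1,2) vec.subspace_scale[OF subW] by (auto simp: x'_def norm_cvec_scale norm_inverse)
    have "\<exists>c. a *v x' = c *s x'" if "a \<in> S" for a
    proof -
      obtain c where "a *v x = c *s x" using x(3) \<open>a \<in> S\<close> by blast
      then have "a *v x' = c *s x'"
        unfolding x'_def by (simp add: vector_scalar_commute vector_smult_assoc mult.commute)
      then show ?thesis ..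
    qed
    moreover have "x' \<notin> T"
      using x' by (auto simp: W_def cinner_self)
    moreover have "cinner x' y = 0" "cinner y x' = 0" if "y \<in> T" for y
      using that x'(1) cinner_commute[of x' y] by (auto simp: W_def)
    ultimately have "P (insert x' T)"
      using T x'(2) by (auto simp: P_def)
    from max[OF this] show False
      using \<open>x' \<notin> T\<close> T by (simp add: P_def)
  qed
  have "x \<in> vec.span T" for x
  proof -
    define z where "z = (\<Sum>y\<in>T. cinner y x *s y)"
    have "cinner v z = (\<Sum>y\<in>T. if y = v then cinner v x else 0)" if "v \<in> T" for v
      unfolding z_def cinner_sum_right using T that
      by (intro sum.cong) (auto simp: cinner_simps P_def cinner_self)
    then have "x - z \<in> W"
      using T by (simp add: W_def cinner_simps P_def)
    then have "x = z" using W0 by simp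
    moreover have "z \<in> vec.span T"
      unfolding z_def by (intro vec.span_sum vec.span_scale vec.span_base)
    ultimately show ?thesis by simp
  qed
  \<comment> \<open>Being a basis, \<open>T\<close> has as many elements as the index type, so its
    vectors can be listed as the columns of \<open>V\<close>.\<close>
  then have "UNIV \<subseteq> vec.span T" by auto
  then have "N = card T"
    unfolding N_def using indep[OF T] vec.basis_card_eq_dim[of T UNIV] by simp
  then have "card (UNIV :: 'n set) = card T"
    unfolding N_def by (simp only: vec_dim_card)
  moreover have "finite T" using T by (simp add: P_def)
  ultimately obtain f where f: "bij_betw f (UNIV :: 'n set) T"
    by (meson finite_class.finite_UNIV finite_same_card_bij)
  define V :: "complex^'n^'n" where "V = (\<chi> i j. f j $ i)"
  have fT: "f i \<in> T" for i
    using f by (auto simp: bij_betw_def)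
  have ip: "cinner (f i) (f j) = (if i = j then 1 else 0)" for i j
    using T fT f by (cases "i = j") (auto simp: P_def cinner_self bij_betw_def inj_eq)
  have entry: "(conj_transpose V ** a ** V) $ i $ j = cinner (f i) (a *v f j)" for a i j
    unfolding cinner_mat
    by (simp add: cinner_def matrix_matrix_mult_def conj_transpose_def V_def matrix_vector_mult_def mult.commute)
  have "unitary_mat V"
    using entry[of "mat 1"] by (simp add: unitary_mat_def vec_eq_iff ip) (simp add: mat_def)
  moreover have "diagonal_mat (conj_transpose V ** a ** V)" if "a \<in> S" for a
    unfolding diagonal_mat_def entry
  proof (intro allI impI)
    fix i j :: 'n assume "i \<noteq> j"
    obtain c where "a *v f j = c *s f j"
      using T fT[of j] \<open>a \<in> S\<close> unfolding P_def by blast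
    then show "cinner (f i) (a *v f j) = 0"
      using \<open>i \<noteq> j\<close> by (simp add: cinner_simps ip)
  qed
  ultimately show ?thesis using that by blast
qed

section \<open>Conjugacy in symmetric groups\<close>

text \<open>The cycle through \<open>x\<close>. Nonnegative powers suffice since a permutation of a
  finite set has finite order.\<close>

definition perm_orbit :: "('a \<Rightarrow> 'a) \<Rightarrow> 'a \<Rightarrow> 'a set" where
  "perm_orbit \<sigma> x = range (\<lambda>i. (\<sigma> ^^ i) x)"

context
  fixes \<sigma> :: "'a::finite \<Rightarrow> 'a"
  assumes bij: "bij \<sigma>"
begin

lemma permutation_of_bij: "permutation \<sigma>"
  using bij by (simp add: permutation)

lemma card_perm_orbit: "card (perm_orbit \<sigma> x) = least_power \<sigma> x"
proof -
  have "perm_orbit \<sigma> x = set (support \<sigma> x)"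
    by (simp only: perm_orbit_def support_set[OF permutation_of_bij])
  then show ?thesis
    using distinct_card[OF cycle_of_permutation[OF permutation_of_bij, of x]] by simp
qed

text \<open>Positions on a cycle are exponents modulo its length. Equations between positions can
  thus be carried between cycles of equal length, even of different permutations.\<close>

lemma funpow_eq_iff_mod_card:
  "(\<sigma> ^^ i) x = (\<sigma> ^^ j) x \<longleftrightarrow> i mod card (perm_orbit \<sigma> x) = j mod card (perm_orbit \<sigma> x)"
proof -
  have *: "(\<sigma> ^^ i) x = (\<sigma> ^^ j) x \<longleftrightarrow> i mod least_power \<sigma> x = j mod least_power \<sigma> x" if "i \<le> j" for i j
  proof -
    have "(\<sigma> ^^ j) x = (\<sigma> ^^ i) ((\<sigma> ^^ (j - i)) x)"
      using that by (metis add_diff_inverse_nat funpow_add comp_apply not_le)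
    then have "(\<sigma> ^^ i) x = (\<sigma> ^^ j) x \<longleftrightarrow> (\<sigma> ^^ (j - i)) x = x"
      using bij_fn[OF bij, of i] by (metis bij_is_inj injD)
    also have "\<dots> \<longleftrightarrow> least_power \<sigma> x dvd j - i"
      by (simp add: least_power_dvd[OF permutation_of_bij])
    finally show ?thesis
      using that by (metis mod_eq_dvd_iff_nat)
  qed
  show ?thesis
    unfolding card_perm_orbit by (cases "i \<le> j") (use *[of i j] *[of j i] in auto)
qed

lemma self_in_perm_orbit: "x \<in> perm_orbit \<sigma> x"
  unfolding perm_orbit_def by (metis funpow_0 rangeI)

lemma perm_orbit_subset_of_invariant: "\<sigma> ` S = S \<Longrightarrow> x \<in> S \<Longrightarrow> perm_orbit \<sigma> x \<subseteq> S"
proof -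
  assume S: "\<sigma> ` S = S" "x \<in> S"
  have "(\<sigma> ^^ i) x \<in> S" for i
    by (induction i) (use S in auto)
  then show ?thesis by (auto simp: perm_orbit_def)
qed

lemma perm_orbit_invariant: "\<sigma> ` perm_orbit \<sigma> x = perm_orbit \<sigma> x"
proof (rule card_subset_eq)
  show "\<sigma> ` perm_orbit \<sigma> x \<subseteq> perm_orbit \<sigma> x"
    unfolding perm_orbit_def by (auto intro: range_eqI[of _ _ "Suc _"])
  show "card (\<sigma> ` perm_orbit \<sigma> x) = card (perm_orbit \<sigma> x)"
    using bij by (intro card_image) (auto simp: bij_def inj_on_def)
qed simp

lemma perm_orbit_eq: 
  assumes "y \<in> perm_orbit \<sigma> x" 
  shows "perm_orbit \<sigma> y = perm_orbit \<sigma> x"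
proof
  show "perm_orbit \<sigma> y \<subseteq> perm_orbit \<sigma> x"
    using assms by (intro perm_orbit_subset_of_invariant perm_orbit_invariant)
  obtain i where i: "y = (\<sigma> ^^ i) x"
    using assms by (auto simp: perm_orbit_def)
  define m where "m = least_power \<sigma> x"
  have m: "(\<sigma> ^^ m) x = x" "m > 0"
    unfolding m_def using least_power_of_permutation[OF permutation_of_bij] by auto
  have mk: "(\<sigma> ^^ (m * k)) x = x" for k
    unfolding m_def by (simp flip: least_power_dvd[OF permutation_of_bij])
  \<comment> \<open>The inverse of \<sigma>^i at \<open>y\<close> is obtained as a nonnegative
    power: m * i is a multiple of the period and at least i.\<close>
  have "i \<le> m * i" using m by simp
  then have "(\<sigma> ^^ (m * i - i)) y = x"
    unfolding i using mk[of i] by (metis comp_apply funpow_add le_add_diff_inverse2)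
  then have "x \<in> perm_orbit \<sigma> y"
    by (auto simp: perm_orbit_def)
  then show "perm_orbit \<sigma> x \<subseteq> perm_orbit \<sigma> y"
    by (intro perm_orbit_subset_of_invariant perm_orbit_invariant)
qed

end

text \<open>The minimal nonempty invariant sets are the cycles, so an order isomorphism matches
  cycles, here of equal lengths. Choosing a base point on every cycle and matching positions counted
  from it gives \<pi>.\<close>

lemma conjugate_if_isomorphic_invariant_sets:
  fixes \<sigma> \<tau> :: "'a::finite \<Rightarrow> 'a"
  assumes \<sigma>: "bij \<sigma>" and \<tau>: "bij \<tau>"
    and \<Phi>: "bij_betw \<Phi> {S. \<sigma> ` S = S} {S. \<tau> ` S = S}"
    and mono: "\<And>S T. \<sigma> ` S = S \<Longrightarrow> \<sigma> ` T = T \<Longrightarrow> S \<subseteq> T \<longleftrightarrow> \<Phi> S \<subseteq> \<Phi> T"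
    and card: "\<And>S. \<sigma> ` S = S \<Longrightarrow> card (\<Phi> S) = card S"
  obtains \<pi> where "bij \<pi>" "\<pi> \<circ> \<sigma> = \<tau> \<circ> \<pi>"
proof -
  let ?O = "perm_orbit \<sigma>" and ?O' = "perm_orbit \<tau>"
  \<comment> \<open>The cycle of \<open>y\<close> is the image of an invariant \<open>S\<close>
    inside the cycle of \<open>x\<close>; \<open>S\<close> is nonempty by its cardinality, hence the
    whole cycle.\<close>
  have \<Phi>_orbit: "\<Phi> (?O x) = ?O' y" if y: "y \<in> \<Phi> (?O x)" for x y
  proof -
    have inv: "\<tau> ` \<Phi> (?O x) = \<Phi> (?O x)"
      using bij_betwE[OF \<Phi>] perm_orbit_invariant[OF \<sigma>, of x] by blast
    have "?O' y \<in> \<Phi> ` {S. \<sigma> ` S = S}"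
      using bij_betw_imp_surj_on[OF \<Phi>] perm_orbit_invariant[OF \<tau>, of y] by blast
    then obtain S where S: "\<sigma> ` S = S" "\<Phi> S = ?O' y"
      by auto
    have "S \<subseteq> ?O x"
      using perm_orbit_subset_of_invariant[OF \<tau> inv y] S(2)
      unfolding mono[OF S(1) perm_orbit_invariant[OF \<sigma>]] by simp
    moreover have "card S \<noteq> 0"
      using S(2) card[OF S(1)] self_in_perm_orbit[OF \<tau>, of y] by (metis card_eq_0_iff empty_iff finite)
    then obtain z where "z \<in> S" by (metis card.empty ex_in_conv)
    ultimately have "?O x \<subseteq> S"
      using perm_orbit_eq[OF \<sigma>, of z x] perm_orbit_subset_of_invariant[OF \<sigma> S(1)] by blast
    with \<open>S \<subseteq> ?O x\<close> S(2) show ?thesis by (metis subset_antisym)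
  qed
  \<comment> \<open>One choice function supplies base points both for the cycles of \<sigma> and,
    through \<Phi>, for those of \<tau>.\<close>
  define r where "r S = (SOME x. x \<in> S)" for S :: "'a set"
  have r: "r (?O x) \<in> ?O x" for x
    unfolding r_def by (rule someI) (rule self_in_perm_orbit[OF \<sigma>])
  have s: "r (\<Phi> (?O x)) \<in> \<Phi> (?O x)" for x
  proof -
    have "card (\<Phi> (?O x)) \<noteq> 0"
      using card[OF perm_orbit_invariant[OF \<sigma>], of x] self_in_perm_orbit[OF \<sigma>, of x]
      by (metis card_eq_0_iff empty_iff finite)
    then have "\<Phi> (?O x) \<noteq> {}" by (metis card.empty)
    then show ?thesis unfolding r_def by (simp add: some_in_eq)
  qed
  have ex: "\<exists>i. x = (\<sigma> ^^ i) (r (?O x))" for x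
  proof -
    have "x \<in> ?O (r (?O x))"
      unfolding perm_orbit_eq[OF \<sigma> r] by (rule self_in_perm_orbit[OF \<sigma>])
    then show ?thesis
      unfolding perm_orbit_def[of \<sigma> "r _"] by blast
  qed
  define idx where "idx x = (SOME i. x = (\<sigma> ^^ i) (r (?O x)))" for x
  have idx: "x = (\<sigma> ^^ idx x) (r (?O x))" for x
    unfolding idx_def by (rule someI_ex[OF ex])
  define \<pi> where "\<pi> x = (\<tau> ^^ idx x) (r (\<Phi> (?O x)))" for x
  have card_eq: "card (?O' (r (\<Phi> (?O x)))) = card (?O (r (?O x)))" for x
    using \<Phi>_orbit[OF s, of x] perm_orbit_eq[OF \<sigma> r, of x] card[OF perm_orbit_invariant[OF \<sigma>], of x]
    by simp
  \<comment> \<open>Any exponent reaching \<open>x\<close> may be used in place of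
    \<open>idx x\<close>. This is needed because \<open>idx (\<sigma> x)\<close> need not be the
    successor of \<open>idx x\<close>.\<close>
  have \<pi>: "\<pi> x = (\<tau> ^^ i) (r (\<Phi> (?O x)))" if "x = (\<sigma> ^^ i) (r (?O x))" for x i
  proof -
    have "(\<sigma> ^^ idx x) (r (?O x)) = (\<sigma> ^^ i) (r (?O x))"
      by (rule trans[OF idx[symmetric] that])
    then show ?thesis
      unfolding \<pi>_def funpow_eq_iff_mod_card[OF \<sigma>] funpow_eq_iff_mod_card[OF \<tau>] card_eq .
  qed
  have "\<pi> (\<sigma> x) = \<tau> (\<pi> x)" for x
  proof -
    have "\<sigma> x \<in> ?O x"
      using perm_orbit_invariant[OF \<sigma>, of x] self_in_perm_orbit[OF \<sigma>, of x] by blast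
    then have O: "?O (\<sigma> x) = ?O x"
      by (rule perm_orbit_eq[OF \<sigma>])
    have "\<sigma> x = (\<sigma> ^^ Suc (idx x)) (r (?O (\<sigma> x)))"
      using arg_cong[OF idx, of \<sigma> x] unfolding O by (simp only: funpow.simps comp_apply)
    from \<pi>[OF this] show ?thesis
      unfolding O by (simp add: \<pi>_def)
  qed
  then have comm: "\<pi> \<circ> \<sigma> = \<tau> \<circ> \<pi>" by (simp add: fun_eq_iff)
  have "inj \<pi>"
  proof (rule injI)
    fix x y assume eq: "\<pi> x = \<pi> y"
    have mem: "\<pi> z \<in> \<Phi> (?O z)" for z
      using \<Phi>_orbit[OF s, of z] by (auto simp: \<pi>_def perm_orbit_def)
    have "\<Phi> (?O x) = \<Phi> (?O y)"
      using \<Phi>_orbit[OF mem[of x]] \<Phi>_orbit[OF mem[of y]] eq by simp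
    then have O: "?O x = ?O y"
      using mono[OF perm_orbit_invariant[OF \<sigma>, of x] perm_orbit_invariant[OF \<sigma>, of y]]
        mono[OF perm_orbit_invariant[OF \<sigma>, of y] perm_orbit_invariant[OF \<sigma>, of x]] by simp
    have "(\<tau> ^^ idx x) (r (\<Phi> (?O x))) = (\<tau> ^^ idx y) (r (\<Phi> (?O x)))"
      using eq by (simp add: \<pi>_def O)
    then have "(\<sigma> ^^ idx x) (r (?O x)) = (\<sigma> ^^ idx y) (r (?O x))"
      unfolding funpow_eq_iff_mod_card[OF \<sigma>] funpow_eq_iff_mod_card[OF \<tau>] card_eq .
    then have "(\<sigma> ^^ idx x) (r (?O x)) = (\<sigma> ^^ idx y) (r (?O y))"
      unfolding O .
    then show "x = y"
      unfolding idx[symmetric] .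
  qed
  then have "bij \<pi>"
    by (simp add: bij_def finite_UNIV_inj_surj)
  with comm that show ?thesis by blast
qed

section \<open>Counting classes by a complete invariant\<close>

lemma card_quotient_eq_card_image:
  assumes "R = {(x, y). x \<in> C \<and> y \<in> C \<and> g x = g y}"
  shows "card (C // R) = card (g ` C)" and "finite (g ` C) \<Longrightarrow> finite (C // R)"
proof -
  have cls: "R `` {x} = {y \<in> C. g y = g x}" if "x \<in> C" for x
    using that assms by auto
  have "bij_betw (\<lambda>c. {y \<in> C. g y = c}) (g ` C) (C // R)"
    by (rule bij_betwI') (use cls in \<open>auto simp: quotient_def\<close>)
  then show "card (C // R) = card (g ` C)" "finite (g ` C) \<Longrightarrow> finite (C // R)"
    by (simp_all add: bij_betw_same_card bij_betw_finite)
qed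

lemma conjugacy_classes_sym_group:
  "conjugacy_classes (sym_group n) =
     (\<lambda>p. {h \<circ> p \<circ> inv' h | h. h permutes {1..n}}) ` {p. p permutes {1..n}}"
proof -
  have inv: "inv\<^bsub>sym_group n\<^esub> h = inv' h" if "h permutes {1..n}" for h
  proof (rule group.inv_equality[OF sym_group_is_group])
    show "inv' h \<otimes>\<^bsub>sym_group n\<^esub> h = \<one>\<^bsub>sym_group n\<^esub>"
      using that by (simp add: sym_group_mult sym_group_one permutes_inv_o)
  qed (use that in \<open>auto simp: sym_group_carrier permutes_inv\<close>)
  have "orbit (sym_group n) (\<lambda>g. \<lambda>h \<in> carrier (sym_group n). g \<otimes>\<^bsub>sym_group n\<^esub> h \<otimes>\<^bsub>sym_group n\<^esub> (inv\<^bsub>sym_group n\<^esub> g)) p =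
     {h \<circ> p \<circ> inv' h | h. h permutes {1..n}}" if "p permutes {1..n}" for p
    unfolding orbit_def using that
    by (intro Collect_cong arg_cong[where f = Ex] ext)
      (simp add: sym_group_carrier sym_group_mult inv restrict_def cong: rev_conj_cong)
  then show ?thesis
    unfolding conjugacy_classes_def orbits_def
    by (auto simp: sym_group_carrier image_def)
qed

text \<open>The value \<open>f x\<close> stands for a permutation known only up to conjugacy, hence
  surjectivity is required only up to conjugacy. The class of \<open>f x\<close>, carried to
  permutations of {1..n}, is a complete invariant for \<open>R\<close> that takes all conjugacy
  classes as values.\<close>

lemma card_quotient_eq_card_conjugacy_classes:
  fixes f :: "'b \<Rightarrow> ('a::finite \<Rightarrow> 'a)"
  assumes n: "CARD('a) = n"
    and bij: "\<And>x. x \<in> C \<Longrightarrow> bij (f x)"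
    and surj: "\<And>\<sigma> :: 'a \<Rightarrow> 'a. bij \<sigma> \<Longrightarrow> \<exists>x\<in>C. \<exists>\<pi>. bij \<pi> \<and> \<pi> \<circ> f x = \<sigma> \<circ> \<pi>"
    and R: "\<And>x y. (x, y) \<in> R \<longleftrightarrow> x \<in> C \<and> y \<in> C \<and> (\<exists>\<pi>. bij \<pi> \<and> \<pi> \<circ> f x = f y \<circ> \<pi>)"
  shows "finite (C // R)" and "card (C // R) = card (conjugacy_classes (sym_group n))"
proof -
  obtain e where e: "bij_betw e (UNIV :: 'a set) {1..n}"
    using n finite_same_card_bij[of "UNIV :: 'a set" "{1..n}"] by auto
  \<comment> \<open>Transport along the enumeration \<open>e\<close>; outside {1..n} it is the
    identity, as \<open>permutes\<close> demands.\<close>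
  define hat where "hat p = (\<lambda>x. if x \<in> {1..n} then e (p (inv_into UNIV e x)) else x)" for p :: "'a \<Rightarrow> 'a"
  have "bij_betw hat {p. p permutes UNIV} {p. p permutes {1..n}}"
    unfolding hat_def using bij_betw_permutations[OF e] .
  then have hat: "bij_betw hat {p. bij p} {p. p permutes {1..n}}"
    by (simp add: permutes_univ flip: bij_iff)
  have einv: "inv_into UNIV e (e x) = x" for x
    using e by (simp add: bij_betw_def inv_into_f_f)
  have "e x \<in> {1..n}" for x
    using e by (auto simp: bij_betw_def)
  then have hat_comp: "hat (p \<circ> q) = hat p \<circ> hat q" for p q
    unfolding hat_def by (auto simp: fun_eq_iff einv)
  have hat_inj: "p = q" if "bij p" "bij q" "hat p = hat q" for p q
    using hat that by (auto simp: bij_betw_def dest: inj_onD)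
  define cls where "cls p = {h \<circ> p \<circ> inv' h | h. h permutes {1..n}}" for p :: "nat \<Rightarrow> nat"
  have cls_eq: "cls p = cls q \<longleftrightarrow> (\<exists>h. h permutes {1..n} \<and> h \<circ> p = q \<circ> h)" for p q
  proof
    assume "cls p = cls q"
    moreover have "p \<in> cls p"
      unfolding cls_def by (rule CollectI, rule exI[of _ id]) (auto simp: permutes_id)
    ultimately obtain h where h: "h permutes {1..n}" "p = h \<circ> q \<circ> inv' h"
      by (auto simp: cls_def)
    have "inv' h \<circ> p = inv' h \<circ> h \<circ> q \<circ> inv' h"
      unfolding h(2) by (simp add: comp_assoc)
    then have "inv' h \<circ> p = q \<circ> inv' h"
      using h(1) by (simp add: permutes_inv_o)
    then show "\<exists>h. h permutes {1..n} \<and> h \<circ> p = q \<circ> h"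
      using h(1) permutes_inv by blast
  next
    assume "\<exists>h. h permutes {1..n} \<and> h \<circ> p = q \<circ> h"
    then obtain h where h: "h permutes {1..n}" "h \<circ> p = q \<circ> h" by blast
    have q: "q = h \<circ> p \<circ> inv' h"
      unfolding h(2) using h(1) by (simp add: comp_assoc permutes_inv_o)
    have p: "p = inv' h \<circ> q \<circ> h"
      using h by (simp add: comp_assoc flip: h(2)) (simp add: permutes_inv_o flip: comp_assoc)
    have "g \<circ> p \<circ> inv' g \<in> cls q" if g: "g permutes {1..n}" for g
    proof -
      have "(g \<circ> inv' h) permutes {1..n}"
        using g h(1) by (intro permutes_compose permutes_inv)
      moreover have "inv' (g \<circ> inv' h) = h \<circ> inv' g"
        using g h(1) by (simp add: o_inv_distrib bij_imp_bij_inv inv_inv_eq permutes_bij)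
      then have "g \<circ> p \<circ> inv' g = (g \<circ> inv' h) \<circ> q \<circ> inv' (g \<circ> inv' h)"
        unfolding p by (simp add: comp_assoc)
      ultimately show ?thesis unfolding cls_def by blast
    qed
    moreover have "g \<circ> q \<circ> inv' g \<in> cls p" if g: "g permutes {1..n}" for g
    proof -
      have "(g \<circ> h) permutes {1..n}"
        using g h(1) by (intro permutes_compose)
      moreover have "g \<circ> q \<circ> inv' g = (g \<circ> h) \<circ> p \<circ> inv' (g \<circ> h)"
        unfolding q using g h(1) by (simp add: o_inv_distrib permutes_bij comp_assoc)
      ultimately show ?thesis unfolding cls_def by blast
    qed
    ultimately show "cls p = cls q" unfolding cls_def by blast
  qed
  have conj: "(\<exists>\<pi>. bij \<pi> \<and> \<pi> \<circ> \<sigma> = \<tau> \<circ> \<pi>) \<longleftrightarrow> cls (hat \<sigma>) = cls (hat \<tau>)"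
    if "bij \<sigma>" "bij \<tau>" for \<sigma> \<tau>
  proof
    assume "\<exists>\<pi>. bij \<pi> \<and> \<pi> \<circ> \<sigma> = \<tau> \<circ> \<pi>"
    then obtain \<pi> where "bij \<pi>" "\<pi> \<circ> \<sigma> = \<tau> \<circ> \<pi>" by blast
    then have "hat \<pi> permutes {1..n}" "hat \<pi> \<circ> hat \<sigma> = hat \<tau> \<circ> hat \<pi>"
      using hat by (auto simp flip: hat_comp dest: bij_betwE)
    then show "cls (hat \<sigma>) = cls (hat \<tau>)"
      unfolding cls_eq by blast
  next
    assume "cls (hat \<sigma>) = cls (hat \<tau>)"
    then obtain h where h: "h permutes {1..n}" "h \<circ> hat \<sigma> = hat \<tau> \<circ> h"
      unfolding cls_eq by blast
    then have "h \<in> hat ` {p. bij p}"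
      using hat by (simp only: bij_betw_def mem_Collect_eq)
    then obtain \<pi> where "bij \<pi>" "h = hat \<pi>"
      by blast
    then show "\<exists>\<pi>. bij \<pi> \<and> \<pi> \<circ> \<sigma> = \<tau> \<circ> \<pi>"
    proof (intro exI[of _ \<pi>] conjI)
      have "hat (\<pi> \<circ> \<sigma>) = hat (\<tau> \<circ> \<pi>)"
        using h(2) \<open>h = hat \<pi>\<close> by (simp add: hat_comp)
      then show "\<pi> \<circ> \<sigma> = \<tau> \<circ> \<pi>"
        using that \<open>bij \<pi>\<close> by (intro hat_inj bij_comp)
    qed (rule \<open>bij \<pi>\<close>)
  qed
  define g where "g = cls \<circ> hat \<circ> f"
  have Rg: "R = {(x, y). x \<in> C \<and> y \<in> C \<and> g x = g y}"
  proof -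
    have "(x, y) \<in> R \<longleftrightarrow> x \<in> C \<and> y \<in> C \<and> g x = g y" for x y
      using R[of x y] conj[of "f x" "f y"] bij[of x] bij[of y] by (auto simp only: g_def comp_apply)
    then show ?thesis by auto
  qed
  have "g ` C = cls ` {p. p permutes {1..n}}"
  proof
    show "g ` C \<subseteq> cls ` {p. p permutes {1..n}}"
      using bij bij_betwE[OF hat] by (auto simp: g_def)
    show "cls ` {p. p permutes {1..n}} \<subseteq> g ` C"
    proof (rule image_subsetI)
      fix p assume "p \<in> {p. p permutes {1..n}}"
      then have "p \<in> hat ` {\<sigma>. bij \<sigma>}"
        using hat by (simp only: bij_betw_def)
      then obtain \<sigma> where \<sigma>: "bij \<sigma>" "p = hat \<sigma>" by blast
      then obtain x where "x \<in> C" "\<exists>\<pi>. bij \<pi> \<and> \<pi> \<circ> f x = \<sigma> \<circ> \<pi>"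
        using surj[OF \<sigma>(1)] by blast
      then have "x \<in> C" "cls p = g x"
        using conj[OF bij \<sigma>(1)] \<sigma>(2) by (auto simp: g_def)
      then show "cls p \<in> g ` C" by blast
    qed
  qed
  then have gC: "g ` C = conjugacy_classes (sym_group n)"
    unfolding conjugacy_classes_sym_group cls_def .
  have "finite (g ` C)"
    unfolding gC conjugacy_classes_sym_group by (intro finite_imageI finite_permutations) simp
  then show "finite (C // R)" "card (C // R) = card (conjugacy_classes (sym_group n))"
    using card_quotient_eq_card_image[OF Rg] by (simp_all add: gC)
qed

section \<open>Matrix-valued functions on the circle\<close>

text \<open>The norm of \<open>complex^'n^'n\<close> is the Hilbert-Schmidt norm. For a projection
  this shows that its trace vanishes only if it is zero.\<close>

lemma trace_conj_transpose_mult_self: "trace (conj_transpose A ** A) = complex_of_real ((norm A)\<^sup>2)"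
proof -
  have "trace (conj_transpose A ** A) = (\<Sum>i\<in>UNIV. \<Sum>j\<in>UNIV. complex_of_real ((cmod (A $ j $ i))\<^sup>2))"
    by (simp add: trace_def matrix_matrix_mult_def conj_transpose_def complex_norm_square mult.commute del: of_real_power)
  also have "\<dots> = (\<Sum>j\<in>UNIV. \<Sum>i\<in>UNIV. complex_of_real ((cmod (A $ j $ i))\<^sup>2))"
    by (rule sum.swap)
  also have "\<dots> = complex_of_real ((norm A)\<^sup>2)"
    by (simp add: norm_vec_def L2_set_def sum_nonneg)
  finally show ?thesis .
qed

lemma matscale_mult_left: "matscale c A ** B = matscale c (A ** B)"
  by (simp add: matscale_def matrix_matrix_mult_def vec_eq_iff sum_distrib_left mult.assoc)

lemma matscale_mult_right: "A ** matscale c B = matscale c (A ** B)"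
  by (simp add: matscale_def matrix_matrix_mult_def vec_eq_iff sum_distrib_left mult_ac)

lemma matrix_mult_add_left: "(A + B) ** C = A ** C + B ** (C :: complex^'n^'n)"
  by (simp add: matrix_matrix_mult_def vec_eq_iff sum.distrib distrib_right)

lemma matrix_mult_0_right [simp]: "A ** 0 = (0 :: complex^'n^'n)"
  by (simp add: matrix_matrix_mult_def vec_eq_iff)

lemma matrix_mult_0_left [simp]: "0 ** A = (0 :: complex^'n^'n)"
  by (simp add: matrix_matrix_mult_def vec_eq_iff)

lemma matrix_mult_sum_right: "A ** (\<Sum>i\<in>I. f i) = (\<Sum>i\<in>I. A ** (f i :: complex^'n^'n))"
  by (induction I rule: infinite_finite_induct) (simp_all add: matrix_add_ldistrib matrix_mult_0_right)

lemma matrix_mult_diff_right: "A ** (B - C) = A ** B - A ** (C :: complex^'n^'n)"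
  by (simp add: matrix_matrix_mult_def vec_eq_iff sum_subtractf right_diff_distrib)

lemma matscale_0_left [simp]: "matscale 0 A = 0"
  by (simp add: matscale_def vec_eq_iff)

lemma trace_matscale: "trace (matscale c A) = c * trace A"
  by (simp add: trace_def matscale_def sum_distrib_left)

lemma continuous_on_trace: 
  fixes f :: "'a::topological_space \<Rightarrow> complex^'n^'n"
  shows "continuous_on S f \<Longrightarrow> continuous_on S (\<lambda>z. trace (f z))"
  unfolding trace_def by (intro continuous_intros)

lemma continuous_on_matscale_fun:
  fixes f :: "'a::topological_space \<Rightarrow> complex^'n^'m"
  assumes "continuous_on S c" "continuous_on S f"
  shows "continuous_on S (\<lambda>z. matscale (c z) (f z))"
  unfolding matscale_def by (intro continuous_intros assms)

lemma continuous_on_monomial_mat: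
  fixes c :: "'a::topological_space \<Rightarrow> 'n::finite \<Rightarrow> complex"
  assumes "\<And>i. continuous_on S (\<lambda>z. c z i)"
  shows "continuous_on S (\<lambda>z. monomial_mat \<pi> (c z))"
proof -
  have "continuous_on S (\<lambda>z. if k = \<pi> i then c z i else 0)" for k i
    by (cases "k = \<pi> i") (use assms in auto)
  then show ?thesis
    unfolding monomial_mat_def by (intro continuous_intros)
qed

definition mat_unit :: "'n::finite \<Rightarrow> 'n \<Rightarrow> complex^'n^'n" where
  "mat_unit i j = (\<chi> k l. if k = i \<and> l = j then 1 else 0)"

lemma sum_mat_units: "(\<Sum>i\<in>UNIV. \<Sum>j\<in>UNIV. matscale (x $ i $ j) (mat_unit i j)) = x"
proof -
  have "(\<Sum>j\<in>UNIV. x $ i $ j * (if k = i \<and> l = j then 1 else 0)) = (if k = i then x $ i $ l else 0)" for k l i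
    by (cases "k = i") (simp_all add: if_distrib[of "(*) _"] cong: if_cong)
  then show ?thesis
    by (simp add: vec_eq_iff sum_component matscale_def mat_unit_def)
qed

definition circle_pt :: "real \<Rightarrow> complex" where
  "circle_pt t = cis (2 * pi * t)"

lemma circle_pt_in_sphere [simp]: "circle_pt t \<in> sphere 0 1" "norm (circle_pt t) = 1"
  by (simp_all add: circle_pt_def)

lemma circle_pt_0_1 [simp]: "circle_pt 0 = 1" "circle_pt 1 = 1"
  by (simp_all add: circle_pt_def)

lemma continuous_circle_pt [continuous_intros]: "continuous_on S circle_pt"
  unfolding circle_pt_def by (intro continuous_intros)

lemma circle_pt_Arg2pi: "z \<in> sphere 0 1 \<Longrightarrow> circle_pt (Arg2pi z / (2 * pi)) = z"
  using Arg2pi_eq[of z] by (auto simp: circle_pt_def cis_conv_exp)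

lemma Arg2pi_in_unit_interval: "Arg2pi z / (2 * pi) \<in> {0..1}"
  using Arg2pi_ge_0[of z] Arg2pi_lt_2pi[of z] by (simp add: field_simps)

lemma circle_ext_path:
  assumes "\<And>t. t \<in> {0..1} \<Longrightarrow> circle_fun a (circle_pt t) = circle_fun b (circle_pt t)"
  shows "a = b"
  using assms circle_pt_Arg2pi Arg2pi_in_unit_interval by (metis circle_eqI)

lemma continuous_circle_fun_path: "continuous_on S (\<lambda>t. circle_fun a (circle_pt t))"
  by (rule continuous_on_compose2[OF continuous_circle_fun])
     (auto intro: continuous_intros)

lemma exists_circle_fun:
  assumes "continuous_on (sphere 0 1) f"
  shows "\<exists>a. \<forall>z\<in>sphere 0 1. circle_fun a z = f z"
proof -
  have "continuous_on (sphere 0 1) (\<lambda>z. if z \<in> sphere 0 1 then f z else 0)"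
    by (rule continuous_on_eq[OF assms]) simp
  then show ?thesis
    by (intro exI[of _ "Circle_fun (\<lambda>z. if z \<in> sphere 0 1 then f z else 0)"] ballI)
       (subst Circle_fun_inverse; auto)
qed

text \<open>The parameter \<open>Arg2pi\<close> jumps at the point 1, where f 0 = f 1 repairs
  continuity. The continuity is extracted from the trivial homotopy of the loop \<open>f\<close>
  with itself, which corresponds to a homotopy of maps on the circle.\<close>

lemma exists_circle_fun_path:
  fixes f :: "real \<Rightarrow> complex^'n^'n"
  assumes "continuous_on {0..1} f" "f 0 = f 1"
  shows "\<exists>a. \<forall>t\<in>{0..1}. circle_fun a (circle_pt t) = f t"
proof -
  have "homotopic_loops UNIV f f"
    using assms by (simp add: homotopic_loops_refl path_def pathfinish_def pathstart_def)
  then have "continuous_on (sphere 0 1) (f \<circ> (\<lambda>z. Arg2pi z / (2 * pi)))"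
    using homotopic_loops_imp_homotopic_circlemaps homotopic_with_imp_continuous by blast
  then obtain a where a: "\<And>z. z \<in> sphere 0 1 \<Longrightarrow> circle_fun a z = f (Arg2pi z / (2 * pi))"
    using exists_circle_fun by fastforce
  have "f (Arg2pi (circle_pt t) / (2 * pi)) = f t" if t: "t \<in> {0..1}" for t
  proof (cases "t = 1")
    case True
    then show ?thesis using assms by (simp add: Arg2pi_of_real[of 1, simplified])
  next
    case False
    have "Arg2pi (circle_pt t) = 2 * pi * t"
      by (rule Arg2pi_unique[of 1]) (use t False in \<open>auto simp: circle_pt_def cis_conv_exp mult_ac\<close>)
    then show ?thesis by simp
  qed
  then show ?thesis using a by (intro exI[of _ a]) simp
qed

lift_definition const_circle :: "complex^'n^'n \<Rightarrow> 'n circle_matrix_algebra" is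
  "\<lambda>M z. if z \<in> sphere 0 1 then M else 0"
  by (auto intro: continuous_on_eq[OF continuous_on_const])

lemma const_circle [simp]: "z \<in> sphere 0 1 \<Longrightarrow> circle_fun (const_circle M) z = M"
  by (simp add: const_circle.rep_eq)

lemma circle_fun_sum: "circle_fun (\<Sum>i\<in>I. f i) z = (\<Sum>i\<in>I. circle_fun (f i) z)"
  by (induction I rule: infinite_finite_induct) (simp_all add: circle_rep_eqs')

definition commutant :: "'a::cstar_algebra set \<Rightarrow> 'a set" where
  "commutant S = {x. \<forall>s\<in>S. x * s = s * x}"

lemma commutant_antimono: "S \<subseteq> T \<Longrightarrow> commutant T \<subseteq> commutant S"
  by (auto simp: commutant_def)

lemma cstar_subalgebra_commutant:
  assumes "\<And>s. s \<in> S \<Longrightarrow> star s \<in> S"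
  shows "cstar_subalgebra (commutant S)"
proof -
  have "closed (commutant S)"
  proof -
    have "commutant S = (\<Inter>s\<in>S. {x. x * s = s * x})"
      by (auto simp: commutant_def)
    then show ?thesis
      by (simp only:) (intro closed_INT ballI closed_Collect_eq continuous_intros)
  qed
  moreover have "star x \<in> commutant S" if "x \<in> commutant S" for x
  proof -
    have "star x * s = s * star x" if "s \<in> S" for s
    proof -
      have "star (x * star s) = star (star s * x)"
        using assms[OF that] \<open>x \<in> commutant S\<close> by (simp add: commutant_def)
      then show ?thesis by (simp add: star_mult star_star)
    qed
    then show ?thesis by (simp add: commutant_def)
  qed
  moreover have "x * y \<in> commutant S" if "x \<in> commutant S" "y \<in> commutant S" for x y
    using that by (auto simp: commutant_def) (metis mult.assoc)
  ultimately show ?thesis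
    by (auto simp: cstar_subalgebra_def commutant_def mult_scaleC_left mult_scaleC_right distrib_left distrib_right)
qed

text \<open>Maximality controls abelian C*-subalgebras, so \<open>a\<close> must first be placed
  into one. If \<open>a\<close> is selfadjoint, \<open>B\<close> with \<open>a\<close> added is a
  commuting set closed under adjoints, and its double commutant is abelian. A general
  \<open>a\<close> need not be normal and is split into selfadjoint parts.\<close>

lemma maximal_abelian_commutant:
  assumes max: "maximal_abelian B" and a: "\<And>b. b \<in> B \<Longrightarrow> a * b = b * a"
  shows "a \<in> B"
proof -
  have B: "cstar_subalgebra B" and comm: "\<And>x y. x \<in> B \<Longrightarrow> y \<in> B \<Longrightarrow> x * y = y * x"
    using max by (auto simp: maximal_abelian_def abelian_cstar_subalgebra_def)
  have starB: "star b \<in> B" if "b \<in> B" for b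
    using B that by (auto simp: cstar_subalgebra_def)
  have selfadjoint: "h \<in> B" if h: "star h = h" "\<And>b. b \<in> B \<Longrightarrow> h * b = b * h" for h
  proof -
    define S where "S = insert h B"
    have starS: "star s \<in> S" if "s \<in> S" for s
      using that h starB by (auto simp: S_def)
    define C where "C = commutant (commutant S)"
    have "S \<subseteq> commutant S"
      using h comm by (auto simp: S_def commutant_def)
    then have "C \<subseteq> commutant S"
      unfolding C_def by (rule commutant_antimono)
    moreover have "cstar_subalgebra C"
      unfolding C_def
      using cstar_subalgebra_commutant[of S] starS
      by (intro cstar_subalgebra_commutant) (auto simp: cstar_subalgebra_def)
    ultimately have "abelian_cstar_subalgebra C"
      unfolding abelian_cstar_subalgebra_def C_def commutant_def[of "commutant S"] by blast
    moreover have "S \<subseteq> C"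
      by (auto simp: C_def commutant_def)
    ultimately show ?thesis
      using max unfolding maximal_abelian_def S_def by blast
  qed
  have a': "star a * b = b * star a" if "b \<in> B" for b
    using arg_cong[OF a[OF starB[OF that]], of star] by (simp add: star_mult star_star)
  have "a + star a \<in> B"
    by (rule selfadjoint) (simp_all add: star_add star_star a a' algebra_simps)
  moreover have "\<i> *\<^sub>C a + (- \<i>) *\<^sub>C star a \<in> B"
    by (rule selfadjoint)
       (simp_all add: star_add star_star star_scaleC a a' distrib_left distrib_right mult_scaleC_left mult_scaleC_right)
  \<comment> \<open>Recovers a = Re a + i Im a; the second summand is built from i a - i a^*, which
    is -2 Im a.\<close>
  ultimately have "(1/2) *\<^sub>C (a + star a) + (- \<i> / 2) *\<^sub>C (\<i> *\<^sub>C a + (- \<i>) *\<^sub>C star a) \<in> B"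
    using B by (auto simp: cstar_subalgebra_def)
  also have "(1/2) *\<^sub>C (a + star a) + (- \<i> / 2) *\<^sub>C (\<i> *\<^sub>C a + (- \<i>) *\<^sub>C star a) = 
     ((1/2) *\<^sub>C a + (1/2) *\<^sub>C a) + ((1/2) *\<^sub>C star a + (-1/2) *\<^sub>C star a)"
    by (simp add: scaleC_add_right scaleC_scaleC)
  also have "\<dots> = (1/2 + 1/2) *\<^sub>C a + (1/2 + (-1/2)) *\<^sub>C star a"
    by (simp only: scaleC_add_left)
  also have "\<dots> = a"
    using scaleC_of_real[of 1 a] scaleC_of_real[of 0 "star a"] by simp
  finally show ?thesis .
qed

text \<open>In a common eigenbasis \<open>S\<close> is an algebra of functions on the index set, and
  its minimal projections are the indicators of the classes of indices that \<open>S\<close> does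
  not separate. To index them by 'n, each indicator sits at the representative of its class and the
  other indices get 0.\<close>

lemma minimal_projections_of_abelian_algebra:
  fixes S :: "(complex^'n^'n) set"
  assumes comm: "\<And>a b. a \<in> S \<Longrightarrow> b \<in> S \<Longrightarrow> a ** b = b ** a"
    and star: "\<And>a. a \<in> S \<Longrightarrow> conj_transpose a \<in> S"
    and one: "mat 1 \<in> S" and add: "\<And>a b. a \<in> S \<Longrightarrow> b \<in> S \<Longrightarrow> a + b \<in> S"
    and mult: "\<And>a b. a \<in> S \<Longrightarrow> b \<in> S \<Longrightarrow> a ** b \<in> S"
    and scale: "\<And>a c. a \<in> S \<Longrightarrow> matscale c a \<in> S"
  obtains Q :: "'n \<Rightarrow> complex^'n^'n" where
    "\<And>i. Q i \<in> S" "\<And>i. conj_transpose (Q i) = Q i" "\<And>i. Q i ** Q i = Q i"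
    "\<And>i b. b \<in> S \<Longrightarrow> \<exists>c. b ** Q i = matscale c (Q i)" "(\<Sum>i\<in>UNIV. Q i) = mat 1"
proof -
  obtain V where V: "unitary_mat V" "\<And>a. a \<in> S \<Longrightarrow> diagonal_mat (conj_transpose V ** a ** V)"
    by (rule simultaneous_diagonalization[of S]) (use comm star in auto)
  define D where "D f = V ** diag_mat f ** conj_transpose V" for f
  have D_mult: "D f ** D g = D (\<lambda>i. f i * g i)" for f g
    unfolding D_def
    by (simp add: matrix_mul_assoc[symmetric] unitary_cancel_left[OF V(1)])
       (simp add: matrix_mul_assoc monomial_mat_mult)
  have D_add: "D f + D g = D (\<lambda>i. f i + g i)" for f g
  proof -
    have "diag_mat (\<lambda>i. f i + g i) = diag_mat f + diag_mat g"
      by (simp add: monomial_mat_def vec_eq_iff)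
    then show ?thesis by (simp add: D_def matrix_add_ldistrib matrix_mult_add_left)
  qed
  have D_scale: "matscale c (D f) = D (\<lambda>i. c * f i)" for c f
  proof -
    have "diag_mat (\<lambda>i. c * f i) = matscale c (diag_mat f)"
      by (simp add: monomial_mat_def vec_eq_iff matscale_def)
    then show ?thesis by (simp add: D_def matscale_mult_left matscale_mult_right)
  qed
  have D_adj: "conj_transpose (D f) = D (\<lambda>i. cnj (f i))" for f
    by (simp add: D_def conj_transpose_mult conj_transpose_monomial_mat matrix_mul_assoc)
  have D1: "D (\<lambda>_. 1) = mat 1"
    by (simp add: D_def diag_mat_1 unitary_mat_right[OF V(1)])
  have D0: "D (\<lambda>_. 0) = 0"
    using D_scale[of 0 "\<lambda>_. 1"] by simp
  have D_sum: "(\<Sum>i\<in>I. D (f i)) = D (\<lambda>k. \<Sum>i\<in>I. f i k)" for I and f :: "'n \<Rightarrow> 'n \<Rightarrow> complex"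
    by (induction I rule: infinite_finite_induct) (simp_all add: D0 D_add)
  have S_D: "\<exists>f. a = D f" if "a \<in> S" for a
  proof -
    obtain f where "conj_transpose V ** a ** V = diag_mat f"
      using diagonal_mat_eq[OF V(2)[OF \<open>a \<in> S\<close>]] by blast
    then have "D f = V ** (conj_transpose V ** a ** V) ** conj_transpose V"
      by (simp add: D_def)
    also have "\<dots> = a"
      by (simp add: matrix_mul_assoc[symmetric] unitary_cancel_left'[OF V(1)] unitary_mat_right[OF V(1)])
    finally show ?thesis by blast
  qed
  define sim where "sim i j \<longleftrightarrow> (\<forall>f. D f \<in> S \<longrightarrow> f i = f j)" for i j
  define ind where "ind i = (\<lambda>k. if sim i k then 1 else 0 :: complex)" for i
  have ind: "D (ind i) \<in> S" for i
  proof -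
    \<comment> \<open>A function separating i from j, normalized to the values 1 and 0 there; as in
      Lagrange interpolation, the product over all such j is the indicator of the class of
      i.\<close>
    have "\<exists>f. D f \<in> S \<and> f i = 1 \<and> f j = 0" if "\<not> sim i j" for j
    proof -
      from that obtain f where f: "D f \<in> S" "f i \<noteq> f j" by (auto simp: sim_def)
      have "matscale (1 / (f i - f j)) (D f + matscale (- f j) (mat 1)) \<in> S"
        by (intro scale add f one)
      then have "D (\<lambda>k. (f k - f j) / (f i - f j)) \<in> S"
        by (simp add: D_scale D_add flip: D1)
      then show ?thesis using f(2) by (intro exI[of _ "\<lambda>k. (f k - f j) / (f i - f j)"]) auto
    qed
    then obtain F where F: "\<And>j. \<not> sim i j \<Longrightarrow> D (F j) \<in> S \<and> F j i = 1 \<and> F j j = 0"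
      by metis
    have prod: "D (\<lambda>k. \<Prod>j\<in>J. F j k) \<in> S" if "J \<subseteq> {j. \<not> sim i j}" for J
      using finite[of J] that
    proof (induction J rule: finite_induct)
      case (insert j J)
      then have "D (F j) ** D (\<lambda>k. \<Prod>j\<in>J. F j k) \<in> S"
        using F by (intro mult) auto
      then show ?case using insert by (simp add: D_mult)
    qed (simp add: D1 one)
    have "(\<lambda>k. \<Prod>j\<in>{j. \<not> sim i j}. F j k) = ind i"
    proof
      fix k
      show "(\<Prod>j\<in>{j. \<not> sim i j}. F j k) = ind i k"
      proof (cases "sim i k")
        case True
        \<comment> \<open>The product itself belongs to the algebra, so it cannot separate k from
          i.\<close>
        then have "(\<Prod>j\<in>{j. \<not> sim i j}. F j k) = (\<Prod>j\<in>{j. \<not> sim i j}. F j i)"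
          using prod[OF subset_refl] unfolding sim_def[of i k] by metis
        also have "\<dots> = 1" using F by (intro prod.neutral) auto
        finally show ?thesis using True by (simp add: ind_def)
      next
        case False
        then show ?thesis using F by (auto simp: ind_def)
      qed
    qed
    then show ?thesis using prod[OF subset_refl] by simp
  qed
  have sim_refl: "sim i i" and sim_sym: "sim i j \<Longrightarrow> sim j i" and sim_trans: "sim i j \<Longrightarrow> sim j k \<Longrightarrow> sim i k" for i j k
    by (auto simp: sim_def)
  define rep where "rep i = (SOME j. sim i j)" for i
  have rep: "sim i (rep i)" for i
    unfolding rep_def by (rule someI) (rule sim_refl)
  have rep_eq: "rep i = rep k" if "sim i k" for i k
    unfolding rep_def using that sim_sym sim_trans by (intro arg_cong[where f = Eps] ext) blast
  define f where "f i = (if rep i = i then ind i else (\<lambda>_. 0))" for i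
  have f_eq: "f i k = (if i = rep k then 1 else 0)" for i k
  proof (cases "i = rep k")
    case True
    then show ?thesis using rep[of k] rep_eq[OF rep[of k]] sim_sym by (auto simp: f_def ind_def)
  next
    case False
    then show ?thesis using rep_eq[of i k] by (auto simp: f_def ind_def)
  qed
  show ?thesis
  proof (rule that[of "\<lambda>i. D (f i)"])
    fix i
    show "D (f i) \<in> S"
      using ind scale[OF one, of 0] by (simp add: f_def D0)
    show "conj_transpose (D (f i)) = D (f i)"
      unfolding D_adj by (rule arg_cong[where f = D]) (simp add: f_eq fun_eq_iff)
    show "D (f i) ** D (f i) = D (f i)"
      unfolding D_mult by (rule arg_cong[where f = D]) (simp add: f_eq fun_eq_iff)
    fix b assume b: "b \<in> S"
    then obtain g where g: "b = D g" using S_D by blast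
    have "g k * f i k = g i * f i k" for k
      using b unfolding g by (cases "rep i = i") (auto simp: f_def ind_def sim_def)
    then have "D g ** D (f i) = matscale (g i) (D (f i))"
      unfolding D_mult D_scale by (intro arg_cong[where f = D] ext)
    then show "\<exists>c. b ** D (f i) = matscale c (D (f i))"
      unfolding g by blast
  next
    show "(\<Sum>i\<in>UNIV. D (f i)) = mat 1"
      unfolding D_sum by (simp add: f_eq D1)
  qed
qed

section \<open>Fibers of a maximal abelian subalgebra\<close>

lemma circle_fun_add: "circle_fun (a + b) z = circle_fun a z + circle_fun b z"
  and circle_fun_mult: "circle_fun (a * b) z = circle_fun a z ** circle_fun b z"
  and circle_fun_scaleC: "circle_fun (scaleC c a) z = matscale c (circle_fun a z)"
  and circle_fun_star: "circle_fun (star a) z = conj_transpose (circle_fun a z)"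
  by (simp_all add: circle_rep_eqs')

definition fiber :: "'n::finite circle_matrix_algebra set \<Rightarrow> complex \<Rightarrow> (complex^'n^'n) set" where
  "fiber B z = (\<lambda>b. circle_fun b z) ` B"

text \<open>Minimal relative to \<open>S\<close>: compressed to q, the elements of \<open>S\<close>
  become scalars. The rank of q as a matrix may still exceed one.\<close>

definition minimal_projections :: "(complex^'n^'n) set \<Rightarrow> (complex^'n^'n) set" where
  "minimal_projections S = {q \<in> S. q \<noteq> 0 \<and> conj_transpose q = q \<and> q ** q = q \<and>
     (\<forall>b\<in>S. \<exists>c. b ** q = matscale c q)}"

lemma minimal_projectionsD:
  assumes "q \<in> minimal_projections S"
  shows "q \<in> S" "q \<noteq> 0" "conj_transpose q = q" "q ** q = q" "b \<in> S \<Longrightarrow> \<exists>c. b ** q = matscale c q"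
  using assms by (auto simp: minimal_projections_def)

lemma opnorm_projection:
  assumes "q \<noteq> 0" "conj_transpose q = q" "q ** q = q"
  shows "opnorm q = 1"
proof -
  have "(opnorm q)\<^sup>2 = opnorm q"
    using opnorm_cstar[of q] assms by simp
  then show ?thesis
    using assms(1) by (simp add: power2_eq_square)
qed

lemma trace_projection_neq_0:
  assumes "q \<noteq> 0" "conj_transpose q = q" "q ** q = q"
  shows "trace q \<noteq> 0"
  using trace_conj_transpose_mult_self[of q] assms by simp

lemma matscale_self_eqD:
  assumes "A \<noteq> 0" "matscale c A = A"
  shows "c = 1"
proof -
  obtain i j where "A $ i $ j \<noteq> 0"
    using assms(1) by (auto simp: vec_eq_iff)
  moreover have "c * A $ i $ j = A $ i $ j"
    using arg_cong[OF assms(2), of "\<lambda>M. M $ i $ j"] by (simp add: matscale_def)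
  ultimately show ?thesis by simp
qed

text \<open>The product is a multiple of p and of q. Since p and q are idempotent, a nonzero product
  would be equal to both.\<close>

lemma minimal_projections_orthogonal:
  assumes comm: "\<And>a b. a \<in> S \<Longrightarrow> b \<in> S \<Longrightarrow> a ** b = b ** a"
    and p: "p \<in> minimal_projections S" and q: "q \<in> minimal_projections S" and "p \<noteq> q"
  shows "p ** q = 0"
proof (rule ccontr)
  assume nz: "p ** q \<noteq> 0"
  obtain c where c: "p ** q = matscale c q"
    using minimal_projectionsD[OF p] minimal_projectionsD[OF q] by blast
  obtain d where d: "q ** p = matscale d p"
    using minimal_projectionsD[OF p] minimal_projectionsD[OF q] by blast
  have eq: "matscale c q = matscale d p"
    using c d comm[of p q] minimal_projectionsD(1)[OF p] minimal_projectionsD(1)[OF q] by simp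
  have "matscale c (p ** q) = p ** (p ** q)"
    by (simp add: c matscale_mult_right)
  also have "\<dots> = p ** q"
    using minimal_projectionsD(4)[OF p] by (simp add: matrix_mul_assoc)
  finally have "c = 1"
    using nz matscale_self_eqD by blast
  have "matscale d (q ** p) = q ** (q ** p)"
    by (simp add: d matscale_mult_right)
  also have "\<dots> = q ** p"
    using minimal_projectionsD(4)[OF q] by (simp add: matrix_mul_assoc)
  finally have "d = 1"
    using nz matscale_self_eqD comm[of p q] minimal_projectionsD(1)[OF p] minimal_projectionsD(1)[OF q] by metis
  with \<open>c = 1\<close> eq \<open>p \<noteq> q\<close> show False by simp
qed

text \<open>Orthogonality gives p = p (p - q), so the operator norm of p - q is at least 1; the
  square of the dimension is the price for passing to the norm of the matrix space. The bound does
  not depend on \<open>S\<close>, so it is uniform over the circle.\<close>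

lemma minimal_projections_dist:
  fixes p q :: "complex^'n^'n"
  assumes comm: "\<And>a b. a \<in> S \<Longrightarrow> b \<in> S \<Longrightarrow> a ** b = b ** a"
    and p: "p \<in> minimal_projections S" and q: "q \<in> minimal_projections S" and "p \<noteq> q"
  shows "1 / (real CARD('n))\<^sup>2 \<le> dist p q"
proof -
  have "p ** (p + (- 1) *\<^sub>R q) = p"
    using minimal_projections_orthogonal[OF assms] minimal_projectionsD[OF p]
    by (simp add: matrix_add_ldistrib scaleR_matscale matscale_mult_right del: scaleR_minus1_left)
  then have "p = p ** (p - q)" by simp
  then have "opnorm p \<le> opnorm p * opnorm (p - q)"
    using opnorm_mult[of p "p - q"] by simp
  then have "1 \<le> opnorm (p - q)"
    using minimal_projectionsD[OF p] by (simp add: opnorm_projection)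
  also have "\<dots> \<le> (real CARD('n))\<^sup>2 * dist p q"
    unfolding dist_norm by (rule opnorm_le_norm)
  finally show ?thesis by (simp add: field_simps)
qed

lemma bounded_minimal_projections:
  "q \<in> minimal_projections S \<Longrightarrow> norm (q :: complex^'n^'n) \<le> (real CARD('n))\<^sup>2"
  using norm_le_opnorm[of q] minimal_projectionsD[of q S] by (simp add: opnorm_projection)

locale masa_with_expectation =
  fixes B :: "'n::finite circle_matrix_algebra set" and E
  assumes max: "maximal_abelian B" and E: "conditional_expectation_onto B E"
begin

lemma cstar_subalgebra_B: "cstar_subalgebra B"
  and commute_B: "x \<in> B \<Longrightarrow> y \<in> B \<Longrightarrow> x * y = y * x"
  using max by (auto simp: maximal_abelian_def abelian_cstar_subalgebra_def)

text \<open>Scalar functions are central, so maximality puts C(S^1) inside \<open>B\<close>. This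
  makes the expectation linear over C(S^1), and it puts the unit into every fiber.\<close>

lemma scalar_in_B:
  assumes "\<And>z. z \<in> sphere 0 1 \<Longrightarrow> circle_fun s z = matscale (g z) (mat 1)"
  shows "s \<in> B"
  by (rule maximal_abelian_commutant[OF max], rule circle_eqI)
     (simp add: circle_rep_eqs' assms matscale_mult_left matscale_mult_right)

lemma fiber_commute:
  assumes "a \<in> fiber B z" "b \<in> fiber B z"
  shows "a ** b = b ** a"
proof -
  obtain x y where x: "x \<in> B" "a = circle_fun x z" and y: "y \<in> B" "b = circle_fun y z"
    using assms by (auto simp: fiber_def)
  have "circle_fun (x * y) z = circle_fun (y * x) z"
    using commute_B[OF x(1) y(1)] by simp
  then show ?thesis
    by (simp add: x y circle_rep_eqs')
qed

lemma fiber_one: "z \<in> sphere 0 1 \<Longrightarrow> mat 1 \<in> fiber B z"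
  unfolding fiber_def
  by (rule image_eqI[of _ _ "const_circle (mat 1)"]) (auto intro: scalar_in_B[of _ "\<lambda>_. 1"])

lemma fiberI: "b \<in> B \<Longrightarrow> q = circle_fun b z \<Longrightarrow> q \<in> fiber B z"
  by (simp add: fiber_def)

lemma fiberE:
  assumes "q \<in> fiber B z"
  obtains b where "b \<in> B" "q = circle_fun b z"
  using assms by (auto simp: fiber_def)

lemma fiber_star: "a \<in> fiber B z \<Longrightarrow> conj_transpose a \<in> fiber B z"
  using cstar_subalgebra_B unfolding cstar_subalgebra_def
  by (elim fiberE) (rule fiberI[OF _ circle_fun_star[symmetric, THEN trans[rotated]]]; simp)

lemma fiber_add: "a \<in> fiber B z \<Longrightarrow> b \<in> fiber B z \<Longrightarrow> a + b \<in> fiber B z"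
  using cstar_subalgebra_B unfolding cstar_subalgebra_def
  by (elim fiberE) (rule fiberI[OF _ circle_fun_add[symmetric, THEN trans[rotated]]]; simp)

lemma fiber_mult: "a \<in> fiber B z \<Longrightarrow> b \<in> fiber B z \<Longrightarrow> a ** b \<in> fiber B z"
  using cstar_subalgebra_B unfolding cstar_subalgebra_def
  by (elim fiberE) (rule fiberI[OF _ circle_fun_mult[symmetric, THEN trans[rotated]]]; simp)

lemma fiber_scale: "a \<in> fiber B z \<Longrightarrow> matscale c a \<in> fiber B z"
  using cstar_subalgebra_B unfolding cstar_subalgebra_def
  by (elim fiberE) (rule fiberI[OF _ circle_fun_scaleC[symmetric, THEN trans[rotated]]]; simp)

abbreviation minp :: "complex \<Rightarrow> (complex^'n^'n) set" where
  "minp z \<equiv> minimal_projections (fiber B z)"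

lemma minp_orthogonal: "p \<in> minp z \<Longrightarrow> q \<in> minp z \<Longrightarrow> p \<noteq> q \<Longrightarrow> p ** q = 0"
  by (rule minimal_projections_orthogonal[where S = "fiber B z"]) (erule (1) fiber_commute | assumption)+

lemma minp_dist: "p \<in> minp z \<Longrightarrow> q \<in> minp z \<Longrightarrow> p \<noteq> q \<Longrightarrow> 1 / (real CARD('n))\<^sup>2 \<le> dist p q"
  by (rule minimal_projections_dist[where S = "fiber B z"]) (erule (1) fiber_commute | assumption)+

text \<open>Zeros are allowed because the number of minimal projections of the fiber is not yet
  known to be n. A nonzero \<open>Q i\<close> cannot repeat: multiplied by \<open>Q i\<close>, the
  sum would give \<open>Q i\<close> times its multiplicity.\<close>

lemma exists_minimal_projection_frame:
  assumes "z \<in> sphere 0 1"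
  obtains Q :: "'n \<Rightarrow> complex^'n^'n" where "\<And>i. Q i = 0 \<or> Q i \<in> minp z" "(\<Sum>i\<in>UNIV. Q i) = mat 1"
    "\<And>i j. i \<noteq> j \<Longrightarrow> Q i \<noteq> 0 \<Longrightarrow> Q i \<noteq> Q j"
proof -
  obtain Q :: "'n \<Rightarrow> complex^'n^'n" where Q:
    "\<And>i. Q i \<in> fiber B z" "\<And>i. conj_transpose (Q i) = Q i" "\<And>i. Q i ** Q i = Q i"
    "\<And>i b. b \<in> fiber B z \<Longrightarrow> \<exists>c. b ** Q i = matscale c (Q i)" "(\<Sum>i\<in>UNIV. Q i) = mat 1"
    by (rule minimal_projections_of_abelian_algebra[of "fiber B z"])
       (erule (1) fiber_commute fiber_add fiber_mult | erule fiber_star fiber_scale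
         | rule fiber_one[OF assms] | blast)+
  have min: "Q i = 0 \<or> Q i \<in> minp z" for i
    using Q by (auto simp: minimal_projections_def)
  have "Q i \<noteq> Q j" if "i \<noteq> j" "Q i \<noteq> 0" for i j
  proof
    assume eq: "Q i = Q j"
    define c where "c k = (if Q k = Q i then 1 else 0 :: complex)" for k
    have "Q i ** Q k = matscale (c k) (Q i)" for k
      using min[of i] min[of k] that(2) Q(3)[of i]
        minp_orthogonal[of "Q i" z "Q k"]
      by (auto simp: c_def)
    then have "Q i ** (\<Sum>k\<in>UNIV. Q k) = (\<Sum>k\<in>UNIV. matscale (c k) (Q i))"
      by (simp add: matrix_mult_sum_right)
    also have "\<dots> = matscale (\<Sum>k\<in>UNIV. c k) (Q i)"
      by (simp add: vec_eq_iff sum_component matscale_def sum_distrib_right)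
    finally have "(\<Sum>k\<in>UNIV. c k) = 1"
      using matscale_self_eqD[OF that(2)] Q(5) by simp
    moreover have "(\<Sum>k\<in>UNIV. c k) = of_nat (card {k. Q k = Q i})"
      by (simp add: c_def sum.If_cases)
    moreover have "card {i, j} \<le> card {k. Q k = Q i}"
      using eq by (intro card_mono) auto
    ultimately show False
      using that(1) by simp
  qed
  with min Q(5) that show ?thesis by blast
qed

text \<open>The expectation at the point \<open>z\<close>, expanded in matrix units. It depends on
  \<open>z\<close> only through finitely many continuous functions.\<close>

definition fiber_expectation :: "complex \<Rightarrow> complex^'n^'n \<Rightarrow> complex^'n^'n" where
  "fiber_expectation z x =
     (\<Sum>i\<in>UNIV. \<Sum>j\<in>UNIV. matscale (x $ i $ j) (circle_fun (E (const_circle (mat_unit i j))) z))"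

lemma E_sum: "E (\<Sum>i\<in>I. f i) = (\<Sum>i\<in>I. E (f i))"
proof -
  have add: "E (x + y) = E x + E y" for x y
    using E by (auto simp: conditional_expectation_onto_def)
  have "E 0 = 0" using add[of 0 0] by simp
  with add show ?thesis
    by (induction I rule: infinite_finite_induct) auto
qed

text \<open>Writing a as the sum of a_ij e_ij, the coefficients are scalar functions in
  \<open>B\<close>, and the module property pulls them out of \<open>E\<close>.\<close>

lemma circle_fun_E:
  assumes "z \<in> sphere 0 1"
  shows "circle_fun (E a) z = fiber_expectation z (circle_fun a z)"
proof -
  have "\<exists>s :: 'n circle_matrix_algebra. \<forall>z\<in>sphere 0 1. circle_fun s z = matscale (circle_fun a z $ i $ j) (mat 1)" for i j
    by (intro exists_circle_fun continuous_on_matscale_fun continuous_intros continuous_circle_fun)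
  then obtain s :: "'n \<Rightarrow> 'n \<Rightarrow> 'n circle_matrix_algebra" where s: "\<And>i j z. z \<in> sphere 0 1 \<Longrightarrow> circle_fun (s i j) z = matscale (circle_fun a z $ i $ j) (mat 1)"
    by metis
  have sB: "s i j \<in> B" for i j
    by (rule scalar_in_B) (rule s)
  have "a = (\<Sum>i\<in>UNIV. \<Sum>j\<in>UNIV. s i j * const_circle (mat_unit i j))"
    by (rule circle_eqI) (simp add: circle_fun_sum circle_rep_eqs' s matscale_mult_left sum_mat_units)
  then have "E a = (\<Sum>i\<in>UNIV. \<Sum>j\<in>UNIV. E (s i j * const_circle (mat_unit i j)))"
    by (simp only: E_sum)
  also have "\<dots> = (\<Sum>i\<in>UNIV. \<Sum>j\<in>UNIV. s i j * E (const_circle (mat_unit i j)))"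
    using E sB by (simp add: conditional_expectation_onto_def)
  finally show ?thesis
    using assms by (simp add: fiber_expectation_def circle_fun_sum circle_rep_eqs' s matscale_mult_left)
qed

text \<open>The fiber as a fixed point set: an equation continuous in \<open>z\<close> and
  \<open>q\<close> together, hence stable under limits.\<close>

lemma in_fiber_iff:
  assumes "z \<in> sphere 0 1"
  shows "q \<in> fiber B z \<longleftrightarrow> fiber_expectation z q = q"
proof
  assume "q \<in> fiber B z"
  then obtain b where "b \<in> B" "q = circle_fun b z" by (auto simp: fiber_def)
  moreover have "E b = b" using E \<open>b \<in> B\<close> by (simp add: conditional_expectation_onto_def)
  ultimately show "fiber_expectation z q = q"
    using circle_fun_E[OF assms, of b] by simp
next
  assume "fiber_expectation z q = q"
  then have "q = circle_fun (E (const_circle q)) z"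
    using assms by (simp add: circle_fun_E)
  moreover have "E (const_circle q) \<in> B"
    using E by (simp add: conditional_expectation_onto_def)
  ultimately show "q \<in> fiber B z" by (auto simp: fiber_def)
qed

section \<open>Continuity of the minimal projections in the base point\<close>

lemma tendsto_circle_fun:
  fixes a :: "'n circle_matrix_algebra"
  assumes "\<And>k. \<zeta> k \<in> sphere 0 1" "z \<in> sphere 0 1" "\<zeta> \<longlonglongrightarrow> z"
  shows "(\<lambda>k. circle_fun a (\<zeta> k)) \<longlonglongrightarrow> circle_fun a z"
  using continuous_circle_fun[of a] assms unfolding continuous_on_sequentially comp_def by blast

lemma fiber_closed_graph:
  assumes \<zeta>: "\<And>k. \<zeta> k \<in> sphere 0 1" and z: "z \<in> sphere 0 1" and lim: "\<zeta> \<longlonglongrightarrow> z" "q \<longlonglongrightarrow> q0"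
    and q: "\<And>k. q k \<in> fiber B (\<zeta> k)"
  shows "q0 \<in> fiber B z"
proof -
  have "(\<lambda>k. fiber_expectation (\<zeta> k) (q k)) \<longlonglongrightarrow> fiber_expectation z q0"
    unfolding fiber_expectation_def matscale_def
    by (intro tendsto_intros tendsto_circle_fun lim \<zeta> z)
  moreover have "fiber_expectation (\<zeta> k) (q k) = q k" for k
    using q[of k] in_fiber_iff[OF \<zeta>] by simp
  ultimately have "q \<longlonglongrightarrow> fiber_expectation z q0" by simp
  then show ?thesis
    using LIMSEQ_unique[OF _ lim(2)] in_fiber_iff[OF z] by blast
qed

text \<open>The factor c in b q = c q is unknown and varies with the point, so it is eliminated by
  traces: tr(q) b q = tr(b q) q passes to the limit, and tr(q0) can be cancelled once q0 is nonzero.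
  The latter holds as projections of operator norm one stay away from 0. An element b of the limit
  fiber is approximated along a section in \<open>B\<close>.\<close>

lemma minp_closed_graph:
  assumes \<zeta>: "\<And>k. \<zeta> k \<in> sphere 0 1" and z: "z \<in> sphere 0 1" and lim: "\<zeta> \<longlonglongrightarrow> z" "q \<longlonglongrightarrow> q0"
    and q: "\<And>k. q k \<in> minp (\<zeta> k)"
  shows "q0 \<in> minp z"
proof -
  have fib: "q0 \<in> fiber B z"
    using fiber_closed_graph[OF \<zeta> z lim] q minimal_projectionsD(1) by blast
  have nz: "q0 \<noteq> 0"
  proof
    assume "q0 = 0"
    then have "(\<lambda>k. norm (q k)) \<longlonglongrightarrow> 0"
      using lim(2) tendsto_norm_zero by blast
    moreover have "1 / (real CARD('n))\<^sup>2 \<le> norm (q k)" for k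
      using opnorm_le_norm[of "q k"] minimal_projectionsD[OF q[of k]]
      by (simp add: opnorm_projection field_simps)
    ultimately have "1 / (real CARD('n))\<^sup>2 \<le> 0"
      by (meson LIMSEQ_le_const)
    then show False by (simp add: field_simps)
  qed
  have "(\<lambda>k. conj_transpose (q k)) \<longlonglongrightarrow> conj_transpose q0"
    unfolding conj_transpose_def by (intro tendsto_intros lim)
  then have star: "conj_transpose q0 = q0"
    unfolding minimal_projectionsD(3)[OF q] by (rule LIMSEQ_unique[OF _ lim(2)])
  have tm: "(\<lambda>k. a k ** b k) \<longlonglongrightarrow> a0 ** b0" if "a \<longlonglongrightarrow> a0" "b \<longlonglongrightarrow> b0"
    for a b :: "nat \<Rightarrow> complex^'n^'n" and a0 b0
    unfolding matrix_matrix_mult_def by (intro tendsto_intros that)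
  have tt: "(\<lambda>k. trace (a k)) \<longlonglongrightarrow> trace a0" if "a \<longlonglongrightarrow> a0" for a :: "nat \<Rightarrow> complex^'n^'n" and a0
    unfolding trace_def by (intro tendsto_intros that)
  have ts: "(\<lambda>k. matscale (c k) (a k)) \<longlonglongrightarrow> matscale c0 a0" if "c \<longlonglongrightarrow> c0" "a \<longlonglongrightarrow> a0"
    for a :: "nat \<Rightarrow> complex^'n^'n" and a0 c c0
    unfolding matscale_def by (intro tendsto_intros that)
  have idem: "q0 ** q0 = q0"
    using tm[OF lim(2) lim(2)] unfolding minimal_projectionsD(4)[OF q] by (rule LIMSEQ_unique[OF _ lim(2)])
  have "\<exists>c. b ** q0 = matscale c q0" if "b \<in> fiber B z" for b
  proof -
    obtain \<beta> where \<beta>: "\<beta> \<in> B" "b = circle_fun \<beta> z"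
      using \<open>b \<in> fiber B z\<close> by (auto simp: fiber_def)
    define b' where "b' k = circle_fun \<beta> (\<zeta> k)" for k
    have b': "b' \<longlonglongrightarrow> b"
      unfolding b'_def \<beta>(2) by (rule tendsto_circle_fun[OF \<zeta> z lim(1)])
    have "matscale (trace (q k)) (b' k ** q k) = matscale (trace (b' k ** q k)) (q k)" for k
    proof -
      have "b' k \<in> fiber B (\<zeta> k)"
        using \<beta>(1) by (auto simp: b'_def fiber_def)
      then obtain c where "b' k ** q k = matscale c (q k)"
        using minimal_projectionsD(5)[OF q] by blast
      then show ?thesis
        by (simp add: trace_matscale matscale_matscale mult.commute)
    qed
    moreover have "(\<lambda>k. matscale (trace (q k)) (b' k ** q k)) \<longlonglongrightarrow> matscale (trace q0) (b ** q0)"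
      by (intro ts tt tm lim b')
    moreover have "(\<lambda>k. matscale (trace (b' k ** q k)) (q k)) \<longlonglongrightarrow> matscale (trace (b ** q0)) q0"
      by (intro ts tt tm lim b')
    ultimately have "matscale (trace q0) (b ** q0) = matscale (trace (b ** q0)) q0"
      by (simp add: LIMSEQ_unique)
    then have "matscale (1 / trace q0) (matscale (trace q0) (b ** q0)) =
        matscale (1 / trace q0) (matscale (trace (b ** q0)) q0)"
      by simp
    then show ?thesis
      using trace_projection_neq_0[OF nz star idem] by (auto simp: matscale_matscale)
  qed
  with fib nz star idem show ?thesis
    by (simp add: minimal_projections_def)
qed

text \<open>Otherwise a sequence of minimal projections over points tending to \<open>z0\<close>
  stays away from those over \<open>z0\<close>; being bounded it has a limit point, which
  contradicts the closed graph.\<close>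

lemma minp_upper_semicontinuous:
  assumes z0: "z0 \<in> sphere 0 1" and "e > 0"
  shows "\<exists>d>0. \<forall>z\<in>sphere 0 1. dist z z0 < d \<longrightarrow> (\<forall>q\<in>minp z. \<exists>p\<in>minp z0. dist q p < e)"
proof (rule ccontr)
  assume neg: "\<not> ?thesis"
  have "\<exists>z q. z \<in> sphere 0 1 \<and> dist z z0 < inverse (real (Suc k)) \<and> q \<in> minp z \<and> (\<forall>p\<in>minp z0. \<not> dist q p < e)" for k
  proof -
    have "0 < inverse (real (Suc k))" by simp
    with neg show ?thesis by blast
  qed
  then obtain \<zeta> q where \<zeta>: "\<And>k. \<zeta> k \<in> sphere 0 1" "\<And>k. dist (\<zeta> k) z0 < inverse (real (Suc k))"
    and q: "\<And>k. q k \<in> minp (\<zeta> k)" and far: "\<And>k p. p \<in> minp z0 \<Longrightarrow> \<not> dist (q k) p < e"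
    by metis
  have lim: "\<zeta> \<longlonglongrightarrow> z0"
    by (rule metric_tendsto_imp_tendsto[OF LIMSEQ_inverse_real_of_nat])
       (use \<zeta>(2) in \<open>auto simp: dist_norm intro!: always_eventually less_imp_le\<close>)
  have "\<forall>k. q k \<in> cball 0 ((real CARD('n))\<^sup>2)"
    using bounded_minimal_projections[OF q] by simp
  then obtain q0 r where r: "strict_mono (r :: nat \<Rightarrow> nat)" "(q \<circ> r) \<longlonglongrightarrow> q0"
    using seq_compactE[OF compact_imp_seq_compact[OF compact_cball]] by blast
  have "q0 \<in> minp z0"
    by (rule minp_closed_graph[of "\<zeta> \<circ> r" _ "q \<circ> r"])
       (use \<zeta> q z0 r LIMSEQ_subseq_LIMSEQ[OF lim r(1)] in auto)
  moreover obtain k where "dist ((q \<circ> r) k) q0 < e"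
    using r(2) \<open>e > 0\<close> unfolding LIMSEQ_def by blast
  ultimately show False using far by auto
qed

text \<open>A minimal projection p over \<open>z0\<close> cannot be lost nearby. If none over z is
  close to p, every nonzero \<open>Q i\<close> over z is close to a minimal projection other than p,
  hence nearly orthogonal to p; but the \<open>Q i\<close> sum to 1, so p itself would be
  small.\<close>

lemma minp_lower_semicontinuous:
  assumes z0: "z0 \<in> sphere 0 1" and "e > 0"
  shows "\<exists>d>0. \<forall>z\<in>sphere 0 1. dist z z0 < d \<longrightarrow> (\<forall>p\<in>minp z0. \<exists>q\<in>minp z. dist q p < e)"
proof -
  define N where "N = real CARD('n)"
  have N: "N > 0" by (simp add: N_def)
  \<comment> \<open>Closeness 1/(2 N^3) costs N^2 for the comparison of norms and N for the number
    of summands, which leaves the contradiction 1 \<le> 1/2. The bound by \<open>e\<close> ensures p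
    \<noteq> p' below.\<close>
  define e' where "e' = min e (1 / (2 * N^3))"
  have "e' > 0" using \<open>e > 0\<close> N by (simp add: e'_def)
  then obtain d where d: "d > 0" "\<And>z q. z \<in> sphere 0 1 \<Longrightarrow> dist z z0 < d \<Longrightarrow> q \<in> minp z \<Longrightarrow> \<exists>p\<in>minp z0. dist q p < e'"
    using minp_upper_semicontinuous[OF z0] by metis
  have "\<exists>q\<in>minp z. dist q p < e" if z: "z \<in> sphere 0 1" "dist z z0 < d" and p: "p \<in> minp z0" for z p
  proof (rule ccontr)
    assume far: "\<not> ?thesis"
    obtain Q :: "'n \<Rightarrow> complex^'n^'n" where Q: "\<And>i. Q i = 0 \<or> Q i \<in> minp z" "(\<Sum>i\<in>UNIV. Q i) = mat 1"
      using exists_minimal_projection_frame[OF z(1)] by metis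
    have op: "opnorm p = 1"
      using minimal_projectionsD[OF p] by (intro opnorm_projection)
    have small: "opnorm (p ** Q i) \<le> 1 / (2 * N)" for i
    proof (cases "Q i = 0")
      case True
      then show ?thesis using N by (simp add: matrix_mult_0_right)
    next
      case False
      then have Qi: "Q i \<in> minp z" using Q(1)[of i] by blast
      then obtain p' where p': "p' \<in> minp z0" "dist (Q i) p' < e'"
        using d(2)[OF z] by blast
      then have "p \<noteq> p'" using far Qi by (auto simp: e'_def)
      then have "p ** p' = 0"
        using minp_orthogonal[OF p p'(1)] by simp
      then have "p ** Q i = p ** (Q i - p')"
        by (simp add: matrix_mult_diff_right)
      then have "opnorm (p ** Q i) \<le> opnorm (Q i - p')"
        using opnorm_mult[of p "Q i - p'"] op by simp
      also have "\<dots> \<le> N\<^sup>2 * dist (Q i) p'"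
        unfolding N_def dist_norm by (rule opnorm_le_norm)
      also have "\<dots> \<le> N\<^sup>2 * (1 / (2 * N^3))"
        using p'(2) by (intro mult_left_mono) (auto simp: e'_def)
      also have "\<dots> = 1 / (2 * N)"
        using N by (simp add: power2_eq_square power3_eq_cube)
      finally show ?thesis .
    qed
    have opsum: "opnorm (\<Sum>i\<in>I. f i) \<le> (\<Sum>i\<in>I. opnorm (f i))" for I and f :: "'n \<Rightarrow> complex^'n^'n"
    proof (induction I rule: infinite_finite_induct)
      case (insert x F)
      then show ?case using opnorm_triangle[of "f x" "sum f F"] by simp
    qed simp_all
    have "1 = opnorm (p ** (\<Sum>i\<in>UNIV. Q i))"
      using op Q(2) by simp
    also have "\<dots> \<le> (\<Sum>i\<in>UNIV. opnorm (p ** Q i))"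
      unfolding matrix_mult_sum_right by (rule opsum)
    also have "\<dots> \<le> (\<Sum>i\<in>(UNIV :: 'n set). 1 / (2 * N))"
      by (intro sum_mono small)
    also have "\<dots> = 1 / 2"
      using N by (simp add: N_def)
    finally show False by simp
  qed
  with d(1) show ?thesis by blast
qed

end

section \<open>Lifting to diagonalizing paths\<close>

lemma conj_transpose_sandwich_entry:
  "(conj_transpose V ** A ** V) $ i $ j = cinner (column i V) (A *v column j V)"
  unfolding cinner_mat
  by (simp add: cinner_def matrix_matrix_mult_def conj_transpose_def column_def matrix_vector_mult_def mult.commute)

definition outer :: "complex^'n \<Rightarrow> complex^'n \<Rightarrow> complex^'n^'n" where
  "outer u v = (\<chi> i j. u $ i * cnj (v $ j))"

lemma mult_outer: "A ** outer u v = outer (A *v u) v"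
  by (simp add: outer_def matrix_matrix_mult_def matrix_vector_mult_def vec_eq_iff sum_distrib_right mult.assoc)

lemma outer_mult: "outer u v ** A = outer u (conj_transpose A *v v)"
  by (simp add: outer_def matrix_matrix_mult_def matrix_vector_mult_def conj_transpose_def vec_eq_iff
      sum_distrib_left mult_ac)

lemma outer_mult_vec: "outer u v *v x = cinner v x *s u"
  by (simp add: outer_def matrix_vector_mult_def cinner_def vec_eq_iff sum_distrib_right)
    (simp add: mult_ac)

lemma trace_outer: "trace (outer u v) = cinner v u"
  by (simp add: outer_def trace_def cinner_def mult.commute)

lemma continuous_on_matrix_vector_mult:
  fixes f :: "'a::topological_space \<Rightarrow> complex^'n^'n"
  assumes "continuous_on S f" "continuous_on S g"
  shows "continuous_on S (\<lambda>z. f z *v g z)"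
  unfolding matrix_vector_mult_def by (intro continuous_intros assms)

lemma projection_range_transport:
  assumes "p *v y = y" "y \<noteq> 0" "opnorm (p - q) < 1"
  shows "q *v y \<noteq> 0"
proof
  assume "q *v y = 0"
  then have "(p - q) *v y = y"
    using assms(1) by (simp add: matrix_vector_mult_diff_rdistrib)
  then have "norm y \<le> opnorm (p - q) * norm y"
    using opnorm[of "p - q" y] by simp
  also have "\<dots> < 1 * norm y"
    using assms by (intro mult_strict_right_mono) auto
  finally show False by simp
qed

text \<open>A nonvanishing section of the line bundle is obtained by transporting a vector along a fine
  partition \<open>0, 1/N, \<dots>, 1\<close>; stopping each time at \<open>t\<close> makes the transported vector continuous in \<open>t\<close>.\<close>

lemma rank_one_projection_path_section:
  fixes p :: "real \<Rightarrow> complex^'n^'n"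
  assumes cont: "continuous_on {0..1} p"
    and star: "\<And>t. t \<in> {0..1} \<Longrightarrow> conj_transpose (p t) = p t"
    and idem: "\<And>t. t \<in> {0..1} \<Longrightarrow> p t ** p t = p t"
    and nz: "p 0 \<noteq> 0"
    and rank: "\<And>t x. t \<in> {0..1} \<Longrightarrow> \<exists>c. p t ** x ** p t = matscale c (p t)"
  obtains v where "continuous_on {0..1} v"
    "\<And>t. t \<in> {0..1} \<Longrightarrow> cinner (v t) (v t) = 1" "\<And>t. t \<in> {0..1} \<Longrightarrow> p t = outer (v t) (v t)"
proof -
  define K where "K = (real CARD('n))\<^sup>2"
  have K: "K > 0" by (simp add: K_def)
  have "uniformly_continuous_on {0..1} p"
    using cont by (intro compact_uniformly_continuous) auto
  then obtain d where d: "d > 0" "\<And>s t. s \<in> {0..1} \<Longrightarrow> t \<in> {0..1} \<Longrightarrow> dist s t < d \<Longrightarrow> dist (p s) (p t) < 1 / K"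
    unfolding uniformly_continuous_on_def using K by (metis divide_pos_pos zero_less_one)
  have close: "opnorm (p s - p t) < 1" if "s \<in> {0..1}" "t \<in> {0..1}" "dist s t < d" for s t
  proof -
    have "opnorm (p s - p t) \<le> K * dist (p s) (p t)"
      unfolding K_def dist_norm by (rule opnorm_le_norm)
    also have "\<dots> < K * (1 / K)"
      using d(2)[OF that] K by (intro mult_strict_left_mono) auto
    finally show ?thesis using K by simp
  qed
  obtain N where N: "inverse (real (Suc N)) < d"
    using reals_Archimedean[OF d(1)] by blast
  define M where "M = Suc N"
  obtain x where "p 0 *v x \<noteq> 0"
    using nz by (metis matrix_vector_mult_0 matrix_eq)
  define v0 where "v0 = p 0 *v x"
  have v0: "v0 \<noteq> 0" "p 0 *v v0 = v0"
    using \<open>p 0 *v x \<noteq> 0\<close> idem[of 0] by (simp_all add: v0_def matrix_vector_mul_assoc)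
  define w where "w = rec_nat (\<lambda>t. v0) (\<lambda>k f t. p (min t (real (Suc k) / M)) *v f t)"
  have w_0: "w 0 t = v0" and w_Suc: "w (Suc k) t = p (min t (real (Suc k) / M)) *v w k t" for k t
    by (simp_all add: w_def)
  have min01: "min t (real k / M) \<in> {0..1}" if "t \<in> {0..1}" for t k
    using that by (auto simp: min_def)
  have cont_w: "continuous_on {0..1} (w k)" for k
  proof (induction k)
    case 0
    then show ?case by (simp add: w_0[abs_def])
  next
    case (Suc k)
    have "continuous_on {0..1} (\<lambda>t. p (min t (real (Suc k) / M)))"
      by (rule continuous_on_compose2[OF cont]) (use min01 in \<open>auto intro!: continuous_intros\<close>)
    then show ?case
      unfolding w_Suc[abs_def] by (intro continuous_on_matrix_vector_mult Suc)
  qed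
  have w: "w k t \<noteq> 0 \<and> p (min t (real k / M)) *v w k t = w k t" if t: "t \<in> {0..1}" for k t
  proof (induction k)
    case 0
    then show ?case using v0 t by (simp add: w_0)
  next
    case (Suc k)
    have "dist (min t (real k / M)) (min t (real (Suc k) / M)) \<le> \<bar>real k / M - real (Suc k) / M\<bar>"
      by (auto simp: dist_real_def min_def)
    also have "\<dots> = inverse (real M)"
      by (simp add: add_divide_distrib inverse_eq_divide)
    also have "\<dots> < d" using N by (simp add: M_def)
    finally have "opnorm (p (min t (real k / M)) - p (min t (real (Suc k) / M))) < 1"
      by (intro close min01 t)
    then have "w (Suc k) t \<noteq> 0"
      unfolding w_Suc using Suc by (intro projection_range_transport[of "p (min t (real k / M))"]) auto
    moreover have "p (min t (real (Suc k) / M)) *v w (Suc k) t = w (Suc k) t"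
      unfolding w_Suc by (simp only: matrix_vector_mul_assoc idem[OF min01[OF t]])
    ultimately show ?case by blast
  qed
  define v where "v t = complex_of_real (1 / norm (w M t)) *s w M t" for t
  \<comment> \<open>The last step lands at min t 1 = t, so \<open>w M t\<close> is in the range of
    \<open>p t\<close>.\<close>
  have wM: "w M t \<noteq> 0" "p t *v w M t = w M t" if "t \<in> {0..1}" for t
    using w[OF that, of M] that by (simp_all add: M_def min_def)
  show ?thesis
  proof (rule that[of v])
    show "continuous_on {0..1} v"
      unfolding v_def vector_scalar_mult_def
      by (intro continuous_intros cont_w) (use wM in auto)
    fix t :: real assume t: "t \<in> {0..1}"
    have "norm (v t) = 1"
      unfolding v_def norm_cvec_scale using wM(1)[OF t] by (simp add: norm_divide)
    then show one: "cinner (v t) (v t) = 1"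
      by (simp add: cinner_self)
    have pv: "p t *v v t = v t"
      unfolding v_def by (simp only: vector_scalar_commute wM(2)[OF t])
    \<comment> \<open>Rank one enters here: compressing v v^* by \<open>p t\<close> leaves it
      unchanged, so it is a multiple of \<open>p t\<close>, and evaluating at v shows the factor to
      be 1.\<close>
    obtain c where c: "p t ** outer (v t) (v t) ** p t = matscale c (p t)"
      using rank[OF t] by blast
    have outer: "outer (v t) (v t) = matscale c (p t)"
      using c by (simp add: mult_outer outer_mult star[OF t] pv)
    have "outer (v t) (v t) *v v t = matscale c (p t) *v v t"
      by (simp only: outer)
    then have "v t = c *s v t"
      by (simp add: outer_mult_vec one matscale_mult_vec pv)
    then have "cinner (v t) (v t) = c * cinner (v t) (v t)"
      by (metis cinner_simps(3))
    then have "c = 1" using one by simp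
    then show "p t = outer (v t) (v t)" using outer by simp
  qed
qed

text \<open>The normal form of a Cartan subalgebra. Column i of \<open>U 1\<close> is column
  \<sigma> i of \<open>U 0\<close> up to the phase \<open>d i\<close>: \<sigma> is the monodromy of
  the lines spanned by the columns, while \<open>d\<close> depends on the vectors chosen in
  them.\<close>

definition cartan_data ::
  "(real \<Rightarrow> complex^'n^'n) \<Rightarrow> ('n \<Rightarrow> 'n) \<Rightarrow> ('n \<Rightarrow> complex) \<Rightarrow> 'n::finite circle_matrix_algebra set \<Rightarrow> bool" where
  "cartan_data U \<sigma> d B \<longleftrightarrow>
     continuous_on {0..1} U \<and> (\<forall>t\<in>{0..1}. unitary_mat (U t)) \<and>
     bij \<sigma> \<and> (\<forall>i. cmod (d i) = 1) \<and> U 1 = U 0 ** monomial_mat \<sigma> d \<and>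
     B = {f. \<forall>t\<in>{0..1}. diagonal_mat (conj_transpose (U t) ** circle_fun f (circle_pt t) ** U t)}"

section \<open>The covering space of minimal projections\<close>

context masa_with_expectation
begin

definition minp_space :: "(complex \<times> (complex^'n^'n)) set" where
  "minp_space = {(z, q). z \<in> sphere 0 1 \<and> q \<in> minp z}"

text \<open>Over a small arc around \<open>z0\<close> there is one sheet near each minimal
  projection p over \<open>z0\<close>. Upper semicontinuity puts every minimal projection on a
  sheet, lower semicontinuity makes each sheet reach every fiber, and the uniform gap keeps the
  sheets apart and single valued.\<close>

lemma covering_space_minp: "covering_space minp_space fst (sphere 0 1)"
proof (rule covering_spaceI)
  show "continuous_on minp_space fst" by (intro continuous_intros)
  have "\<exists>q. q \<in> minp z" if z: "z \<in> sphere 0 1" for z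
  proof (rule ccontr)
    assume "\<nexists>q. q \<in> minp z"
    obtain Q :: "'n \<Rightarrow> complex^'n^'n" where "\<And>i. Q i = 0 \<or> Q i \<in> minp z" "(\<Sum>i\<in>UNIV. Q i) = mat 1"
      using exists_minimal_projection_frame[OF z] by metis
    then have "mat 1 = (0 :: complex^'n^'n)"
      using \<open>\<nexists>q. q \<in> minp z\<close> by simp
    then have "(mat 1 :: complex^'n^'n) $ undefined $ undefined = 0" by simp
    then show False by (simp add: mat_def)
  qed
  then show "fst ` minp_space = sphere 0 1"
    by (force simp: minp_space_def)
next
  fix z0 :: complex assume z0: "z0 \<in> sphere 0 1"
  \<comment> \<open>The gap from \<open>minp_dist\<close>. With radius \<kappa>/4, two points near
    the same p are closer than \<kappa>, even if one of them carries a second error of \<kappa>/4,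
    as happens in the continuity argument.\<close>
  define \<kappa> where "\<kappa> = 1 / (real CARD('n))\<^sup>2"
  have \<kappa>: "\<kappa> > 0" by (simp add: \<kappa>_def)
  have same: "p = q" if "p \<in> minp z" "q \<in> minp z" "dist p q < \<kappa>" for p q z
    using minp_dist[OF that(1,2)] that(3) unfolding \<kappa>_def by force
  obtain d1 where d1: "d1 > 0" "\<And>z q. z \<in> sphere 0 1 \<Longrightarrow> dist z z0 < d1 \<Longrightarrow> q \<in> minp z \<Longrightarrow> \<exists>p\<in>minp z0. dist q p < \<kappa> / 4"
    using minp_upper_semicontinuous[OF z0, of "\<kappa> / 4"] \<kappa> by auto
  obtain d2 where d2: "d2 > 0" "\<And>z p. z \<in> sphere 0 1 \<Longrightarrow> dist z z0 < d2 \<Longrightarrow> p \<in> minp z0 \<Longrightarrow> \<exists>q\<in>minp z. dist q p < \<kappa> / 4"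
    using minp_lower_semicontinuous[OF z0, of "\<kappa> / 4"] \<kappa> by auto
  define T where "T = sphere 0 1 \<inter> ball z0 (min d1 d2)"
  define u where "u p = minp_space \<inter> ball z0 (min d1 d2) \<times> ball p (\<kappa> / 4)" for p :: "complex^'n^'n"
  have "z0 \<in> T" using z0 d1 d2 by (simp add: T_def)
  moreover have "openin (top_of_set (sphere 0 1)) T"
    unfolding T_def by (rule openin_open_Int) simp
  moreover have "\<Union>(u ` minp z0) = minp_space \<inter> fst -` T"
  proof
    show "\<Union>(u ` minp z0) \<subseteq> minp_space \<inter> fst -` T"
      by (auto simp: u_def T_def minp_space_def)
    show "minp_space \<inter> fst -` T \<subseteq> \<Union>(u ` minp z0)"
    proof
      fix x assume x: "x \<in> minp_space \<inter> fst -` T"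
      then obtain p where "p \<in> minp z0" "dist (snd x) p < \<kappa> / 4"
        using d1(2)[of "fst x" "snd x"] by (auto simp: minp_space_def T_def dist_commute)
      then show "x \<in> \<Union>(u ` minp z0)"
        using x by (auto simp: u_def T_def dist_commute mem_Times_iff)
    qed
  qed
  moreover have "\<forall>w\<in>u ` minp z0. openin (top_of_set minp_space) w"
    unfolding u_def by (auto intro!: openin_open_Int open_Times)
  moreover have "pairwise disjnt (u ` minp z0)"
  proof -
    have "u p = u p'" if p: "p \<in> minp z0" "p' \<in> minp z0" and "x \<in> u p" "x \<in> u p'" for p p' x
    proof -
      have "dist p (snd x) < \<kappa> / 4" "dist p' (snd x) < \<kappa> / 4"
        using that by (auto simp: u_def)
      then have "dist p p' < \<kappa>"
        using dist_triangle2[of p p' "snd x"] \<kappa> by linarith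
      then show ?thesis using same[OF p] by simp
    qed
    then show ?thesis
      unfolding pairwise_def disjnt_def by blast
  qed
  moreover have "\<exists>g. homeomorphism (u p) T fst g" if p: "p \<in> minp z0" for p
  proof -
    have "\<exists>q\<in>minp z. dist q p < \<kappa> / 4" if "z \<in> T" for z
      using d2(2)[OF _ _ p, of z] that by (auto simp: T_def dist_commute)
    then obtain g where g: "\<And>z. z \<in> T \<Longrightarrow> g z \<in> minp z" "\<And>z. z \<in> T \<Longrightarrow> dist (g z) p < \<kappa> / 4"
      by metis
    have unique: "q = g z" if "z \<in> T" "q \<in> minp z" "dist q p < \<kappa> / 4 + \<kappa> / 4" for q z
    proof (rule same[of _ z])
      show "dist q (g z) < \<kappa>"
        using dist_triangle2[of q "g z" p] that g(2)[OF that(1)] \<kappa> by linarith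
    qed (use that g in auto)
    \<comment> \<open>Upper semicontinuity at \<open>z1\<close> gives some minimal projection over
      \<open>z1\<close> close to \<open>g z\<close>; it is still within \<kappa>/2 of p, so
      uniqueness identifies it with \<open>g z1\<close>.\<close>
    have "continuous_on T g"
      unfolding continuous_on_iff
    proof (intro ballI allI impI)
      fix z1 and e :: real assume z1: "z1 \<in> T" and "e > 0"
      then have "z1 \<in> sphere 0 1" "min e (\<kappa> / 4) > 0"
        using \<kappa> by (auto simp: T_def)
      from minp_upper_semicontinuous[OF this] obtain d where d: "d > 0"
        "\<And>z q. z \<in> sphere 0 1 \<Longrightarrow> dist z z1 < d \<Longrightarrow> q \<in> minp z \<Longrightarrow> \<exists>p\<in>minp z1. dist q p < min e (\<kappa> / 4)"
        by blast
      have "dist (g z) (g z1) < e" if z: "z \<in> T" "dist z z1 < d" for z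
      proof -
        obtain p' where p': "p' \<in> minp z1" "dist (g z) p' < min e (\<kappa> / 4)"
          using d(2)[OF _ z(2) g(1)[OF z(1)]] z(1) by (auto simp: T_def)
        have "dist p' p \<le> dist (g z) p' + dist (g z) p"
          by (rule dist_triangle3)
        then have "p' = g z1"
          using p' g(2)[OF z(1)] by (intro unique z1) auto
        then show ?thesis using p'(2) by simp
      qed
      then show "\<exists>d>0. \<forall>x'\<in>T. dist x' z1 < d \<longrightarrow> dist (g x') (g z1) < e"
        using d(1) by blast
    qed
    then have "continuous_on T (\<lambda>z. (z, g z))"
      by (intro continuous_intros)
    moreover have "(\<lambda>z. (z, g z)) ` T = u p"
    proof
      show "(\<lambda>z. (z, g z)) ` T \<subseteq> u p"
        using g by (auto simp: u_def minp_space_def T_def dist_commute)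
      show "u p \<subseteq> (\<lambda>z. (z, g z)) ` T"
      proof
        fix x assume x: "x \<in> u p"
        obtain z q where zq: "x = (z, q)" by fastforce
        have z: "z \<in> T" and q: "q \<in> minp z" "dist p q < \<kappa> / 4"
          using x unfolding zq u_def minp_space_def T_def by auto
        have "dist q p < \<kappa> / 4 + \<kappa> / 4"
          using q(2) \<kappa> unfolding dist_commute[of q p] by linarith
        then have "q = g z"
          by (rule unique[OF z q(1)])
        then show "x \<in> (\<lambda>z. (z, g z)) ` T"
          using z zq by blast
      qed
    qed
    ultimately have "homeomorphism (u p) T fst (\<lambda>z. (z, g z))"
      unfolding homeomorphism_def by (force intro: continuous_intros)
    then show ?thesis by (rule exI[where x = "\<lambda>z. (z, g z)"])
  qed
  ultimately show "\<exists>T. z0 \<in> T \<and> openin (top_of_set (sphere 0 1)) T \<and>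
          (\<exists>v. \<Union>v = minp_space \<inter> fst -` T \<and> (\<forall>w\<in>v. openin (top_of_set minp_space) w) \<and>
               pairwise disjnt v \<and> (\<forall>w\<in>v. \<exists>g. homeomorphism w T fst g))"
    by (intro exI[of _ T] conjI exI[of _ "u ` minp z0"]) auto
qed

lemma minp_path_lift:
  assumes "q \<in> minp 1"
  obtains p where "continuous_on {0..1} p" "p 0 = q" "\<And>t. t \<in> {0..1} \<Longrightarrow> p t \<in> minp (circle_pt t)"
proof -
  have "(1, q) \<in> minp_space" "path circle_pt" "path_image circle_pt \<subseteq> sphere 0 1" "pathstart circle_pt = fst (1, q)"
    using assms by (auto simp: minp_space_def path_def path_image_def pathstart_def continuous_circle_pt)
  from covering_space_lift_path_strong[OF covering_space_minp this]
  obtain h where h: "path h" "path_image h \<subseteq> minp_space" "pathstart h = (1, q)"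
    "\<And>t. t \<in> {0..1} \<Longrightarrow> fst (h t) = circle_pt t" by blast
  show ?thesis
  proof (rule that[of "snd \<circ> h"])
    show "continuous_on {0..1} (snd \<circ> h)"
      using h(1) unfolding path_def comp_def by (intro continuous_intros)
    show "(snd \<circ> h) 0 = q" using h(3) by (simp add: pathstart_def)
    fix t :: real assume t: "t \<in> {0..1}"
    then have "h t \<in> minp_space" using h(2) by (auto simp: path_image_def)
    then show "(snd \<circ> h) t \<in> minp (circle_pt t)"
      using h(4)[OF t] by (auto simp: minp_space_def)
  qed
qed

text \<open>Lifts of a path to a covering that agree at one parameter agree everywhere.\<close>

lemma minp_paths_distinct:
  assumes "continuous_on {0..1} p" "\<And>t. t \<in> {0..1} \<Longrightarrow> p t \<in> minp (circle_pt t)"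
    and "continuous_on {0..1} q" "\<And>t. t \<in> {0..1} \<Longrightarrow> q t \<in> minp (circle_pt t)"
    and "p 0 \<noteq> q 0" "t \<in> {0..1}"
  shows "p t \<noteq> q t"
proof
  assume eq: "p t = q t"
  have "(circle_pt 0, p 0) = (circle_pt 0, q 0)"
  proof (rule covering_space_lift_unique[OF covering_space_minp,
        of "\<lambda>t. (circle_pt t, p t)" t "\<lambda>t. (circle_pt t, q t)" "{0..1}" circle_pt 0])
  qed (use assms eq in \<open>auto simp: minp_space_def intro!: continuous_intros\<close>)
  then show False using assms(5) by simp
qed

text \<open>The compression p x p commutes with \<open>B\<close> pointwise, but p need not close up
  to a function on the circle. The factor t (1 - t) vanishes at the seam, so the product is an
  element of the algebra and, by maximality, of \<open>B\<close>; minimality of p then makes p x p a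
  multiple of p for 0 < t < 1.\<close>

lemma minp_path_rank_one:
  assumes cont: "continuous_on {0..1} p" and p: "\<And>t. t \<in> {0..1} \<Longrightarrow> p t \<in> minp (circle_pt t)"
    and t: "t \<in> {0..1}"
  shows "\<exists>c. p t ** x ** p t = matscale c (p t)"
proof -
  define f where "f t = matscale (complex_of_real (t * (1 - t))) (p t ** x ** p t)" for t
  have "continuous_on {0..1} f" "f 0 = f 1"
    unfolding f_def by (auto intro!: continuous_on_matscale_fun continuous_on_matrix_mult continuous_intros cont)
  from exists_circle_fun_path[OF this] obtain a where
    a: "\<And>t. t \<in> {0..1} \<Longrightarrow> circle_fun a (circle_pt t) = f t" by blast
  have "a \<in> B"
  proof (rule maximal_abelian_commutant[OF max], rule circle_ext_path)
    fix b and s :: real assume b: "b \<in> B" and s: "s \<in> {0..1}"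
    have bf: "circle_fun b (circle_pt s) \<in> fiber B (circle_pt s)"
      using b by (auto simp: fiber_def)
    obtain c where c: "circle_fun b (circle_pt s) ** p s = matscale c (p s)"
      using minimal_projectionsD(5)[OF p[OF s] bf] by blast
    have c': "p s ** circle_fun b (circle_pt s) = matscale c (p s)"
      using c fiber_commute[OF bf minimal_projectionsD(1)[OF p[OF s]]] by simp
    have "circle_fun b (circle_pt s) ** (p s ** x ** p s) = matscale c (p s ** x ** p s)"
      by (simp add: matrix_mul_assoc c matscale_mult_left)
    moreover have "(p s ** x ** p s) ** circle_fun b (circle_pt s) = matscale c (p s ** x ** p s)"
      by (simp add: matrix_mul_assoc[symmetric] c' matscale_mult_right)
    ultimately show "circle_fun (a * b) (circle_pt s) = circle_fun (b * a) (circle_pt s)"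
      by (simp add: circle_fun_mult a[OF s] f_def matscale_mult_left matscale_mult_right)
  qed
  have inner: "matscale (trace (p s)) (p s ** x ** p s) = matscale (trace (p s ** x ** p s)) (p s)"
    if s: "s \<in> {0<..<1}" for s
  proof -
    have s': "s \<in> {0..1}" using s by auto
    have "f s \<in> fiber B (circle_pt s)"
      using \<open>a \<in> B\<close> a[OF s'] by (auto simp: fiber_def intro: image_eqI[of _ _ a])
    then obtain c where "f s ** p s = matscale c (p s)"
      using minimal_projectionsD(5)[OF p[OF s']] by blast
    moreover have "(p s ** x ** p s) ** p s = p s ** x ** p s"
      using minimal_projectionsD(4)[OF p[OF s']] by (simp add: matrix_mul_assoc[symmetric])
    ultimately have "matscale (complex_of_real (s * (1 - s))) (p s ** x ** p s) = matscale c (p s)"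
      by (simp add: f_def matscale_mult_left)
    then have "matscale (inverse (complex_of_real (s * (1 - s)))) (matscale (complex_of_real (s * (1 - s))) (p s ** x ** p s)) =
       matscale (inverse (complex_of_real (s * (1 - s)))) (matscale c (p s))"
      by simp
    moreover have "complex_of_real (s * (1 - s)) \<noteq> 0"
      using s by (auto simp only: of_real_eq_0_iff) auto
    ultimately have "p s ** x ** p s = matscale (inverse (complex_of_real (s * (1 - s))) * c) (p s)"
      by (simp add: matscale_matscale del: of_real_mult)
    then show ?thesis
      by (simp add: trace_matscale matscale_matscale mult.commute)
  qed
  \<comment> \<open>The endpoints are reached by continuity; the identity with traces is used
    because it contains no unknown scalar.\<close>
  define g where "g s = matscale (trace (p s)) (p s ** x ** p s) - matscale (trace (p s ** x ** p s)) (p s)" for s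
  have "continuous_on {0..1} g"
    unfolding g_def
    by (intro continuous_on_matscale_fun continuous_on_matrix_mult continuous_on_trace continuous_intros cont)
  then have "g t = 0"
    using continuous_constant_on_closure[of "{0<..<1}" g 0 t] inner t by (simp add: g_def)
  then have "matscale (trace (p t)) (p t ** x ** p t) = matscale (trace (p t ** x ** p t)) (p t)"
    by (simp add: g_def)
  then have "matscale (1 / trace (p t)) (matscale (trace (p t)) (p t ** x ** p t)) =
      matscale (1 / trace (p t)) (matscale (trace (p t ** x ** p t)) (p t))"
    by simp
  moreover have "trace (p t) \<noteq> 0"
    using minimal_projectionsD[OF p[OF t]] by (intro trace_projection_neq_0)
  ultimately show ?thesis by (auto simp: matscale_matscale)
qed

text \<open>Each minimal projection over 1 is followed around the circle and given a continuous unit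
  vector; these vectors are the columns of \<open>U\<close>.\<close>

lemma exists_cartan_data: "\<exists>U \<sigma> d. cartan_data U \<sigma> d B"
proof -
  have one: "(1::complex) \<in> sphere 0 1" by simp
  obtain Q :: "'n \<Rightarrow> complex^'n^'n" where Q: "\<And>i. Q i = 0 \<or> Q i \<in> minp 1" "(\<Sum>i\<in>UNIV. Q i) = mat 1"
    and Q_inj: "\<And>i j. i \<noteq> j \<Longrightarrow> Q i \<noteq> 0 \<Longrightarrow> Q i \<noteq> Q j"
    using exists_minimal_projection_frame[OF one] by metis
  have "\<exists>p v. continuous_on {0..1} p \<and> p 0 = Q i \<and> (\<forall>t\<in>{0..1}. p t \<in> minp (circle_pt t)) \<and>
      continuous_on {0..1} v \<and> (\<forall>t\<in>{0..1}. cinner (v t) (v t) = 1 \<and> p t = outer (v t) (v t))"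
    if i: "Q i \<noteq> 0" for i
  proof -
    have "Q i \<in> minp 1" using Q(1) i by blast
    then obtain p where p: "continuous_on {0..1} p" "p 0 = Q i" "\<And>t. t \<in> {0..1} \<Longrightarrow> p t \<in> minp (circle_pt t)"
      by (rule minp_path_lift) blast
    have "p 0 \<noteq> 0" using p i by simp
    obtain v where "continuous_on {0..1} v"
      "\<And>t. t \<in> {0..1} \<Longrightarrow> cinner (v t) (v t) = 1" "\<And>t. t \<in> {0..1} \<Longrightarrow> p t = outer (v t) (v t)"
      by (rule rank_one_projection_path_section[OF p(1) minimal_projectionsD(3)[OF p(3)]
            minimal_projectionsD(4)[OF p(3)] \<open>p 0 \<noteq> 0\<close> minp_path_rank_one[OF p(1) p(3)]]) blast+
    with p show ?thesis by blast
  qed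
  then obtain p v where pv: "\<And>i. Q i \<noteq> 0 \<Longrightarrow> continuous_on {0..1} (p i) \<and> p i 0 = Q i \<and>
      (\<forall>t\<in>{0..1}. p i t \<in> minp (circle_pt t)) \<and> continuous_on {0..1} (v i) \<and>
      (\<forall>t\<in>{0..1}. cinner (v i t) (v i t) = 1 \<and> p i t = outer (v i t) (v i t))"
    by metis
  then have p: "\<And>i. Q i \<noteq> 0 \<Longrightarrow> continuous_on {0..1} (p i)" "\<And>i. Q i \<noteq> 0 \<Longrightarrow> p i 0 = Q i"
      "\<And>i t. Q i \<noteq> 0 \<Longrightarrow> t \<in> {0..1} \<Longrightarrow> p i t \<in> minp (circle_pt t)"
    and v: "\<And>i. Q i \<noteq> 0 \<Longrightarrow> continuous_on {0..1} (v i)"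
      "\<And>i t. Q i \<noteq> 0 \<Longrightarrow> t \<in> {0..1} \<Longrightarrow> cinner (v i t) (v i t) = 1"
      "\<And>i t. Q i \<noteq> 0 \<Longrightarrow> t \<in> {0..1} \<Longrightarrow> p i t = outer (v i t) (v i t)"
    by blast+
  \<comment> \<open>Every nonzero \<open>Q j\<close> now has rank one, hence trace 1. The traces add
    up to n, so there is no room for padding zeros.\<close>
  have nz: "Q i \<noteq> 0" for i
  proof
    assume "Q i = 0"
    have tr: "trace (Q j) = (if Q j = 0 then 0 else 1)" for j
    proof (cases "Q j = 0")
      case False
      have "Q j = outer (v j 0) (v j 0)"
        using p(2)[OF False] v(3)[OF False, of 0] by simp
      then have "trace (Q j) = trace (outer (v j 0) (v j 0))"
        by (rule arg_cong)
      then show ?thesis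
        using False v(2)[OF False, of 0] by (simp add: trace_outer)
    qed (simp add: trace_def)
    have "of_nat CARD('n) = trace (\<Sum>j\<in>UNIV. Q j)"
      unfolding Q(2) by (simp add: trace_I)
    also have "\<dots> = (\<Sum>j\<in>UNIV. trace (Q j))"
      unfolding trace_def by (simp add: sum_component) (rule sum.swap)
    also have "\<dots> = of_nat (card {j. Q j \<noteq> 0})"
      unfolding tr by (simp add: sum.If_cases Collect_neg_eq[symmetric])
    finally have "CARD('n) = card {j. Q j \<noteq> 0}" by (simp only: of_nat_eq_iff)
    moreover have "card {j. Q j \<noteq> 0} < CARD('n)"
      using \<open>Q i = 0\<close> by (intro psubset_card_mono) auto
    ultimately show False by simp
  qed
  note p = p[OF nz] and v = v[OF nz]
  have distinct: "p i t \<noteq> p j t" if "i \<noteq> j" "t \<in> {0..1}" for i j t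
    by (rule minp_paths_distinct[OF p(1,3) p(1,3)]) (use that Q_inj nz p(2) in auto)
  have pv: "p i t *v v i t = v i t" if "t \<in> {0..1}" for i t
    using v(2,3)[OF that] by (simp add: outer_mult_vec)
  have ortho: "cinner (v i t) (v j t) = (if i = j then 1 else 0)" if t: "t \<in> {0..1}" for i j t
  proof (cases "i = j")
    case False
    then have "p i t ** p j t = 0"
      using minp_orthogonal[OF p(3) p(3)] distinct t by blast
    then have "p i t *v v j t = 0"
      using pv[OF t, of j] by (metis matrix_vector_mul_assoc matrix_vector_mult_0)
    then have "cinner (v i t) (v j t) *s v i t = 0"
      using v(3)[OF t] by (simp add: outer_mult_vec)
    then have "cinner (v i t) (cinner (v i t) (v j t) *s v i t) = 0"
      by (simp only: cinner_simps)
    then show ?thesis using False v(2)[OF t] by (simp add: cinner_simps)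
  qed (use v(2) t in simp)
  define U where "U t = (\<chi> k i. v i t $ k)" for t
  have col: "column i (U t) = v i t" for i t
    by (simp add: U_def column_def vec_eq_iff)
  have cont: "continuous_on {0..1} U"
    unfolding U_def by (intro continuous_intros v(1))
  have unitary: "unitary_mat (U t)" if t: "t \<in> {0..1}" for t
  proof -
    have "(conj_transpose (U t) ** mat 1 ** U t) $ i $ j = mat 1 $ i $ j" for i j
      unfolding conj_transpose_sandwich_entry col by (simp add: ortho[OF t]) (simp add: mat_def)
    then show ?thesis by (simp add: unitary_mat_def vec_eq_iff)
  qed
  \<comment> \<open>A minimal projection over 1 different from all \<open>Q j\<close> would be
    orthogonal to all of them, hence to their sum 1.\<close>
  have "\<exists>j. p i 1 = Q j" for i
  proof (rule ccontr)
    assume neg: "\<nexists>j. p i 1 = Q j"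
    have "p i 1 \<in> minp 1" using p(3)[of 1 i] by simp
    then have "p i 1 ** Q j = 0" for j
      using minp_orthogonal[of "p i 1" 1 "Q j"] neg Q(1)[of j] nz[of j] by metis
    then have "p i 1 ** (\<Sum>j\<in>UNIV. Q j) = 0"
      by (simp add: matrix_mult_sum_right)
    then show False
      using minimal_projectionsD(2)[OF \<open>p i 1 \<in> minp 1\<close>] by (simp add: Q(2))
  qed
  then obtain \<sigma> where \<sigma>: "\<And>i. p i 1 = Q (\<sigma> i)" by metis
  have "inj \<sigma>"
    by (rule injI) (metis \<sigma> distinct atLeastAtMost_iff order_refl zero_le_one)
  then have bij: "bij \<sigma>" by (simp add: bij_def finite_UNIV_inj_surj)
  \<comment> \<open>Both vectors span the range of \<open>Q (\<sigma> i)\<close>, so they differ by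
    a phase, given by their inner product.\<close>
  define d where "d i = cinner (v (\<sigma> i) 0) (v i 1)" for i
  have v1: "v i 1 = d i *s v (\<sigma> i) 0" for i
  proof -
    have "v i 1 = Q (\<sigma> i) *v v i 1"
      using pv[of 1 i] \<sigma>[of i] by simp
    also have "Q (\<sigma> i) = outer (v (\<sigma> i) 0) (v (\<sigma> i) 0)"
      using p(2)[of "\<sigma> i"] v(3)[of 0 "\<sigma> i"] by simp
    finally show ?thesis by (simp add: outer_mult_vec d_def)
  qed
  have d1: "cmod (d i) = 1" for i
  proof -
    have "norm (v i t) = 1" if "t \<in> {0..1}" for i t
      using v(2)[OF that, of i] unfolding cinner_self by (simp add: abs_square_eq_1 power2_eq_1_iff flip: of_real_power)
    then show ?thesis
      using arg_cong[OF v1[of i], of norm] by (simp add: norm_cvec_scale)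
  qed
  have U1: "U 1 = U 0 ** monomial_mat \<sigma> d"
    by (simp add: U_def monomial_mat_def matrix_matrix_mult_def vec_eq_iff v1 mult.commute
        if_distrib[of "(*) _"] cong: if_cong)
  have "B = {f. \<forall>t\<in>{0..1}. diagonal_mat (conj_transpose (U t) ** circle_fun f (circle_pt t) ** U t)}" (is "B = ?D")
  proof
    have diag: "diagonal_mat (conj_transpose (U t) ** circle_fun b (circle_pt t) ** U t)"
      if b: "b \<in> B" and t: "t \<in> {0..1}" for b t
      unfolding diagonal_mat_def conj_transpose_sandwich_entry col
    proof (intro allI impI)
      fix i j :: 'n assume "i \<noteq> j"
      have "circle_fun b (circle_pt t) \<in> fiber B (circle_pt t)"
        using b by (auto simp: fiber_def)
      then obtain c where "circle_fun b (circle_pt t) ** p j t = matscale c (p j t)"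
        using minimal_projectionsD(5)[OF p(3)[OF t]] by blast
      then have "circle_fun b (circle_pt t) *v (p j t *v v j t) = c *s (p j t *v v j t)"
        by (simp add: matrix_vector_mul_assoc matscale_mult_vec)
      then show "cinner (v i t) (circle_fun b (circle_pt t) *v v j t) = 0"
        using \<open>i \<noteq> j\<close> by (simp add: pv[OF t] cinner_simps ortho[OF t])
    qed
    then show "B \<subseteq> ?D" by blast
    \<comment> \<open>A function diagonal in the frame commutes with \<open>B\<close>, which is
      diagonal too; maximality does the rest.\<close>
    show "?D \<subseteq> B"
    proof
      fix f assume f: "f \<in> ?D"
      show "f \<in> B"
      proof (rule maximal_abelian_commutant[OF max], rule circle_ext_path)
        fix b and t :: real assume b: "b \<in> B" and t: "t \<in> {0..1}"
        let ?f = "circle_fun f (circle_pt t)" and ?b = "circle_fun b (circle_pt t)"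
        have comm: "X ** Y = Y ** X" if "diagonal_mat X" "diagonal_mat Y" for X Y :: "complex^'n^'n"
          by (subst (1 2) diagonal_mat_eq[OF that(1)], subst (1 2) diagonal_mat_eq[OF that(2)])
             (simp add: monomial_mat_mult mult.commute)
        have un: "unitary_mat (U t)" by (rule unitary[OF t])
        have eq: "U t ** ((conj_transpose (U t) ** x ** U t) ** (conj_transpose (U t) ** y ** U t)) ** conj_transpose (U t) = x ** y" for x y
          by (simp add: matrix_mul_assoc[symmetric] unitary_cancel_left'[OF un] unitary_mat_right[OF un])
        show "circle_fun (f * b) (circle_pt t) = circle_fun (b * f) (circle_pt t)"
          using eq[of ?f ?b] eq[of ?b ?f] comm[of "conj_transpose (U t) ** ?f ** U t" "conj_transpose (U t) ** ?b ** U t"]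
            f t diag[OF b t] by (simp add: circle_fun_mult)
      qed
    qed
  qed
  then have "cartan_data U \<sigma> d B"
    unfolding cartan_data_def using cont unitary bij d1 U1 by blast
  then show ?thesis by blast
qed

end

section \<open>Conjugation by unitary and monomial matrices\<close>

definition conjugate_mat :: "complex^'n^'n \<Rightarrow> complex^'n^'n \<Rightarrow> complex^'n^'n" where
  "conjugate_mat V A = V ** A ** conj_transpose V"

lemma conjugate_mat_comp: "conjugate_mat V (conjugate_mat W A) = conjugate_mat (V ** W) A"
  by (simp add: conjugate_mat_def conj_transpose_mult matrix_mul_assoc)

lemma conjugate_mat_add: "conjugate_mat V (A + B) = conjugate_mat V A + conjugate_mat V B"
  by (simp add: conjugate_mat_def matrix_add_ldistrib matrix_mult_add_left)

lemma conjugate_mat_matscale: "conjugate_mat V (matscale c A) = matscale c (conjugate_mat V A)"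
  by (simp add: conjugate_mat_def matscale_mult_left matscale_mult_right)

lemma conjugate_mat_0 [simp]: "conjugate_mat V 0 = 0"
  by (simp add: conjugate_mat_def)

lemma conj_transpose_conjugate_mat:
  "conj_transpose (conjugate_mat V A) = conjugate_mat V (conj_transpose A)"
  by (simp add: conjugate_mat_def conj_transpose_mult matrix_mul_assoc)

lemma conjugate_mat_mult:
  "unitary_mat V \<Longrightarrow> conjugate_mat V (A ** B) = conjugate_mat V A ** conjugate_mat V B"
  by (simp add: conjugate_mat_def matrix_mul_assoc[symmetric] unitary_cancel_left)

lemma conjugate_mat_1: "unitary_mat V \<Longrightarrow> conjugate_mat V (mat 1) = mat 1"
  by (simp add: conjugate_mat_def unitary_mat_right)

lemma conjugate_mat_inverse:
  assumes "unitary_mat V"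
  shows "conjugate_mat (conj_transpose V) (conjugate_mat V A) = A"
    and "conjugate_mat V (conjugate_mat (conj_transpose V) A) = A"
  by (simp_all add: conjugate_mat_comp unitary_mat_left[OF assms] unitary_mat_right[OF assms])
     (simp_all add: conjugate_mat_def)

lemma trace_conjugate_mat: "unitary_mat V \<Longrightarrow> trace (conjugate_mat V A) = trace A"
  unfolding conjugate_mat_def
  by (subst trace_mul_sym) (simp add: unitary_cancel_left)

lemma continuous_on_conjugate_mat:
  fixes f g :: "'a::topological_space \<Rightarrow> complex^'n^'n"
  assumes "continuous_on S f" "continuous_on S g"
  shows "continuous_on S (\<lambda>z. conjugate_mat (f z) (g z))"
  unfolding conjugate_mat_def
  by (intro continuous_on_matrix_mult continuous_on_conj_transpose assms)

lemma monomial_mat_conjugate_entry: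
  assumes "bij \<pi>"
  shows "conjugate_mat (monomial_mat \<pi> c) A $ \<pi> i $ \<pi> j = c i * A $ i $ j * cnj (c j)"
proof -
  have eq: "\<pi> i = \<pi> k \<longleftrightarrow> k = i" for i k
    using assms by (auto simp: bij_def inj_eq)
  show ?thesis
    by (simp add: conjugate_mat_def matrix_matrix_mult_def monomial_mat_def conj_transpose_def eq
        if_distrib[of cnj] if_distrib[of "\<lambda>x. x * _"] if_distrib[of "(*) _"] cong: if_cong)
qed

lemma monomial_mat_conjugate_entry':
  "conjugate_mat (conj_transpose (monomial_mat \<pi> c)) A $ i $ j = cnj (c i) * A $ \<pi> i $ \<pi> j * c j"
  by (simp add: conjugate_mat_def matrix_matrix_mult_def monomial_mat_def conj_transpose_def
        if_distrib[of cnj] if_distrib[of "\<lambda>x. x * _"] if_distrib[of "(*) _"] cong: if_cong)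

lemma diagonal_conjugate_monomial:
  assumes "bij \<pi>" "diagonal_mat A"
  shows "diagonal_mat (conjugate_mat (monomial_mat \<pi> c) A)"
  unfolding diagonal_mat_def
proof (intro allI impI)
  fix k l :: 'a assume "k \<noteq> l"
  obtain i j where ij: "k = \<pi> i" "l = \<pi> j"
    using assms(1) by (metis bij_pointE)
  then have "i \<noteq> j" using \<open>k \<noteq> l\<close> by blast
  then show "conjugate_mat (monomial_mat \<pi> c) A $ k $ l = 0"
    using assms(2) by (simp add: ij monomial_mat_conjugate_entry[OF assms(1)] diagonal_mat_def)
qed

lemma diagonal_conjugate_monomial':
  assumes "bij \<pi>" "diagonal_mat A"
  shows "diagonal_mat (conjugate_mat (conj_transpose (monomial_mat \<pi> c)) A)"
  using assms by (auto simp: diagonal_mat_def monomial_mat_conjugate_entry' bij_def inj_eq)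

text \<open>The phases cancel, so only the permutation acts on diagonal matrices. Hence
  \<open>d\<close> does not affect which diagonal paths close up.\<close>

lemma conjugate_monomial_diag_mat:
  assumes "bij \<pi>" "\<And>i. cmod (c i) = 1"
  shows "conjugate_mat (monomial_mat \<pi> c) (diag_mat e) = diag_mat (\<lambda>k. e (inv' \<pi> k))"
proof -
  have "c i * cnj (c i) = 1" for i
    using assms(2)[of i] by (simp add: complex_norm_square[symmetric])
  then have c: "c i * e i * cnj (c i) = e i" for i
    by (metis mult.assoc mult.commute mult.right_neutral)
  show ?thesis
    unfolding conjugate_mat_def conj_transpose_monomial_mat[OF assms(1)] monomial_mat_mult
    using assms(1) c by (simp add: bij_is_surj surj_iff comp_def fun_eq_iff)
      (simp add: monomial_mat_def fun_eq_iff vec_eq_iff bij_is_surj surj_f_inv_f c)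
qed

lemma cartan_dataD:
  assumes "cartan_data U \<sigma> d B"
  shows "continuous_on {0..1} U" "\<And>t. t \<in> {0..1} \<Longrightarrow> unitary_mat (U t)" "bij \<sigma>"
    "\<And>i. cmod (d i) = 1" "U 1 = U 0 ** monomial_mat \<sigma> d"
    "\<And>f. f \<in> B \<longleftrightarrow> (\<forall>t\<in>{0..1}. diagonal_mat (conjugate_mat (conj_transpose (U t)) (circle_fun f (circle_pt t))))"
  using assms by (auto simp: cartan_data_def conjugate_mat_def)

section \<open>Equivalence from conjugacy\<close>

lemma cartan_equivalent_if_conjugate:
  fixes B1 B2 :: "'n::finite circle_matrix_algebra set"
  assumes B1: "cartan_data U1 \<sigma>1 d1 B1" and B2: "cartan_data U2 \<sigma>2 d2 B2"
    and \<pi>: "bij \<pi>" "\<pi> \<circ> \<sigma>1 = \<sigma>2 \<circ> \<pi>"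
  shows "\<exists>\<phi>. cstar_automorphism \<phi> \<and> \<phi> ` B1 = B2"
proof -
  note D1 = cartan_dataD[OF B1] and D2 = cartan_dataD[OF B2]
  \<comment> \<open>Dictated by the closing condition N2 V(1) = V(0) N1 for V(t) monomial over \<pi>
    with trivial phases at t = 0, where N1 and N2 are the monomial matrices of the two data.\<close>
  define c where "c i = d1 i / d2 (\<pi> i)" for i
  have norm_c: "cmod (c i) = 1" for i
    by (simp add: c_def norm_divide D1(4) D2(4))
  have cis: "cis (Arg (c i)) = c i" for i
  proof -
    have "c i \<noteq> 0" using norm_c[of i] by force
    then show ?thesis by (simp add: cis_Arg sgn_eq norm_c)
  qed
  define V where "V t = monomial_mat \<pi> (\<lambda>i. cis (t * Arg (c i)))" for t
  have unV: "unitary_mat (V t)" for t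
    unfolding V_def by (rule unitary_monomial_mat[OF \<pi>(1)]) simp
  have d2nz: "d2 i \<noteq> 0" for i using D2(4)[of i] by auto
  have d12: "d2 (\<pi> i) * cis (Arg (c i)) = d1 i" for i
    unfolding cis by (simp add: c_def d2nz)
  have VN: "monomial_mat \<sigma>2 d2 ** V 1 = V 0 ** monomial_mat \<sigma>1 d1"
    using \<pi>(2) by (simp add: V_def monomial_mat_mult d12)
  \<comment> \<open>W carries one frame to the other up to the monomial factor V, and conjugation by
    V or its adjoint preserves diagonality.\<close>
  define W where "W t = U2 t ** V t ** conj_transpose (U1 t)" for t
  have unN1: "unitary_mat (monomial_mat \<sigma>1 d1)"
    using D1(3,4) by (rule unitary_monomial_mat)
  have "W 1 = U2 0 ** (monomial_mat \<sigma>2 d2 ** V 1) ** (conj_transpose (monomial_mat \<sigma>1 d1) ** conj_transpose (U1 0))"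
    by (simp add: W_def D1(5) D2(5) conj_transpose_mult matrix_mul_assoc)
  also have "\<dots> = W 0"
    unfolding VN W_def by (simp add: matrix_mul_assoc[symmetric] unitary_cancel_left'[OF unN1])
  finally have W01: "W 0 = W 1" ..
  have "continuous_on {0..1} W"
    unfolding W_def V_def
    by (intro continuous_on_matrix_mult continuous_on_conj_transpose continuous_on_monomial_mat
        continuous_intros D1(1) D2(1))
  from exists_circle_fun_path[OF this W01]
  obtain w where w: "\<And>t. t \<in> {0..1} \<Longrightarrow> circle_fun w (circle_pt t) = W t" by blast
  have unW: "unitary_mat (W t)" if "t \<in> {0..1}" for t
    unfolding W_def using that by (intro unitary_mat_mult unitary_mat_conj_transpose unV D1(2) D2(2))
  \<comment> \<open>The class \<open>cstar_algebra\<close> provides no unit, so unitarity of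
    \<open>w\<close> takes the form of four cancellation laws.\<close>
  have w1: "star w * (w * x) = x" and w2: "w * (star w * x) = x" for x
    by (rule circle_ext_path;
        simp add: circle_fun_mult circle_fun_star w unitary_cancel_left unitary_cancel_left' unW)+
  have w3: "x * (star w * w) = x" and w4: "x * (w * star w) = x" for x
    by (rule circle_ext_path;
        simp add: circle_fun_mult circle_fun_star w unitary_mat_left unitary_mat_right unW)+
  define \<phi> where "\<phi> x = w * x * star w" for x
  define \<psi> where "\<psi> x = star w * x * w" for x
  have inv: "\<psi> (\<phi> x) = x" "\<phi> (\<psi> x) = x" for x
    unfolding \<phi>_def \<psi>_def by (simp_all add: mult.assoc w1 w2 w3 w4)
  have conj: "circle_fun (\<phi> f) (circle_pt t) = conjugate_mat (W t) (circle_fun f (circle_pt t))"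
    "circle_fun (\<psi> f) (circle_pt t) = conjugate_mat (conj_transpose (W t)) (circle_fun f (circle_pt t))"
    if "t \<in> {0..1}" for f t
    using that by (simp_all add: \<phi>_def \<psi>_def circle_fun_mult circle_fun_star w conjugate_mat_def)
  have W_U2: "conj_transpose (U2 t) ** W t = V t ** conj_transpose (U1 t)"
    and W_U1: "conj_transpose (U1 t) ** conj_transpose (W t) = conj_transpose (V t) ** conj_transpose (U2 t)"
    if "t \<in> {0..1}" for t
    using that D1(2) D2(2)
    by (simp_all add: W_def conj_transpose_mult matrix_mul_assoc[symmetric] unitary_cancel_left)
  have \<phi>_B1: "\<phi> f \<in> B2" if "f \<in> B1" for f
    unfolding D2(6)
  proof
    fix t :: real assume t: "t \<in> {0..1}"
    have "conjugate_mat (conj_transpose (U2 t)) (circle_fun (\<phi> f) (circle_pt t)) =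
        conjugate_mat (V t) (conjugate_mat (conj_transpose (U1 t)) (circle_fun f (circle_pt t)))"
      by (simp add: conj(1)[OF t] conjugate_mat_comp W_U2[OF t])
    then show "diagonal_mat (conjugate_mat (conj_transpose (U2 t)) (circle_fun (\<phi> f) (circle_pt t)))"
      unfolding V_def using that t D1(6) by (auto intro: diagonal_conjugate_monomial[OF \<pi>(1)])
  qed
  have \<psi>_B2: "\<psi> f \<in> B1" if "f \<in> B2" for f
    unfolding D1(6)
  proof
    fix t :: real assume t: "t \<in> {0..1}"
    have "conjugate_mat (conj_transpose (U1 t)) (circle_fun (\<psi> f) (circle_pt t)) =
        conjugate_mat (conj_transpose (V t)) (conjugate_mat (conj_transpose (U2 t)) (circle_fun f (circle_pt t)))"
      by (simp add: conj(2)[OF t] conjugate_mat_comp W_U1[OF t])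
    then show "diagonal_mat (conjugate_mat (conj_transpose (U1 t)) (circle_fun (\<psi> f) (circle_pt t)))"
      unfolding V_def using that t D2(6) by (auto intro: diagonal_conjugate_monomial'[OF \<pi>(1)])
  qed
  have "\<phi> ` B1 = B2"
  proof
    show "\<phi> ` B1 \<subseteq> B2" using \<phi>_B1 by blast
    show "B2 \<subseteq> \<phi> ` B1"
    proof
      fix f assume "f \<in> B2"
      then show "f \<in> \<phi> ` B1"
        using \<psi>_B2 inv(2)[of f] by (intro image_eqI[of f \<phi> "\<psi> f"]) simp_all
    qed
  qed
  moreover have "cstar_automorphism \<phi>"
    unfolding cstar_automorphism_def
  proof (intro conjI allI)
    show "bij \<phi>"
      using inv by (intro o_bij[of \<psi>]) (auto simp: fun_eq_iff)
    show "\<phi> (x * y) = \<phi> x * \<phi> y" for x y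
      by (simp add: \<phi>_def mult.assoc w1)
    show "\<phi> (star x) = star (\<phi> x)" for x
      by (simp add: \<phi>_def star_mult star_star mult.assoc)
  qed (simp_all add: \<phi>_def distrib_left distrib_right mult_scaleC_left mult_scaleC_right)
  ultimately show ?thesis by blast
qed

section \<open>Conjugacy from equivalence\<close>

text \<open>Writing \<open>a\<close> as \<open>tr(a) e\<^sub>0\<^sub>0\<close> plus commutators shows that an automorphism preserves constant traces.\<close>

lemma cstar_automorphism_trace:
  fixes \<phi> :: "'n::finite circle_matrix_algebra \<Rightarrow> 'n circle_matrix_algebra"
  assumes \<phi>: "cstar_automorphism \<phi>"
    and tr: "\<And>z. z \<in> sphere 0 1 \<Longrightarrow> trace (circle_fun a z) = t" and z: "z \<in> sphere 0 1"
  shows "trace (circle_fun (\<phi> a) z) = t"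
proof -
  have add: "\<phi> (x + y) = \<phi> x + \<phi> y" and scale: "\<phi> (c *\<^sub>C x) = c *\<^sub>C \<phi> x"
    and mult: "\<phi> (x * y) = \<phi> x * \<phi> y" and bij: "bij \<phi>" for x y c
    using \<phi> by (auto simp: cstar_automorphism_def)
  have diff: "\<phi> (x - y) = \<phi> x - \<phi> y" for x y
    using add[of "x - y" y] by simp
  have "\<phi> 0 = 0" using add[of 0 0] by simp
  then have sum: "\<phi> (\<Sum>i\<in>I. f i) = (\<Sum>i\<in>I. \<phi> (f i))" for I and f :: "'i \<Rightarrow> _"
    by (induction I rule: infinite_finite_induct) (simp_all add: add)
  define i0 :: 'n where "i0 = undefined"
  define e where "e = const_circle (mat_unit i0 i0)"
  \<comment> \<open>At first only up to the factor tr \<phi>(e). Constancy of t matters: a complex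
    multiple passes through \<phi>, whereas a function on the circle may be moved by it.\<close>
  have main: "trace (circle_fun (\<phi> a) z) = t * trace (circle_fun (\<phi> e) z)"
    if tr: "\<And>z. z \<in> sphere 0 1 \<Longrightarrow> trace (circle_fun a z) = t" for a t
  proof -
    have "\<exists>s :: 'n circle_matrix_algebra. \<forall>z\<in>sphere 0 1. circle_fun s z = matscale (circle_fun a z $ i $ j) (mat_unit i i0)" for i j
      by (intro exists_circle_fun continuous_on_matscale_fun continuous_intros continuous_circle_fun)
    then obtain s :: "'n \<Rightarrow> 'n \<Rightarrow> 'n circle_matrix_algebra"
      where s: "\<And>i j z. z \<in> sphere 0 1 \<Longrightarrow> circle_fun (s i j) z = matscale (circle_fun a z $ i $ j) (mat_unit i i0)"
      by metis
    define r where "r j = const_circle (mat_unit i0 j)" for j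
    have unit_mult: "mat_unit i j ** mat_unit k l = (if j = k then mat_unit i l else 0)" for i j k l :: 'n
    proof -
      have "(\<Sum>m\<in>UNIV. (if p = i \<and> m = j then 1 else 0) * (if m = k \<and> q = l then 1 else 0)) =
        (if j = k \<and> p = i \<and> q = l then 1 else (0::complex))" for p q
        by (subst sum.cong[where h = "\<lambda>m. if m = j then (if j = k \<and> p = i \<and> q = l then 1 else 0) else 0"]) auto
      then show ?thesis
        by (auto simp: mat_unit_def matrix_matrix_mult_def vec_eq_iff)
    qed
    \<comment> \<open>Here s_ij r_j = a_ij e_ij, while r_j s_ij is a_ii e_00 for i = j and 0
      otherwise; so the commutators add up to a - tr(a) e_00.\<close>
    have a: "a = (\<Sum>i\<in>UNIV. \<Sum>j\<in>UNIV. s i j * r j - r j * s i j) + t *\<^sub>C e"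
    proof (rule circle_eqI)
      fix z :: complex assume z: "z \<in> sphere 0 1"
      let ?A = "circle_fun a z"
      have "circle_fun (\<Sum>i\<in>UNIV. \<Sum>j\<in>UNIV. s i j * r j - r j * s i j) z =
        (\<Sum>i\<in>UNIV. \<Sum>j\<in>UNIV. matscale (?A $ i $ j) (mat_unit i j) - (if j = i then matscale (?A $ i $ j) (mat_unit i0 i0) else 0))"
        using z by (simp add: circle_fun_sum circle_rep_eqs' s r_def matscale_mult_left matscale_mult_right
            unit_mult if_distrib[of "matscale _"] cong: if_cong)
      also have "\<dots> = ?A - (\<Sum>i\<in>UNIV. matscale (?A $ i $ i) (mat_unit i0 i0))"
        by (simp add: sum_subtractf sum_mat_units)
      also have "(\<Sum>i\<in>UNIV. matscale (?A $ i $ i) (mat_unit i0 i0)) = matscale t (mat_unit i0 i0)"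
        using tr[OF z] by (simp add: trace_def matscale_def vec_eq_iff sum_component flip: sum_distrib_right)
      finally show "?A = circle_fun ((\<Sum>i\<in>UNIV. \<Sum>j\<in>UNIV. s i j * r j - r j * s i j) + t *\<^sub>C e) z"
        using z by (simp add: circle_fun_add circle_fun_scaleC e_def)
    qed
    have "\<phi> a = (\<Sum>i\<in>UNIV. \<Sum>j\<in>UNIV. \<phi> (s i j) * \<phi> (r j) - \<phi> (r j) * \<phi> (s i j)) + t *\<^sub>C \<phi> e"
      by (subst a) (simp only: add sum diff mult scale)
    moreover have "trace (circle_fun (\<Sum>i\<in>UNIV. \<Sum>j\<in>UNIV. \<phi> (s i j) * \<phi> (r j) - \<phi> (r j) * \<phi> (s i j)) z) = 0"
    proof -
      have trace_sum: "trace (\<Sum>i\<in>I. M i) = (\<Sum>i\<in>I. trace (M i))" for I and M :: "'n \<Rightarrow> complex^'n^'n"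
        unfolding trace_def by (simp add: sum_component) (rule sum.swap)
      have "trace (X ** Y - Y ** X) = 0" for X Y :: "complex^'n^'n"
        by (simp add: trace_sub trace_mul_sym[of X Y])
      then show ?thesis
        by (simp add: circle_fun_sum circle_rep_eqs' trace_sum)
    qed
    ultimately show ?thesis
      by (simp add: circle_fun_add circle_fun_scaleC trace_add trace_matscale)
  qed
  \<comment> \<open>Surjectivity makes \<phi> preserve the unit, and the formula for the unit, n = n
    tr \<phi>(e), fixes the factor as 1.\<close>
  have one: "const_circle (mat 1) * x = x" "x * const_circle (mat 1) = x" for x :: "'n circle_matrix_algebra"
    by (rule circle_eqI; simp add: circle_rep_eqs')+
  obtain y where "\<phi> y = const_circle (mat 1)"
    using bij by (metis bij_pointE)
  then have "\<phi> (const_circle (mat 1)) = const_circle (mat 1)"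
    using mult[of "const_circle (mat 1)" y] by (simp add: one)
  then have "of_nat CARD('n) = of_nat CARD('n) * trace (circle_fun (\<phi> e) z)"
    using main[of "const_circle (mat 1)" "of_nat CARD('n)"] z by (simp add: trace_I)
  then have "trace (circle_fun (\<phi> e) z) = 1" by simp
  then show ?thesis using main[OF tr] by simp
qed

text \<open>The projection onto the frame vectors with index in \<open>S\<close>. For a frame of
  \<open>cartan_data\<close> the two ends of the interval match precisely if \<open>S\<close> is
  \<sigma>-invariant, so only such \<open>S\<close> occur in the circle algebra.\<close>

definition set_projection :: "(real \<Rightarrow> complex^'n^'n) \<Rightarrow> 'n::finite set \<Rightarrow> 'n circle_matrix_algebra \<Rightarrow> bool" where
  "set_projection U S p \<longleftrightarrow>
     (\<forall>t\<in>{0..1}. circle_fun p (circle_pt t) = conjugate_mat (U t) (diag_mat (\<lambda>i. if i \<in> S then 1 else 0)))"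

text \<open>The condition on \<open>X\<close> says that U X U^* takes the same value at both ends,
  since the ends of \<open>U\<close> differ by the monomial matrix.\<close>

lemma exists_circle_fun_in_frame:
  assumes B: "cartan_data U \<sigma> d B"
    and X: "continuous_on {0..1} X" "conjugate_mat (monomial_mat \<sigma> d) (X 1) = X 0"
  shows "\<exists>a. \<forall>t\<in>{0..1}. circle_fun a (circle_pt t) = conjugate_mat (U t) (X t)"
proof (rule exists_circle_fun_path)
  show "continuous_on {0..1} (\<lambda>t. conjugate_mat (U t) (X t))"
    by (intro continuous_on_conjugate_mat X cartan_dataD[OF B])
  show "conjugate_mat (U 0) (X 0) = conjugate_mat (U 1) (X 1)"
    unfolding cartan_dataD(5)[OF B] by (simp add: conjugate_mat_comp[symmetric] X(2))
qed

lemma frame_coordinates_loop: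
  assumes B: "cartan_data U \<sigma> d B"
  shows "conjugate_mat (conj_transpose (U 0)) (circle_fun a 1) =
    conjugate_mat (monomial_mat \<sigma> d) (conjugate_mat (conj_transpose (U 1)) (circle_fun a 1))"
proof -
  have un: "unitary_mat (monomial_mat \<sigma> d)"
    using cartan_dataD(3,4)[OF B] by (rule unitary_monomial_mat)
  show ?thesis
    unfolding cartan_dataD(5)[OF B] conj_transpose_mult
    by (simp add: conjugate_mat_comp[symmetric] conjugate_mat_inverse[OF un])
qed

lemma indicator_comp_inv:
  assumes "bij \<sigma>"
  shows "(\<lambda>k. if inv' \<sigma> k \<in> S then 1 else 0 :: complex) = (\<lambda>k. if k \<in> S then 1 else 0) \<longleftrightarrow> \<sigma> ` S = S"
proof -
  have mem: "k \<in> \<sigma> ` S \<longleftrightarrow> inv' \<sigma> k \<in> S" for k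
    using assms by (metis bij_inv_eq_iff image_iff)
  show ?thesis
    unfolding fun_eq_iff set_eq_iff mem by auto
qed

context
  fixes U \<sigma> d and B :: "'n::finite circle_matrix_algebra set"
  assumes B: "cartan_data U \<sigma> d B"
begin

lemma exists_set_projection:
  assumes "\<sigma> ` S = S"
  shows "\<exists>p. set_projection U S p"
  unfolding set_projection_def
  using conjugate_monomial_diag_mat[OF cartan_dataD(3,4)[OF B]] assms indicator_comp_inv[OF cartan_dataD(3)[OF B]]
  by (intro exists_circle_fun_in_frame[OF B]) simp_all

lemma set_projection_props:
  assumes p: "set_projection U S p"
  shows "p \<in> B" "star p = p" "p * p = p"
    "z \<in> sphere 0 1 \<Longrightarrow> trace (circle_fun p z) = of_nat (card S)"
proof -
  note D = cartan_dataD[OF B]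
  have p: "circle_fun p (circle_pt t) = conjugate_mat (U t) (diag_mat (\<lambda>i. if i \<in> S then 1 else 0))"
    if "t \<in> {0..1}" for t
    using p that by (simp add: set_projection_def)
  show "p \<in> B"
    unfolding D(6) by (simp add: p conjugate_mat_inverse D(2))
  show "star p = p"
    by (rule circle_ext_path)
       (simp add: circle_fun_star p conj_transpose_conjugate_mat conj_transpose_monomial_mat if_distrib[of cnj] cong: if_cong)
  show "p * p = p"
    by (rule circle_ext_path)
       (simp add: circle_fun_mult p conjugate_mat_mult[symmetric] D(2) monomial_mat_mult
         if_distrib[of "(*) _"] if_distrib[of "\<lambda>x. x * _"] cong: if_cong)
  show "trace (circle_fun p z) = of_nat (card S)" if "z \<in> sphere 0 1"
  proof -
    have "trace (circle_fun p (circle_pt t)) = of_nat (card S)" if t: "t \<in> {0..1}" for t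
      by (simp add: p[OF t] trace_conjugate_mat[OF D(2)[OF t]]) (simp add: trace_def monomial_mat_def sum.If_cases)
    from this[OF Arg2pi_in_unit_interval[of z]] show ?thesis
      by (simp add: circle_pt_Arg2pi[OF that])
  qed
qed

text \<open>In the frame p is a diagonal path with entries 0 or 1; continuity makes them constant,
  and the boundary condition makes the set of ones invariant.\<close>

lemma projection_is_set_projection:
  assumes p: "p \<in> B" "star p = p" "p * p = p"
  shows "\<exists>S. \<sigma> ` S = S \<and> set_projection U S p"
proof -
  note D = cartan_dataD[OF B]
  define X where "X t = conjugate_mat (conj_transpose (U t)) (circle_fun p (circle_pt t))" for t
  have X: "X t = diag_mat (\<lambda>i. X t $ i $ i)" if "t \<in> {0..1}" for t
    using p(1) that unfolding D(6) X_def by (intro diagonal_mat_eq) auto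
  have XX: "X t ** X t = X t" if "t \<in> {0..1}" for t
  proof -
    have "circle_fun (p * p) (circle_pt t) = circle_fun p (circle_pt t)" using p(3) by simp
    then show ?thesis
      using that D(2) unfolding X_def
      by (simp add: conjugate_mat_mult[symmetric] unitary_mat_conj_transpose circle_fun_mult)
  qed
  have idem: "X t $ i $ i * X t $ i $ i = X t $ i $ i" if "t \<in> {0..1}" for t i
  proof -
    have "diag_mat (\<lambda>i. X t $ i $ i) ** diag_mat (\<lambda>i. X t $ i $ i) = diag_mat (\<lambda>i. X t $ i $ i)"
      using XX[OF that] X[OF that] by metis
    then show ?thesis
      unfolding monomial_mat_mult by (simp add: fun_eq_iff)
  qed
  have cont: "continuous_on {0..1} (\<lambda>t. X t $ i $ i)" for i
    unfolding X_def
    by (intro continuous_intros continuous_on_conjugate_mat continuous_on_conj_transpose D(1) continuous_circle_fun_path)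
  have const: "X t $ i $ i = X 0 $ i $ i" if t: "t \<in> {0..1}" for t i
  proof -
    have "(\<lambda>t. X t $ i $ i) constant_on {0..1}"
    proof (rule continuous_finite_range_constant[OF _ cont])
      have "X t $ i $ i = 0 \<or> X t $ i $ i = 1" if "t \<in> {0..1}" for t
        using idem[OF that, of i] by simp
      then have "(\<lambda>t. X t $ i $ i) ` {0..1} \<subseteq> {0, 1}"
        by blast
      then show "finite ((\<lambda>t. X t $ i $ i) ` {0..1})"
        by (rule finite_subset) simp
    qed simp
    then show ?thesis
      using t unfolding constant_on_def by (metis atLeastAtMost_iff order_refl zero_le_one)
  qed
  define S where "S = {i. X 0 $ i $ i = 1}"
  have XS: "X t = diag_mat (\<lambda>i. if i \<in> S then 1 else 0)" if t: "t \<in> {0..1}" for t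
  proof -
    have "X t $ i $ i = (if i \<in> S then 1 else 0)" for i
      using const[OF t, of i] idem[of 0 i] by (auto simp: S_def)
    then show ?thesis using X[OF t] by simp
  qed
  have "X 0 = conjugate_mat (monomial_mat \<sigma> d) (X 1)"
    using frame_coordinates_loop[OF B, of p] by (simp add: X_def)
  then have "\<sigma> ` S = S"
    using indicator_comp_inv[OF D(3), of S]
    by (simp add: XS conjugate_monomial_diag_mat[OF D(3,4)])
  moreover have "set_projection U S p"
    unfolding set_projection_def
  proof
    fix t :: real assume t: "t \<in> {0..1}"
    show "circle_fun p (circle_pt t) = conjugate_mat (U t) (diag_mat (\<lambda>i. if i \<in> S then 1 else 0))"
      unfolding XS[OF t, symmetric] X_def conjugate_mat_inverse(2)[OF D(2)[OF t]] ..
  qed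
  ultimately show ?thesis by blast
qed

text \<open>The order on projections expressed by multiplication, so that automorphisms preserve
  it.\<close>

lemma set_projection_le_iff:
  assumes "set_projection U S p" "set_projection U T q"
  shows "p * q = p \<longleftrightarrow> S \<subseteq> T"
proof -
  note D = cartan_dataD[OF B]
  have pq: "circle_fun (p * q) (circle_pt t) = conjugate_mat (U t) (diag_mat (\<lambda>i. if i \<in> S \<and> i \<in> T then 1 else 0))"
    if "t \<in> {0..1}" for t
  proof -
    have "(\<lambda>i. (if i \<in> S then 1 else 0) * (if i \<in> T then 1 else 0)) = (\<lambda>i. if i \<in> S \<and> i \<in> T then 1 else (0::complex))"
      by auto
    then show ?thesis
      using assms that D(2) by (simp add: set_projection_def circle_fun_mult conjugate_mat_mult[symmetric] monomial_mat_mult)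
  qed
  show ?thesis
  proof
    assume eq: "p * q = p"
    have un0: "unitary_mat (U 0)" by (rule D(2)) simp
    have "conjugate_mat (U 0) (diag_mat (\<lambda>i. if i \<in> S \<and> i \<in> T then 1 else 0)) =
      conjugate_mat (U 0) (diag_mat (\<lambda>i. if i \<in> S then 1 else 0))"
      using pq[of 0] bspec[OF assms(1)[unfolded set_projection_def], of 0] by (simp add: eq)
    from arg_cong[OF this, of "conjugate_mat (conj_transpose (U 0))"]
    have "diag_mat (\<lambda>i. if i \<in> S \<and> i \<in> T then 1 else 0) = diag_mat (\<lambda>i. if i \<in> S then 1 else 0)"
      by (simp only: conjugate_mat_inverse(1)[OF un0])
    then show "S \<subseteq> T"
      by (auto simp: fun_eq_iff split: if_splits)
  next
    assume "S \<subseteq> T"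
    then have "(\<lambda>i. if i \<in> S \<and> i \<in> T then 1 else (0::complex)) = (\<lambda>i. if i \<in> S then 1 else 0)"
      by (auto simp: fun_eq_iff)
    then show "p * q = p"
      using assms(1) pq by (intro circle_ext_path) (simp add: set_projection_def)
  qed
qed

lemma set_projection_unique:
  "set_projection U S p \<Longrightarrow> set_projection U S q \<Longrightarrow> p = q"
  by (rule circle_ext_path) (simp add: set_projection_def)

end

lemma conjugate_if_cartan_equivalent:
  fixes B1 B2 :: "'n::finite circle_matrix_algebra set"
  assumes B1: "cartan_data U1 \<sigma>1 d1 B1" and B2: "cartan_data U2 \<sigma>2 d2 B2"
    and \<phi>: "cstar_automorphism \<phi>" "\<phi> ` B1 = B2"
  shows "\<exists>\<pi>. bij \<pi> \<and> \<pi> \<circ> \<sigma>1 = \<sigma>2 \<circ> \<pi>"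
proof -
  have mult: "\<phi> (x * y) = \<phi> x * \<phi> y" and star: "\<phi> (star x) = star (\<phi> x)" and bij: "bij \<phi>" for x y
    using \<phi>(1) by (auto simp: cstar_automorphism_def)
  have inj: "\<phi> x = \<phi> y \<longleftrightarrow> x = y" for x y
    using bij by (simp add: bij_def inj_eq)
  obtain p1 where p1: "\<And>S. \<sigma>1 ` S = S \<Longrightarrow> set_projection U1 S (p1 S)"
    using exists_set_projection[OF B1] by metis
  obtain p2 where p2: "\<And>S. \<sigma>2 ` S = S \<Longrightarrow> set_projection U2 S (p2 S)"
    using exists_set_projection[OF B2] by metis
  have "\<exists>T. \<sigma>2 ` T = T \<and> \<phi> (p1 S) = p2 T" if S: "\<sigma>1 ` S = S" for S
  proof -
    note props = set_projection_props[OF B1 p1[OF S]]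
    have "\<phi> (p1 S) \<in> B2" "star (\<phi> (p1 S)) = \<phi> (p1 S)" "\<phi> (p1 S) * \<phi> (p1 S) = \<phi> (p1 S)"
      using props(1) \<phi>(2) by (auto simp: star[symmetric] mult[symmetric] props(2,3))
    from projection_is_set_projection[OF B2 this] show ?thesis
      using p2 set_projection_unique[OF B2] by blast
  qed
  then obtain \<Phi> where \<Phi>: "\<And>S. \<sigma>1 ` S = S \<Longrightarrow> \<sigma>2 ` \<Phi> S = \<Phi> S" "\<And>S. \<sigma>1 ` S = S \<Longrightarrow> \<phi> (p1 S) = p2 (\<Phi> S)"
    by metis
  have le1: "p1 S * p1 T = p1 S \<longleftrightarrow> S \<subseteq> T" if "\<sigma>1 ` S = S" "\<sigma>1 ` T = T" for S T
    by (rule set_projection_le_iff[OF B1 p1[OF that(1)] p1[OF that(2)]])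
  have le2: "p2 S * p2 T = p2 S \<longleftrightarrow> S \<subseteq> T" if "\<sigma>2 ` S = S" "\<sigma>2 ` T = T" for S T
    by (rule set_projection_le_iff[OF B2 p2[OF that(1)] p2[OF that(2)]])
  have mono: "S \<subseteq> T \<longleftrightarrow> \<Phi> S \<subseteq> \<Phi> T" if "\<sigma>1 ` S = S" "\<sigma>1 ` T = T" for S T
  proof -
    have "S \<subseteq> T \<longleftrightarrow> \<phi> (p1 S * p1 T) = \<phi> (p1 S)"
      using le1[OF that] inj by simp
    then show ?thesis
      using le2[OF \<Phi>(1)[OF that(1)] \<Phi>(1)[OF that(2)]] by (simp add: mult \<Phi>(2) that)
  qed
  have bij_\<Phi>: "bij_betw \<Phi> {S. \<sigma>1 ` S = S} {S. \<sigma>2 ` S = S}"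
  proof (rule bij_betwI')
    fix S T assume "S \<in> {S. \<sigma>1 ` S = S}" "T \<in> {S. \<sigma>1 ` S = S}"
    then show "(\<Phi> S = \<Phi> T) = (S = T)"
      using mono[of S T] mono[of T S] by auto
  next
    fix T assume "T \<in> {S. \<sigma>2 ` S = S}"
    then have T: "\<sigma>2 ` T = T" by simp
    note props = set_projection_props[OF B2 p2[OF T]]
    obtain p where p: "p \<in> B1" "\<phi> p = p2 T"
      using props(1) \<phi>(2) by auto
    have "\<phi> (star p) = \<phi> p" "\<phi> (p * p) = \<phi> p"
      using props(2,3) by (simp_all add: p(2) star mult)
    then have "star p = p" "p * p = p"
      by (simp_all only: inj)
    with projection_is_set_projection[OF B1 p(1)] obtain S where S: "\<sigma>1 ` S = S" "set_projection U1 S p"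
      by blast
    then have "p = p1 S"
      using set_projection_unique[OF B1] p1 by blast
    then have eq: "p2 (\<Phi> S) = p2 T"
      using \<Phi>(2)[OF S(1)] p(2) by simp
    \<comment> \<open>Equal projections come from equal sets, by comparing them in both
      orders.\<close>
    have "p2 (\<Phi> S) * p2 T = p2 (\<Phi> S)" "p2 T * p2 (\<Phi> S) = p2 T"
      unfolding eq by (rule props(3))+
    then have "\<Phi> S = T"
      unfolding le2[OF \<Phi>(1)[OF S(1)] T] le2[OF T \<Phi>(1)[OF S(1)]] by (rule subset_antisym)
    then show "\<exists>S\<in>{S. \<sigma>1 ` S = S}. T = \<Phi> S"
      using S(1) by auto
  qed (use \<Phi>(1) in auto)
  have card_\<Phi>: "card (\<Phi> S) = card S" if S: "\<sigma>1 ` S = S" for S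
  proof -
    have one: "(1::complex) \<in> sphere 0 1" by simp
    have "trace (circle_fun (\<phi> (p1 S)) 1) = of_nat (card S)"
      by (rule cstar_automorphism_trace[OF \<phi>(1) set_projection_props(4)[OF B1 p1[OF S]] one])
    then have "of_nat (card (\<Phi> S)) = (of_nat (card S) :: complex)"
      using set_projection_props(4)[OF B2 p2[OF \<Phi>(1)[OF S]] one] by (simp add: \<Phi>(2)[OF S])
    then show ?thesis by (simp only: of_nat_eq_iff)
  qed
  show ?thesis
    by (rule conjugate_if_isomorphic_invariant_sets[of \<sigma>1 \<sigma>2 \<Phi>])
       (use cartan_dataD(3)[OF B1] cartan_dataD(3)[OF B2] bij_\<Phi> mono card_\<Phi> in blast)+
qed

section \<open>Cartan subalgebras with prescribed monodromy\<close>

text \<open>W commutes with its adjoint, so it is unitarily diagonalizable with eigenvalues of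
  modulus 1, whose arguments are scaled down to 0.\<close>

lemma exists_unitary_path:
  fixes W :: "complex^'n^'n"
  assumes W: "unitary_mat W"
  obtains U where "continuous_on {0..1} U" "\<And>t. unitary_mat (U t)" "U 0 = mat 1" "U (1::real) = W"
proof -
  have comm: "a ** b = b ** a" if "a \<in> {W, conj_transpose W}" "b \<in> {W, conj_transpose W}" for a b
    using that unitary_mat_left[OF W] unitary_mat_right[OF W] by auto
  obtain V where V: "unitary_mat V" "\<And>a. a \<in> {W, conj_transpose W} \<Longrightarrow> diagonal_mat (conj_transpose V ** a ** V)"
    by (rule simultaneous_diagonalization[of "{W, conj_transpose W}"]) (use comm in auto)
  define D where "D = conjugate_mat (conj_transpose V) W"
  have "diagonal_mat D"
    using V(2)[of W] by (simp add: D_def conjugate_mat_def)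
  then obtain e where e: "D = diag_mat e"
    using diagonal_mat_eq by blast
  have "conj_transpose D ** D = mat 1"
    unfolding D_def conj_transpose_conjugate_mat
    by (simp add: conjugate_mat_mult[symmetric] unitary_mat_conj_transpose V(1) unitary_mat_left[OF W] conjugate_mat_1)
  then have "diag_mat (\<lambda>i. cnj (e i) * e i) = diag_mat (\<lambda>_. 1)"
    by (simp add: e conj_transpose_monomial_mat monomial_mat_mult diag_mat_1)
  then have "e i * cnj (e i) = 1" for i
    by (simp add: fun_eq_iff mult.commute)
  then have "(cmod (e i))\<^sup>2 = 1" for i
    by (metis complex_norm_square of_real_eq_1_iff)
  then have norm_e: "cmod (e i) = 1" for i
    using power2_eq_1_iff[of "cmod (e i)"] norm_ge_zero[of "e i"] by auto
  have cis: "cis (Arg (e i)) = e i" for i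
  proof -
    have "e i \<noteq> 0" using norm_e[of i] by force
    then show ?thesis by (simp add: cis_Arg sgn_eq norm_e)
  qed
  define U where "U t = conjugate_mat V (diag_mat (\<lambda>i. cis (t * Arg (e i))))" for t
  show ?thesis
  proof (rule that[of U])
    show "continuous_on {0..1} U"
      unfolding U_def
      by (intro continuous_on_conjugate_mat continuous_on_monomial_mat continuous_intros)
    show "unitary_mat (U t)" for t
      unfolding U_def conjugate_mat_def
      by (intro unitary_mat_mult unitary_mat_conj_transpose V(1) unitary_monomial_mat) auto
    show "U 0 = mat 1"
      by (simp add: U_def diag_mat_1 conjugate_mat_1 V(1))
    have "U 1 = conjugate_mat V D"
      by (simp add: U_def cis e)
    then show "U 1 = W"
      by (simp add: D_def conjugate_mat_inverse V(1))
  qed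
qed

lemma exists_cartan_data_of_permutation:
  fixes \<sigma> :: "'n::finite \<Rightarrow> 'n"
  assumes "bij \<sigma>"
  shows "\<exists>U B. cartan_data U \<sigma> (\<lambda>_. 1) B"
proof -
  have "unitary_mat (monomial_mat \<sigma> (\<lambda>_. 1))"
    using assms by (intro unitary_monomial_mat) auto
  then obtain U where "continuous_on {0..1} U" "\<And>t. unitary_mat (U t)" "U 0 = mat 1"
    "U (1::real) = monomial_mat \<sigma> (\<lambda>_. 1)"
    using exists_unitary_path by blast
  with assms show ?thesis
    unfolding cartan_data_def by (intro exI[of _ U]) simp
qed

section \<open>Pinching to the diagonal\<close>

definition diagonal_part :: "complex^'n^'n \<Rightarrow> complex^'n^'n" where
  "diagonal_part A = diag_mat (\<lambda>i. A $ i $ i)"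

text \<open>Taking diagonals is compatible with the twist at the seam, so pinching in frame
  coordinates is well defined on the circle.\<close>

lemma diagonal_part_conjugate_monomial:
  assumes "bij \<sigma>" "\<And>i. cmod (c i) = 1"
  shows "conjugate_mat (monomial_mat \<sigma> c) (diagonal_part A) = diagonal_part (conjugate_mat (monomial_mat \<sigma> c) A)"
proof -
  have "A $ inv' \<sigma> k $ inv' \<sigma> k = conjugate_mat (monomial_mat \<sigma> c) A $ k $ k" for k
  proof -
    have "c i * x * cnj (c i) = x" for x i
      using assms(2)[of i] complex_norm_square[of "c i"] by (simp add: mult_ac)
    moreover have "k = \<sigma> (inv' \<sigma> k)"
      using assms(1) by (simp add: bij_is_surj surj_f_inv_f)
    ultimately show ?thesis
      using monomial_mat_conjugate_entry[OF assms(1), of c A "inv' \<sigma> k" "inv' \<sigma> k"] by simp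
  qed
  then show ?thesis
    unfolding diagonal_part_def conjugate_monomial_diag_mat[OF assms] by simp
qed

lemma diagonal_mat_commute: "diagonal_mat X \<Longrightarrow> diagonal_mat Y \<Longrightarrow> X ** Y = Y ** X"
proof -
  assume "diagonal_mat X" "diagonal_mat Y"
  then obtain f g where "X = diag_mat f" "Y = diag_mat g"
    using diagonal_mat_eq by blast
  then show ?thesis by (simp add: monomial_mat_mult mult.commute)
qed

lemma opnorm_unitary_le: "unitary_mat U \<Longrightarrow> opnorm U \<le> 1"
proof -
  assume "unitary_mat U"
  then have "(opnorm U)\<^sup>2 = opnorm (mat 1 :: complex^'a^'a)"
    by (simp add: opnorm_cstar[symmetric] unitary_mat_left)
  also have "\<dots> \<le> 1" by (rule opnorm_le) simp_all
  finally show ?thesis by (simp add: power2_le_iff_abs_le abs_square_le_1)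
qed

lemma opnorm_conjugate_mat_le:
  assumes "unitary_mat U"
  shows "opnorm (conjugate_mat U A) \<le> opnorm A"
proof -
  have "opnorm (conjugate_mat U A) \<le> opnorm U * opnorm A * opnorm (conj_transpose U)"
    unfolding conjugate_mat_def
    by (rule order_trans[OF opnorm_mult mult_right_mono[OF opnorm_mult]]) simp
  also have "\<dots> \<le> 1 * opnorm A * 1"
    using opnorm_unitary_le[OF assms] by (intro mult_mono) simp_all
  finally show ?thesis by simp
qed

lemma opnorm_diagonal_part_le: "opnorm (diagonal_part A) \<le> opnorm A"
proof (rule opnorm_le)
  fix x :: "complex^'a"
  have entry: "(diagonal_part A *v x) $ i = A $ i $ i * x $ i" for i
    by (simp add: diagonal_part_def monomial_mat_def matrix_vector_mult_def if_distrib[of "\<lambda>x. x * _"] cong: if_cong)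
  have "norm (diagonal_part A *v x) \<le> L2_set (\<lambda>i. opnorm A * norm (x $ i)) UNIV"
    unfolding norm_vec_def
    by (intro L2_set_mono) (simp_all add: entry norm_mult mult_right_mono opnorm_entry_le)
  also have "\<dots> = opnorm A * norm x"
    by (simp add: L2_set_right_distrib norm_vec_def)
  finally show "norm (diagonal_part A *v x) \<le> opnorm A * norm x" .
qed simp

section \<open>The Cartan axioms in frame coordinates\<close>

context
  fixes U \<sigma> d and B :: "'n::finite circle_matrix_algebra set"
  assumes B: "cartan_data U \<sigma> d B"
begin

text \<open>In these coordinates the algebra becomes the paths satisfying the twisted boundary
  condition of \<open>coords_loop\<close>, and \<open>B\<close> the diagonal ones among
  them.\<close>

definition coords :: "'n circle_matrix_algebra \<Rightarrow> real \<Rightarrow> complex^'n^'n" where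
  "coords a t = conjugate_mat (conj_transpose (U t)) (circle_fun a (circle_pt t))"

lemma unitary_U: "t \<in> {0..1} \<Longrightarrow> unitary_mat (U t)"
  using cartan_dataD(2)[OF B] .

lemma in_B_iff: "a \<in> B \<longleftrightarrow> (\<forall>t\<in>{0..1}. diagonal_mat (coords a t))"
  unfolding coords_def using cartan_dataD(6)[OF B] .

lemma coords_eqI: "(\<And>t. t \<in> {0..1} \<Longrightarrow> coords a t = coords b t) \<Longrightarrow> a = b"
  unfolding coords_def by (rule circle_ext_path) (metis conjugate_mat_inverse(2) unitary_U)

lemma continuous_on_coords: "continuous_on {0..1} (coords a)"
  unfolding coords_def[abs_def]
  by (intro continuous_on_conjugate_mat continuous_on_conj_transpose cartan_dataD(1)[OF B] continuous_circle_fun_path)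

lemma coords_loop: "coords a 0 = conjugate_mat (monomial_mat \<sigma> d) (coords a 1)"
  using frame_coordinates_loop[OF B, of a] by (simp add: coords_def)

lemma exists_coords:
  assumes "continuous_on {0..1} X" "conjugate_mat (monomial_mat \<sigma> d) (X 1) = X 0"
  shows "\<exists>a. \<forall>t\<in>{0..1}. coords a t = X t"
proof -
  obtain a where "\<And>t. t \<in> {0..1} \<Longrightarrow> circle_fun a (circle_pt t) = conjugate_mat (U t) (X t)"
    using exists_circle_fun_in_frame[OF B assms] by blast
  then show ?thesis
    using conjugate_mat_inverse(1)[OF unitary_U] by (intro exI[of _ a]) (simp add: coords_def)
qed

lemma coords_add: "coords (a + b) t = coords a t + coords b t"
  and coords_scaleC: "coords (c *\<^sub>C a) t = matscale c (coords a t)"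
  and coords_star: "coords (star a) t = conj_transpose (coords a t)"
  by (simp_all add: coords_def circle_fun_add circle_fun_scaleC circle_fun_star conjugate_mat_add
      conjugate_mat_matscale conj_transpose_conjugate_mat)

lemma coords_mult: "t \<in> {0..1} \<Longrightarrow> coords (a * b) t = coords a t ** coords b t"
  by (simp add: coords_def circle_fun_mult conjugate_mat_mult unitary_mat_conj_transpose unitary_U)

lemma coords_sum: "coords (\<Sum>i\<in>I. f i) t = (\<Sum>i\<in>I. coords (f i) t)"
proof (induction I rule: infinite_finite_induct)
  have "coords 0 t = 0" by (simp add: coords_def circle_rep_eqs')
  then show "coords (sum f A) t = (\<Sum>i\<in>A. coords (f i) t)" if "infinite A" for A
    using that by simp
  show "coords (sum f {}) t = (\<Sum>i\<in>{}. coords (f i) t)"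
    using \<open>coords 0 t = 0\<close> by simp
qed (simp add: coords_add)

lemma exists_pinching: "\<exists>b. \<forall>t\<in>{0..1}. coords b t = diagonal_part (coords a t)"
proof (rule exists_coords)
  show "continuous_on {0..1} (\<lambda>t. diagonal_part (coords a t))"
    unfolding diagonal_part_def
    by (intro continuous_on_monomial_mat continuous_intros continuous_on_coords)
  show "conjugate_mat (monomial_mat \<sigma> d) (diagonal_part (coords a 1)) = diagonal_part (coords a 0)"
    unfolding coords_loop[of a]
    by (rule diagonal_part_conjugate_monomial[OF cartan_dataD(3,4)[OF B]])
qed

definition pinching :: "'n circle_matrix_algebra \<Rightarrow> 'n circle_matrix_algebra" where
  "pinching a = (SOME b. \<forall>t\<in>{0..1}. coords b t = diagonal_part (coords a t))"

lemma coords_pinching: "t \<in> {0..1} \<Longrightarrow> coords (pinching a) t = diagonal_part (coords a t)"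
  unfolding pinching_def using someI_ex[OF exists_pinching[of a]] by blast

lemma pinching_in_B: "pinching a \<in> B"
  by (simp add: in_B_iff coords_pinching) (simp add: diagonal_part_def)

lemma pinching_id: "b \<in> B \<Longrightarrow> pinching b = b"
  by (rule coords_eqI) (simp add: coords_pinching diagonal_part_def in_B_iff diagonal_mat_eq[symmetric])

lemma commute_in_B:
  assumes "x \<in> B" "y \<in> B"
  shows "x * y = y * x"
  by (rule coords_eqI) (use assms in \<open>simp add: coords_mult in_B_iff diagonal_mat_commute\<close>)

lemma star_in_B: "b \<in> B \<Longrightarrow> star b \<in> B"
  by (simp add: in_B_iff coords_star) (simp add: diagonal_mat_def conj_transpose_def)

lemma commutant_B: "commutant B = B"
proof
  show "B \<subseteq> commutant B"
    using commute_in_B by (auto simp: commutant_def)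
  show "commutant B \<subseteq> B"
  proof
    fix f assume f: "f \<in> commutant B"
    have "coords f t $ k $ i = 0" if t: "t \<in> {0..1}" and "k \<noteq> i" for t k i
    proof -
      define e :: "'n \<Rightarrow> complex" where "e j = (if j = i then 1 else 0)" for j
      \<comment> \<open>An element of \<open>B\<close> with a prescribed diagonal at t: the constant
        function with the right value there, pinched into \<open>B\<close>. Commuting with it kills
        column i of \<open>coords f t\<close> off the diagonal.\<close>
      define b where "b = pinching (const_circle (conjugate_mat (U t) (diag_mat e)))"
      have "coords b t = diag_mat e"
        using t by (simp add: b_def coords_pinching)
          (simp add: coords_def conjugate_mat_inverse unitary_U diagonal_part_def monomial_mat_def)
      moreover have "b \<in> B" by (simp add: b_def pinching_in_B)
      then have "f * b = b * f"
        using f by (simp add: commutant_def)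
      then have "coords f t ** coords b t = coords b t ** coords f t"
        by (simp only: coords_mult[OF t, symmetric])
      ultimately have "(coords f t ** diag_mat e) $ k $ i = (diag_mat e ** coords f t) $ k $ i"
        by simp
      then show ?thesis
        using \<open>k \<noteq> i\<close>
        by (simp add: matrix_matrix_mult_def monomial_mat_def e_def if_distrib[of "(*) _"]
            if_distrib[of "\<lambda>x. x * _"] cong: if_cong)
    qed
    then show "f \<in> B"
      by (auto simp: in_B_iff diagonal_mat_def)
  qed
qed

lemma maximal_abelian_B: "maximal_abelian B"
proof -
  have "abelian_cstar_subalgebra B"
    using cstar_subalgebra_commutant[OF star_in_B] commute_in_B
    by (auto simp: abelian_cstar_subalgebra_def commutant_B)
  moreover have "C = B" if "abelian_cstar_subalgebra C" "B \<subseteq> C" for C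
  proof -
    have "C \<subseteq> commutant B"
      using that by (auto simp: abelian_cstar_subalgebra_def commutant_def)
    then show ?thesis using that(2) by (simp add: commutant_B)
  qed
  ultimately show ?thesis by (auto simp: maximal_abelian_def)
qed

lemma coords_const_1: "t \<in> {0..1} \<Longrightarrow> coords (const_circle (mat 1)) t = mat 1"
  by (simp add: coords_def conjugate_mat_1 unitary_mat_conj_transpose unitary_U)

text \<open>The algebra is unital and its unit lies in \<open>B\<close>; the principal filter at the
  unit is that of a constant net.\<close>

lemma contains_approximate_unit_B: "contains_approximate_unit B"
proof -
  define u :: "'n circle_matrix_algebra" where "u = const_circle (mat 1)"
  have u: "u * a = a" "a * u = a" for a
    by (rule circle_eqI; simp add: circle_rep_eqs' u_def)+
  have "star u = u"
    by (rule circle_eqI) (simp add: circle_rep_eqs' u_def)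
  then have "positive_element u"
    unfolding positive_element_def by (metis u(1))
  moreover have "norm u \<le> 1"
    by (rule circle_norm_le) (simp add: u_def opnorm_le)
  moreover have "diagonal_mat (mat 1 :: complex^'n^'n)"
    by (simp add: diagonal_mat_def mat_def)
  then have "u \<in> B"
    by (simp add: in_B_iff u_def coords_const_1)
  moreover have "((\<lambda>e. e * a) \<longlongrightarrow> a) (principal {u})" "((\<lambda>e. a * e) \<longlongrightarrow> a) (principal {u})" for a
    by (rule topological_tendstoI; simp add: eventually_principal u)+
  ultimately show ?thesis
    unfolding contains_approximate_unit_def
    by (intro exI[of _ "principal {u}"]) (simp add: eventually_principal principal_eq_bot_iff)
qed

text \<open>This entry is the squared length of x u_i for the frame vector u_i. It has an explicit
  continuous square root, which serves positivity, and it vanishes only if x kills u_i, which serves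
  faithfulness.\<close>

lemma coords_star_mult_self_diagonal:
  assumes "t \<in> {0..1}"
  shows "coords (star x * x) t $ i $ i =
    complex_of_real ((norm (circle_fun x (circle_pt t) *v column i (U t)))\<^sup>2)"
proof -
  have "coords (star x * x) t = conj_transpose (U t) ** (conj_transpose (circle_fun x (circle_pt t)) ** circle_fun x (circle_pt t)) ** U t"
    by (simp add: coords_def conjugate_mat_def circle_fun_mult circle_fun_star)
  also have "\<dots> $ i $ i = cinner (circle_fun x (circle_pt t) *v column i (U t)) (circle_fun x (circle_pt t) *v column i (U t))"
    unfolding conj_transpose_sandwich_entry matrix_vector_mul_assoc[symmetric]
    by (simp add: cinner_mat)
  finally show ?thesis by (simp add: cinner_self)
qed

lemma conditional_expectation_pinching: "conditional_expectation_onto B pinching"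
  unfolding conditional_expectation_onto_def
proof (intro conjI allI ballI impI)
  show "pinching (x + y) = pinching x + pinching y" for x y
    by (rule coords_eqI) (simp add: coords_pinching coords_add diagonal_part_def, simp add: monomial_mat_def vec_eq_iff)
  show "pinching (c *\<^sub>C x) = c *\<^sub>C pinching x" for c x
    by (rule coords_eqI) (simp add: coords_pinching coords_scaleC diagonal_part_def, simp add: monomial_mat_def vec_eq_iff matscale_def)
  show "norm (pinching a) \<le> norm a" for a
  proof (rule circle_norm_le)
    fix z :: complex assume z: "z \<in> sphere 0 1"
    define t where "t = Arg2pi z / (2 * pi)"
    have t: "t \<in> {0..1}" "z = circle_pt t"
      using Arg2pi_in_unit_interval circle_pt_Arg2pi[OF z] by (auto simp: t_def)
    have eq: "circle_fun (pinching a) z = conjugate_mat (U t) (coords (pinching a) t)"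
      using t by (simp add: coords_def conjugate_mat_inverse unitary_U)
    have "opnorm (circle_fun (pinching a) z) \<le> opnorm (diagonal_part (coords a t))"
      unfolding eq coords_pinching[OF t(1)] by (rule opnorm_conjugate_mat_le[OF unitary_U[OF t(1)]])
    also have "\<dots> \<le> opnorm (coords a t)" by (rule opnorm_diagonal_part_le)
    also have "\<dots> \<le> opnorm (circle_fun a z)"
      unfolding coords_def t(2) by (intro opnorm_conjugate_mat_le unitary_mat_conj_transpose unitary_U t)
    also have "\<dots> \<le> norm a" by (rule opnorm_le_circle_norm[OF z])
    finally show "opnorm (circle_fun (pinching a) z) \<le> norm a" .
  qed
  show "pinching (b * a) = b * pinching a" if b: "b \<in> B" for a b
  proof (rule coords_eqI)
    fix t :: real assume t: "t \<in> {0..1}"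
    obtain e where e: "coords b t = diag_mat e"
      using b t diagonal_mat_eq unfolding in_B_iff by blast
    have "diagonal_part (diag_mat e ** X) = diag_mat e ** diagonal_part X" for e and X :: "complex^'n^'n"
      by (simp add: diagonal_part_def monomial_mat_mult)
        (simp add: monomial_mat_def matrix_matrix_mult_def if_distrib[of "\<lambda>x. x * _"] cong: if_cong)
    then show "coords (pinching (b * a)) t = coords (b * pinching a) t"
      by (simp only: coords_pinching[OF t] coords_mult[OF t] e)
  qed
  show "pinching (a * b) = pinching a * b" if b: "b \<in> B" for a b
  proof (rule coords_eqI)
    fix t :: real assume t: "t \<in> {0..1}"
    obtain e where e: "coords b t = diag_mat e"
      using b t diagonal_mat_eq unfolding in_B_iff by blast
    have "diagonal_part (X ** diag_mat e) = diagonal_part X ** diag_mat e" for e and X :: "complex^'n^'n"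
      by (simp add: diagonal_part_def monomial_mat_mult)
        (simp add: monomial_mat_def matrix_matrix_mult_def if_distrib[of "(*) _"] cong: if_cong)
    then show "coords (pinching (a * b)) t = coords (pinching a * b) t"
      by (simp only: coords_pinching[OF t] coords_mult[OF t] e)
  qed
  show "positive_element (pinching a)" if a: "positive_element a" for a
  proof -
    obtain x where x: "a = star x * x" using a by (auto simp: positive_element_def)
    \<comment> \<open>Positivity means being of the form y^* y, so a root of the pinched element
      must be exhibited: the diagonal path whose entries are the lengths of x u_i.\<close>
    define \<rho> where "\<rho> t i = norm (circle_fun x (circle_pt t) *v column i (U t))" for t i
    define s where "s t i = complex_of_real (\<rho> t i)" for t i
    have diag: "diagonal_part (coords a t) = diag_mat (\<lambda>i. s t i * s t i)" if "t \<in> {0..1}" for t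
      unfolding diagonal_part_def x coords_star_mult_self_diagonal[OF that] s_def \<rho>_def
      by (simp add: power2_eq_square)
    note N = cartan_dataD(3,4)[OF B]
    have "diag_mat (\<lambda>i. s 0 i * s 0 i) = diagonal_part (coords a 0)"
      by (simp add: diag)
    also have "\<dots> = conjugate_mat (monomial_mat \<sigma> d) (diagonal_part (coords a 1))"
      unfolding coords_loop[of a] by (rule diagonal_part_conjugate_monomial[OF N, symmetric])
    also have "\<dots> = diag_mat (\<lambda>i. s 1 (inv' \<sigma> i) * s 1 (inv' \<sigma> i))"
      by (simp add: diag conjugate_monomial_diag_mat[OF N])
    finally have "diag_mat (\<lambda>i. s 1 (inv' \<sigma> i) * s 1 (inv' \<sigma> i)) = diag_mat (\<lambda>i. s 0 i * s 0 i)" ..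
    then have "s 1 (inv' \<sigma> i) * s 1 (inv' \<sigma> i) = s 0 i * s 0 i" for i
      by (simp add: fun_eq_iff)
    then have "\<rho> 1 (inv' \<sigma> i) * \<rho> 1 (inv' \<sigma> i) = \<rho> 0 i * \<rho> 0 i" for i
      by (simp only: s_def of_real_mult[symmetric] of_real_eq_iff)
    \<comment> \<open>The squares satisfy the boundary condition; nonnegativity transfers it to the
      roots.\<close>
    then have s_loop: "s 1 (inv' \<sigma> i) = s 0 i" for i
      using power2_eq_iff_nonneg[of "\<rho> 1 (inv' \<sigma> i)" "\<rho> 0 i"]
      by (simp add: power2_eq_square \<rho>_def s_def)
    have "\<exists>y. \<forall>t\<in>{0..1}. coords y t = diag_mat (s t)"
    proof (rule exists_coords)
      have "continuous_on {0..1} (\<lambda>t. column i (U t))" for i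
        unfolding column_def by (intro continuous_intros cartan_dataD(1)[OF B])
      then show "continuous_on {0..1} (\<lambda>t. diag_mat (s t))"
        unfolding s_def \<rho>_def
        by (intro continuous_on_monomial_mat continuous_intros continuous_on_matrix_vector_mult continuous_circle_fun_path)
      show "conjugate_mat (monomial_mat \<sigma> d) (diag_mat (s 1)) = diag_mat (s 0)"
        unfolding conjugate_monomial_diag_mat[OF N] s_loop ..
    qed
    then obtain y where y: "\<And>t. t \<in> {0..1} \<Longrightarrow> coords y t = diag_mat (s t)" by blast
    have "pinching a = star y * y"
    proof (rule coords_eqI)
      fix t :: real assume t: "t \<in> {0..1}"
      have "cnj (s t i) = s t i" for i by (simp add: s_def)
      then show "coords (pinching a) t = coords (star y * y) t"
        using t by (simp add: coords_pinching diag coords_mult coords_star y conj_transpose_monomial_mat monomial_mat_mult)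
    qed
    then show ?thesis by (auto simp: positive_element_def)
  qed
qed (simp_all add: pinching_in_B pinching_id)

text \<open>If the diagonal of x^* x vanishes, x kills every column of \<open>U t\<close>, and these
  form a basis.\<close>

lemma faithful_pinching: "faithful_map pinching"
  unfolding faithful_map_def
proof (intro allI impI)
  fix a assume a: "positive_element a \<and> pinching a = 0"
  then obtain x where x: "a = star x * x" by (auto simp: positive_element_def)
  have "x = 0"
  proof (rule circle_ext_path)
    fix t :: real assume t: "t \<in> {0..1}"
    have "diagonal_part (coords a t) = 0"
      using a coords_pinching[OF t, of a] by (simp add: coords_def circle_rep_eqs')
    then have "diagonal_part (coords a t) $ i $ i = 0" for i
      by simp
    then have "coords a t $ i $ i = 0" for i
      by (simp add: diagonal_part_def monomial_mat_def)
    then have "circle_fun x (circle_pt t) *v column i (U t) = 0" for i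
      unfolding x coords_star_mult_self_diagonal[OF t] by simp
    then have "circle_fun x (circle_pt t) ** U t = 0"
      by (simp add: vec_eq_iff matrix_matrix_mult_def matrix_vector_mult_def column_def)
    then have "circle_fun x (circle_pt t) ** U t ** conj_transpose (U t) = 0"
      by simp
    then show "circle_fun x (circle_pt t) = circle_fun 0 (circle_pt t)"
      by (simp add: matrix_mul_assoc[symmetric] unitary_mat_right[OF unitary_U[OF t]] circle_rep_eqs')
  qed
  then show "a = 0" by (simp add: x)
qed

text \<open>A matrix c e_pq turns diagonal matrices into multiples of e_pp or e_qq. The position may
  change with t, which admits functions supported around the seam, where the twist relabels the
  entry.\<close>

lemma single_entry_normalizer:
  assumes "\<And>t. t \<in> {0..1} \<Longrightarrow> \<exists>p q. \<forall>k l. coords n t $ k $ l \<noteq> 0 \<longrightarrow> k = p \<and> l = q"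
  shows "n \<in> cstar_normalizer B"
proof -
  have *: "diagonal_mat (X ** D ** conj_transpose X)" "diagonal_mat (conj_transpose X ** D ** X)"
    if X: "\<forall>k l. X $ k $ l \<noteq> 0 \<longrightarrow> k = p \<and> l = q" and D: "diagonal_mat D" for X D :: "complex^'n^'n" and p q
  proof -
    have "X = matscale (X $ p $ q) (mat_unit p q)"
      using X by (auto simp: matscale_def mat_unit_def vec_eq_iff)
    then obtain c where c: "X = matscale c (mat_unit p q)" by blast
    obtain e where e: "D = diag_mat e" using diagonal_mat_eq[OF D] by blast
    have adj: "conj_transpose X = matscale (cnj c) (mat_unit q p)"
      by (auto simp: c conj_transpose_def matscale_def mat_unit_def vec_eq_iff)
    have DU: "diag_mat e ** mat_unit i j = matscale (e i) (mat_unit i j)" for i j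
      by (simp add: monomial_mat_def mat_unit_def matrix_matrix_mult_def matscale_def vec_eq_iff
          if_distrib[of "\<lambda>x. x * _"] cong: if_cong)
    have UU: "mat_unit i j ** mat_unit j i = mat_unit i i" for i j :: 'n
    proof -
      have "(if k = i \<and> m = j then 1 else 0) * (if m = j \<and> l = i then 1 else 0) = 
        (if m = j then if k = i \<and> l = i then 1 else 0 else (0::complex))" for k l m
        by simp
      then show ?thesis
        by (simp add: mat_unit_def matrix_matrix_mult_def vec_eq_iff)
    qed
    have dg: "diagonal_mat (matscale x (mat_unit i i))" for x i
      by (auto simp: diagonal_mat_def matscale_def mat_unit_def)
    show "diagonal_mat (X ** D ** conj_transpose X)" "diagonal_mat (conj_transpose X ** D ** X)"
      unfolding adj unfolding c e
      by (simp_all add: matscale_mult_left matscale_mult_right matrix_mul_assoc[symmetric] DU UU matscale_matscale dg)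
  qed
  have "n * b * star n \<in> B" "star n * b * n \<in> B" if b: "b \<in> B" for b
  proof -
    have "diagonal_mat (coords (n * b * star n) t)" "diagonal_mat (coords (star n * b * n) t)"
      if t: "t \<in> {0..1}" for t
    proof -
      obtain p q where pq: "\<forall>k l. coords n t $ k $ l \<noteq> 0 \<longrightarrow> k = p \<and> l = q"
        using assms[OF t] by blast
      have "diagonal_mat (coords b t)" using b t by (simp add: in_B_iff)
      from *[OF pq this] show "diagonal_mat (coords (n * b * star n) t)" "diagonal_mat (coords (star n * b * n) t)"
        by (simp_all only: coords_mult[OF t] coords_star)
    qed
    then show "n * b * star n \<in> B" "star n * b * n \<in> B"
      unfolding in_B_iff by blast+
  qed
  then show ?thesis by (auto simp: cstar_normalizer_def)
qed

text \<open>A single matrix entry followed over the whole interval need not satisfy the boundary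
  condition. Normalizers supported near the seam are used to cancel the value of a there; afterwards
  every entry vanishes at both ends and is a normalizer by itself.\<close>

lemma normalizer_generates: "cstar_generated (cstar_normalizer B) = UNIV"
proof -
  have "a \<in> C" if C: "cstar_subalgebra C" and nC: "cstar_normalizer B \<subseteq> C" for a C
  proof -
    have add: "x + y \<in> C" if "x \<in> C" "y \<in> C" for x y
      using C that by (auto simp: cstar_subalgebra_def)
    have scale: "c *\<^sub>C x \<in> C" if "x \<in> C" for x c
      using C that by (auto simp: cstar_subalgebra_def)
    have zero: "0 \<in> C" using C by (simp add: cstar_subalgebra_def)
    have sum: "(\<Sum>i\<in>I. f i) \<in> C" if "\<And>i. f i \<in> C" for I and f :: "'n \<Rightarrow> _"
      by (induction I rule: infinite_finite_induct) (simp_all add: zero add that)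
    let ?N = "monomial_mat \<sigma> d"
    have unN: "unitary_mat ?N"
      using cartan_dataD(3,4)[OF B] by (rule unitary_monomial_mat)
    have "\<exists>n. n \<in> C \<and> coords n 0 = mat_unit i j" for i j
    proof -
      \<comment> \<open>A bump equal to 1 at t = 0 and to 0 from t = 1/2 on. Thus at most one of
        \<open>r t\<close> and \<open>r (1 - t)\<close> is nonzero, and \<open>X t\<close> has at
        most one nonzero entry.\<close>
      define r where "r t = complex_of_real (max 0 (1 - 2 * t))" for t
      define Y where "Y = conjugate_mat (conj_transpose ?N) (mat_unit i j)"
      define X where "X t = matscale (r t) (mat_unit i j) + matscale (r (1 - t)) Y" for t
      have "continuous_on {0..1} X"
        unfolding X_def r_def by (intro continuous_intros continuous_on_matscale_fun)
      moreover have "conjugate_mat ?N (X 1) = X 0"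
        by (simp add: X_def r_def Y_def conjugate_mat_inverse unN)
      ultimately obtain n where n: "\<And>t. t \<in> {0..1} \<Longrightarrow> coords n t = X t"
        using exists_coords by blast
      have "n \<in> cstar_normalizer B"
      proof (rule single_entry_normalizer)
        fix t :: real assume t: "t \<in> {0..1}"
        have inj: "\<sigma> k = \<sigma> l \<longleftrightarrow> k = l" for k l
          using cartan_dataD(3)[OF B] by (simp add: bij_def inj_eq)
        obtain p q where pq: "i = \<sigma> p" "j = \<sigma> q"
          using cartan_dataD(3)[OF B] by (metis bij_pointE)
        show "\<exists>p q. \<forall>k l. coords n t $ k $ l \<noteq> 0 \<longrightarrow> k = p \<and> l = q"
        proof (cases "t \<le> 1/2")
          case True
          then have "r (1 - t) = 0" by (simp add: r_def)
          then have "X t $ k $ l \<noteq> 0 \<longrightarrow> k = i \<and> l = j" for k l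
            by (simp add: X_def matscale_def mat_unit_def)
          then show ?thesis unfolding n[OF t] by blast
        next
          case False
          then have "r t = 0" by (simp add: r_def)
          then have "X t $ k $ l \<noteq> 0 \<longrightarrow> k = p \<and> l = q" for k l
            by (simp add: X_def Y_def matscale_def monomial_mat_conjugate_entry' mat_unit_def pq inj)
          then show ?thesis unfolding n[OF t] by blast
        qed
      qed
      moreover have "coords n 0 = mat_unit i j"
        by (simp add: n X_def r_def)
      ultimately show ?thesis using nC by blast
    qed
    then obtain n where n: "\<And>i j. n i j \<in> C" "\<And>i j. coords (n i j) 0 = mat_unit i j"
      by metis
    \<comment> \<open>Matches a at t = 0; the boundary condition then forces agreement at t = 1 as
      well.\<close>
    define m where "m = (\<Sum>i\<in>UNIV. \<Sum>j\<in>UNIV. (coords a 0 $ i $ j) *\<^sub>C n i j)"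
    have m: "m \<in> C" unfolding m_def by (intro sum scale n)
    have m0: "coords m 0 = coords a 0"
      by (simp add: m_def coords_sum coords_scaleC n sum_mat_units)
    define b where "b = a + (-1) *\<^sub>C m"
    have b0: "coords b 0 = 0"
      by (simp add: b_def coords_add coords_scaleC m0) (simp add: matscale_def vec_eq_iff)
    have "conjugate_mat (conj_transpose ?N) (coords b 0) = coords b 1"
      unfolding coords_loop[of b] by (rule conjugate_mat_inverse(1)[OF unN])
    then have b1: "coords b 1 = 0" by (simp add: b0)
    have "\<exists>g. g \<in> C \<and> (\<forall>t\<in>{0..1}. coords g t = matscale (coords b t $ i $ j) (mat_unit i j))" for i j
    proof -
      have "\<exists>g. \<forall>t\<in>{0..1}. coords g t = matscale (coords b t $ i $ j) (mat_unit i j)"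
        by (rule exists_coords)
          (intro continuous_on_matscale_fun continuous_intros continuous_on_coords, simp add: b0 b1)
      then obtain g where g: "\<And>t. t \<in> {0..1} \<Longrightarrow> coords g t = matscale (coords b t $ i $ j) (mat_unit i j)"
        by blast
      have "g \<in> cstar_normalizer B"
        by (rule single_entry_normalizer, rule exI[of _ i], rule exI[of _ j])
          (simp add: g matscale_def mat_unit_def)
      then show ?thesis using g nC by blast
    qed
    then obtain g where g: "\<And>i j. g i j \<in> C"
      "\<And>i j t. t \<in> {0..1} \<Longrightarrow> coords (g i j) t = matscale (coords b t $ i $ j) (mat_unit i j)"
      by metis
    have "b = (\<Sum>i\<in>UNIV. \<Sum>j\<in>UNIV. g i j)"
      by (rule coords_eqI) (simp add: coords_sum g sum_mat_units)
    then have "b \<in> C" using g(1) by (simp add: sum)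
    then have "b + 1 *\<^sub>C m \<in> C" by (intro add scale m)
    moreover have "b + 1 *\<^sub>C m = a"
      by (rule coords_eqI) (simp add: b_def coords_add coords_scaleC, simp add: matscale_def vec_eq_iff)
    ultimately show "a \<in> C" by simp
  qed
  then show ?thesis by (auto simp: cstar_generated_def)
qed

lemma cartan_subalgebra_of_data: "cartan_subalgebra B"
  unfolding cartan_subalgebra_def
  using maximal_abelian_B contains_approximate_unit_B normalizer_generates
    conditional_expectation_pinching faithful_pinching
  by (auto simp: maximal_abelian_def)

end

section \<open>Counting\<close>

lemma cartan_subalgebra_has_data:
  assumes "cartan_subalgebra B"
  shows "\<exists>\<sigma> U d. cartan_data U \<sigma> d B"
proof -
  obtain E where "conditional_expectation_onto B E"
    using assms by (auto simp: cartan_subalgebra_def)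
  then interpret masa_with_expectation B E
    using assms by unfold_locales (auto simp: cartan_subalgebra_def)
  show ?thesis using exists_cartan_data by blast
qed

theorem mainTheorem9:
  fixes n :: nat
  assumes "n \<ge> 1" and "CARD('n::finite) = n"
  shows "finite ({B :: 'n circle_matrix_algebra set. cartan_subalgebra B} // cartan_equivalence) \<and>
         card ({B :: 'n circle_matrix_algebra set. cartan_subalgebra B} // cartan_equivalence)
           = card (conjugacy_classes (sym_group n))"
proof -
  let ?C = "{B :: 'n circle_matrix_algebra set. cartan_subalgebra B}"
  \<comment> \<open>The monodromy depends on the chosen frame, so one value per subalgebra is fixed;
    only its conjugacy class is meaningful.\<close>
  define f where "f B = (SOME \<sigma>. \<exists>U d. cartan_data U \<sigma> d B)" for B :: "'n circle_matrix_algebra set"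
  have f: "\<exists>U d. cartan_data U (f B) d B" if "B \<in> ?C" for B
    unfolding f_def using someI_ex[OF cartan_subalgebra_has_data, of B] that by simp
  have bij: "bij (f B)" if "B \<in> ?C" for B
    using f[OF that] cartan_dataD(3) by blast
  have surj: "\<exists>B\<in>?C. \<exists>\<pi>. bij \<pi> \<and> \<pi> \<circ> f B = \<sigma> \<circ> \<pi>" if \<sigma>: "bij \<sigma>" for \<sigma> :: "'n \<Rightarrow> 'n"
  proof -
    obtain U B where B: "cartan_data U \<sigma> (\<lambda>_. 1) B"
      using exists_cartan_data_of_permutation[OF \<sigma>] by blast
    then have C: "B \<in> ?C"
      using cartan_subalgebra_of_data by simp
    then obtain U' d' where B': "cartan_data U' (f B) d' B"
      using f by blast
    \<comment> \<open>The choice \<open>f B\<close> may differ from \<sigma>, but both are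
      monodromies of \<open>B\<close>; the identity automorphism shows them to be conjugate.\<close>
    have "cstar_automorphism (\<lambda>x :: 'n circle_matrix_algebra. x)"
      using bij_id by (simp add: cstar_automorphism_def id_def)
    then have "\<exists>\<pi>. bij \<pi> \<and> \<pi> \<circ> f B = \<sigma> \<circ> \<pi>"
      by (rule conjugate_if_cartan_equivalent[OF B' B]) simp
    with C show ?thesis by blast
  qed
  have R: "(B, B') \<in> cartan_equivalence \<longleftrightarrow>
      B \<in> ?C \<and> B' \<in> ?C \<and> (\<exists>\<pi>. bij \<pi> \<and> \<pi> \<circ> f B = f B' \<circ> \<pi>)" for B B'
  proof (cases "B \<in> ?C \<and> B' \<in> ?C")
    case True
    then obtain U d U' d' where data: "cartan_data U (f B) d B" "cartan_data U' (f B') d' B'"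
      using f by blast
    have "(\<exists>\<phi>. cstar_automorphism \<phi> \<and> \<phi> ` B = B') \<longleftrightarrow> (\<exists>\<pi>. bij \<pi> \<and> \<pi> \<circ> f B = f B' \<circ> \<pi>)"
      using conjugate_if_cartan_equivalent[OF data] cartan_equivalent_if_conjugate[OF data] by metis
    with True show ?thesis by (simp add: cartan_equivalence_def)
  qed (auto simp: cartan_equivalence_def)
  show ?thesis
    using card_quotient_eq_card_conjugacy_classes[OF assms(2) bij surj R] by blast
qed

end
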